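(* Let $n\ge1$, let $(\lambda,\chi)\in\Omega_n$ and let $(\mu,\nu)=\iota_n(\lambda,\chi)\in\mathfrak P_2(n)$. Let $x$ be an indeterminate, and let $E_{n-1}$ be the $\mathbb Q(x)$-vector space with basis the symbols $e(\mu',\nu')$, $(\mu',\nu')\in\mathfrak P_2(n-1)$ (playing the role of the total Springer representations $\mathbf{TSp}_x(\mu',\nu')$). Then the two elements $A(\lambda,\chi)$ and $B(\mu,\nu)$ of $E_{n-1}$ defined below are equal; that is, the restriction formula for $\mathrm{Lie}\,Sp_{2n}$ in characteristic $2$ becomes, after replacing $q$ by $x$ and each $\mathbf{TSp}_q(-,-)$ by $\mathbf{TSp}_x(\iota(-,-))$, the exotic restriction formula with $q$ replaced by $x$. Definition of $A(\lambda,\chi)$. Write $m_r=m_\lambda(r)$, $m_{\ge r}=m_\lambda(\ge r)$, $m_{>r}=m_\lambda(>r)$, $X=\mathbf X_{\mathrm{crit}}^{(\lambda,\chi)}$, and $T(\lambda';Y)=e(\iota_{n-1}(\lambda',\Psi_{\lambda'}(Y)))$. Let $\lambda^{(r)}$ (resp. $\lambda^{[r]}$) be $\lambda$ with two parts $r$ replaced by two parts $r-1$ (resp. one part $r$ replaced by $r-2$). For critical $r$ put $X_r^*=(X\cup\{(r-1,\chi(r)-1)\})\setminus\{(r,\chi(r))\}$ and, if $\chi(r)=r/2$, $X_r^{**}=(X\cup\{(r-2,\frac{r-2}2)\})\setminus\{(r,\frac r2)\}$, $X_r^{***}=(X\cup\{(r-1,\frac{r-2}2)\})\setminus\{(r,\frac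 r2)\}$; let $j$ be the largest element of $\underline\lambda$ with $\chi(j)=\chi(r)$ and $r'-\chi(r')\ne j-\chi(r)$ for all $r'\in\underline\lambda$, $r'>j$. Then $A(\lambda,\chi)$ is $$\sum_{\substack{r\in\underline\lambda\\ \text{not critical}}}\Bigl[\tfrac{x^{m_{\ge r}-1}-x^{m_{>r}-1}}{x-1}T(\lambda^{(r)};X)+(x^{m_{\ge r}-1}-x^{m_{>r}-1})T(\lambda^{(r)};X\cup\{(r-1,\chi(r))\})\Bigr]$$ $$+\sum_{\substack{r\text{ critical}\\ \chi(r)\ne r/2}}\Bigl[x^{m_{\ge r}-1}T(\lambda^{(r)};X\cup\{(r-1,\chi(r))\})+\tfrac{x^{m_{\ge r}-1}-x^{m_{>r}+1}}{x-1}T(\lambda^{(r)};X)+x^{m_{>j}}T(\lambda^{(r)};X_r^* )+\sum_{\substack{k\in\underline\lambda\\ r<k\le j}}(x^{m_{\ge k}}-x^{m_{>k}})T(\lambda^{(r)};X_r^*\cup\{(k,\chi(r))\})\Bigr]$$ $$+\sum_{\substack{r\text{ critical}\\ \chi(r)=r/2,\ m_r\text{ odd}}}\Bigl[\tfrac{x^{m_{\ge r}-1}-x^{m_{>r}}}{x-1}T(\lambda^{(r)};X)+(x^{m_{\ge r}-1}-x^{m_{>r}})T(\lambda^{[r]};X\cup\{(r-2,\tfrac{r-2}2)\})+x^{m_{>j}}T(\lambda^{[r]};X_r^{**})+\sum_{\substack{k\in\underline\lambda\\ r<k\le j}}(x^{m_{\ge k}}-x^{m_{>k}})T(\lambda^{[r]};X_r^{**}\cup\{(k,\tfrac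 r2)\})\Bigr]$$ $$+\sum_{\substack{r\text{ critical}\\ \chi(r)=r/2,\ m_r\text{ even}}}\Bigl[x^{m_{\ge r}-1}T(\lambda^{[r]};X\cup\{(r-2,\tfrac{r-2}2)\})+\tfrac{x^{m_{\ge r}-1}-x^{m_{>r}+1}}{x-1}T(\lambda^{(r)};X)+x^{m_{>j}}T(\lambda^{(r)};X_r^{***})+\sum_{\substack{k\in\underline\lambda\\ r<k\le j}}(x^{m_{\ge k}}-x^{m_{>k}})T(\lambda^{(r)};X_r^{***}\cup\{(k,\tfrac r2)\})\Bigr],$$ ignoring terms whose coefficient is zero. Definition of $B(\mu,\nu)$. Let $\kappa=\mu+\nu$, and now write $m_{\ge r}=m(\ge r)=m_\kappa(\ge r)$, $m_{>r}=m(>r)=m_\kappa(>r)$, and, for $r\in\underline\kappa$, $M(\nu)=m_\nu(\ge\Delta(r))$, $M(\mu)=m_\mu(\ge\nabla(r))$. For $r\in\underline\kappa_v$ say: case 2 if $\nabla(r')>\nabla(r)$ and $\Delta(r')>\Delta(r)$ for all $r'\in\underline\kappa$, $r'>r$; case 3 if $\Delta(r')=\Delta(r)$ for some $r'\in\underline\kappa$, $r'>r$; case 4 if $\nabla(r')=\nabla(r)$ for some $r'\in\underline\kappa$, $r'>r$. In case 4 let $j$ be the largest element of $\underline\kappa$ with $\nabla(j)=\nabla(r)$ and $\Delta(r')\ne\Delta(j)$ for all $r'\in\underline\kappa$, $r'>j$. Then $B(\mu,\nu)$ is $$\sum_{r\in\underline\kappa\setminus\underline\kappa_v}\tfrac{x^{2m_{\ge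 r}}-x^{2m_{>r}}}{x-1}e(\mu,\nu[\Delta(r)\to\Delta(r)-1])$$ $$+\sum_{\text{case 2}}\Bigl[x^{2m_{\ge r}-1}e(\mu^{+[m(\ge r)+1,M(\nu)]},\nu^{-[m(\ge r),M(\nu)]})+\tfrac{x^{2m_{\ge r}-1}-x^{2m_{>r}+1}}{x-1}e(\mu[\nabla(r)\to\nabla(r)-1],\nu)+x^{2m_{>r}}e(\mu^{-[m(>r)+1,M(\mu)]},\nu^{+[m(>r)+1,M(\mu)-1]})\Bigr]$$ $$+\sum_{\text{case 3}}\Bigl[(x^{2m_{\ge r}-1}-x^{2m_{>r}-1})e(\mu^{+[m(\ge r)+1,M(\nu)]},\nu^{-[m(\ge r),M(\nu)]})+\tfrac{x^{2m_{\ge r}-1}-x^{2m_{>r}-1}}{x-1}e(\mu[\nabla(r)\to\nabla(r)-1],\nu)\Bigr]$$ $$+\sum_{\text{case 4}}\Bigl[x^{2m_{\ge r}-1}e(\mu^{+[m(\ge r)+1,M(\nu)]},\nu^{-[m(\ge r),M(\nu)]})+\tfrac{x^{2m_{\ge r}-1}-x^{2m_{>r}+1}}{x-1}e(\mu[\nabla(r)\to\nabla(r)-1],\nu)+x^{2m_{>j}}e(\mu^{-[m(>j)+1,M(\mu)]},\nu^{+[m(>j)+1,M(\mu)-1]})+\sum_{\substack{k\in\underline\kappa\\ r<k\le j}}(x^{2m_{\ge k}}-x^{2m_{>k}})e(\mu^{-[m(\ge k)+1,M(\mu)]},\nu^{+[m(\ge k)+1,M(\mu)-1]})\Bigr],$$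 ignoring terms whose coefficient is zero and the terms involving $\nu^{-[m(\ge r),M(\nu)]}$ when $\Delta(r)=0$.
   Context: Partitions: for a partition $\lambda=(\lambda_1\ge\lambda_2\ge\cdots)$, extended by zeros, $l(\lambda)$ is the number of positive parts, $m_\lambda(r)$ the number of parts equal to $r$, $m_\lambda(\ge r)$, $m_\lambda(>r)$ the number of parts $\ge r$, $>r$; $\underline\lambda$ is the set of positive parts without repetition; $\lambda+\mu=(\lambda_1+\mu_1,\lambda_2+\mu_2,\dots)$. $\lambda[a\to b]$ replaces one part $a$ by $b$. $\lambda^{+[a,b]}$ (resp. $\lambda^{-[a,b]}$) is obtained by increasing (resp. decreasing) the $i$-th part by $1$ for all $a\le i\le b$ and reordering if necessary; it is $\lambda$ if $[a,b]$ is empty. Zero parts are dropped. $\mathfrak P_2(n)$ is the set of pairs $(\mu,\nu)$ of partitions with $|\mu|+|\nu|=n$. $\Omega_n$ is the set of pairs $(\lambda,\chi)$ with $\lambda$ a partition of $2n$ and $\chi:\underline\lambda\to\mathbb Z_{\ge0}$ such that (1) $m_\lambda(r)$ is even for odd $r\in\underline\lambda$; (2) $0\le\chi(r)\le r/2$, with $\chi(r)=r/2$ if $m_\lambda(r)$ is odd; (3) for $r'\le r$ in $\underline\lambda$, $\chi(r')\le\chi(r)$ and $r'-\chi(r')\le r-\chi(r)$. $r\in\underline\lambda$ is critical for $(\lambda,\chi)$ if $\chi(r)\ne0$; $\chi(r')<\chi(r)$ for all $r'\in\underline\lambda$, $r'<r$; and $r'-\chi(r')>r-\chi(r)$ for all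 $r'\in\underline\lambda$, $r'>r$. $\mathbf X_{\mathrm{crit}}^{(\lambda,\chi)}=\{(r,\chi(r)):r\text{ critical}\}$. For a partition $\lambda'$ and a set $Y$ of pairs of non-negative integers, $\Psi_{\lambda'}(Y):\underline{\lambda'}\to\mathbb Z_{\ge0}$ is $\Psi_{\lambda'}(Y)(r)=\max(\{r-(a-b):(a,b)\in Y,a\ge r\}\cup\{b:(a,b)\in Y,a<r\}\cup\{0\})$. The bijection $\iota_n:\Omega_n\to\mathfrak P_2(n)$: given $(\lambda,\chi)$, choose $s$ with $2s\ge l(\lambda)$ and put $\chi(0)=0$. Partition $\{1,\dots,2s+1\}$ into blocks such that $\{i\}$ is a single block iff $\chi(\lambda_i)=\lambda_i/2$, and the other blocks are pairs of consecutive integers $\{i,i+1\}$ (then $\lambda_i=\lambda_{i+1}$). Set $c_i=\lambda_i/2$ for a single block $\{i\}$, and $c_i=\chi(\lambda_i)$, $c_{i+1}=\lambda_i-\chi(\lambda_i)$ for a block $\{i,i+1\}$. Then $\iota_n(\lambda,\chi)=(\mu,\nu)$ with $\mu=(c_1,c_3,\dots,c_{2s+1})$, $\nu=(c_2,c_4,\dots,c_{2s})$ (dropping zeros); this is independent of $s$. For $(\mu,\nu)\in\mathfrak P_2(n)$ and $\kappa=\mu+\nu$: $\nabla(\kappa_i)=\mu_i$, $\Delta(\kappa_i)=\nu_i$ define functions on $\underline\kappa\cup\{0\}$ ($\nabla(0)=\Delta(0)=0$), and $\underline\kappa_v=\{r\in\underline\kappa:\nabla(r)>\nabla(r')\text{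 for all }r'\in\underline\kappa\cup\{0\},\ r'<r\}$. *)

theory Defs
  imports
    "HOL-Computational_Algebra.Fraction_Field"
    "HOL-Computational_Algebra.Polynomial"
    "HOL-Library.Poly_Mapping"
    "HOL-Library.Disjoint_Sets"
begin

section \<open>Partitions\<close>

text \<open>
  A partition is the weakly decreasing list of its positive parts. So \<^term>\<open>length lam\<close> is the
  number of parts, \<^term>\<open>set lam\<close> is the set of parts without repetition, and
  \<^term>\<open>count_list lam r\<close> is the multiplicity of \<open>r\<close>. Parts are numbered from 1.
\<close>

definition is_partition :: "nat list \<Rightarrow> bool" where
  "is_partition lam \<longleftrightarrow> sorted_wrt (\<ge>) lam \<and> 0 \<notin> set lam"

definition part :: "nat list \<Rightarrow> nat \<Rightarrow> nat" where
  "part lam i = (if 1 \<le> i \<and> i \<le> length lam then lam ! (i - 1) else 0)"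

definition mult_ge :: "nat list \<Rightarrow> nat \<Rightarrow> nat" where
  "mult_ge lam r = length (filter (\<lambda>p. r \<le> p) lam)"

definition mult_gt :: "nat list \<Rightarrow> nat \<Rightarrow> nat" where
  "mult_gt lam r = length (filter (\<lambda>p. r < p) lam)"

definition to_partition :: "nat list \<Rightarrow> nat list" where
  "to_partition xs = rev (sort (filter (\<lambda>p. 0 < p) xs))"

definition part_add :: "nat list \<Rightarrow> nat list \<Rightarrow> nat list" where
  "part_add mu nu =
     map (\<lambda>i. part mu i + part nu i) [1..<max (length mu) (length nu) + 1]"

definition replace_part :: "nat \<Rightarrow> nat \<Rightarrow> nat list \<Rightarrow> nat list" where
  "replace_part a b lam = to_partition (b # remove1 a lam)"

text \<open>
  The interval may go beyond the number of parts when increasing: zero parts then become 1.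
  Decreasing is only meaningful when the parts concerned are positive.
\<close>

definition incr_parts :: "nat \<Rightarrow> nat \<Rightarrow> nat list \<Rightarrow> nat list" where
  "incr_parts a b lam =
     to_partition (map (\<lambda>i. part lam i + (if a \<le> i \<and> i \<le> b then 1 else 0))
       [1..<max (length lam) b + 1])"

definition decr_parts :: "nat \<Rightarrow> nat \<Rightarrow> nat list \<Rightarrow> nat list" where
  "decr_parts a b lam =
     to_partition (map (\<lambda>i. part lam i - (if a \<le> i \<and> i \<le> b then 1 else 0))
       [1..<length lam + 1])"

definition P2 :: "nat \<Rightarrow> (nat list \<times> nat list) set" where
  "P2 n = {(mu, nu). is_partition mu \<and> is_partition nu \<and> sum_list mu + sum_list nu = n}"


section \<open>The set \<open>\<Omega>\<close>, critical values and the map \<open>\<iota>\<close>\<close>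

text \<open>
  A function on \<^term>\<open>set lam\<close> is represented by its extension by zero to all natural numbers;
  in particular \<open>\<chi>(0) = 0\<close>. The conditions \<open>\<chi>(r) \<le> r/2\<close> and \<open>\<chi>(r) = r/2\<close> are stated without
  division.
\<close>

definition Omega :: "nat \<Rightarrow> (nat list \<times> (nat \<Rightarrow> nat)) set" where
  "Omega n = {(lam, chi).
     is_partition lam \<and> sum_list lam = 2 * n \<and>
     (\<forall>r. r \<notin> set lam \<longrightarrow> chi r = 0) \<and>
     (\<forall>r\<in>set lam. odd r \<longrightarrow> even (count_list lam r)) \<and>
     (\<forall>r\<in>set lam. 2 * chi r \<le> r \<and> (odd (count_list lam r) \<longrightarrow> 2 * chi r = r)) \<and>
     (\<forall>r\<in>set lam. \<forall>r'\<in>set lam. r' \<le> r \<longrightarrow> chi r' \<le> chi r \<and> r' - chi r' \<le> r - chi r)}"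

definition critical :: "nat list \<Rightarrow> (nat \<Rightarrow> nat) \<Rightarrow> nat \<Rightarrow> bool" where
  "critical lam chi r \<longleftrightarrow>
     r \<in> set lam \<and> chi r \<noteq> 0 \<and>
     (\<forall>r'\<in>set lam. r' < r \<longrightarrow> chi r' < chi r) \<and>
     (\<forall>r'\<in>set lam. r' > r \<longrightarrow> r' - chi r' > r - chi r)"

definition X_crit :: "nat list \<Rightarrow> (nat \<Rightarrow> nat) \<Rightarrow> (nat \<times> nat) set" where
  "X_crit lam chi = {(r, chi r) |r. critical lam chi r}"

text \<open>
  The maximum is taken over the integers, since \<open>r - (a - b)\<close> may be negative.
\<close>

definition Psi :: "nat list \<Rightarrow> (nat \<times> nat) set \<Rightarrow> nat \<Rightarrow> nat" where
  "Psi lam Y r =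
     (if r \<in> set lam
      then nat (Max ({int r - (int a - int b) |a b. (a, b) \<in> Y \<and> a \<ge> r} \<union>
                     {int b |a b. (a, b) \<in> Y \<and> a < r} \<union> {0}))
      else 0)"

definition is_blocks :: "nat list \<Rightarrow> (nat \<Rightarrow> nat) \<Rightarrow> nat \<Rightarrow> nat set set \<Rightarrow> bool" where
  "is_blocks lam chi s P \<longleftrightarrow>
     partition_on {1..2 * s + 1} P \<and>
     (\<forall>B\<in>P. \<exists>i. B = {i} \<or> B = {i, i + 1}) \<and>
     (\<forall>i\<in>{1..2 * s + 1}. {i} \<in> P \<longleftrightarrow> 2 * chi (part lam i) = part lam i)"

text \<open>
  The third branch concerns the second element of a block of two; by the shape of the blocks the
  corresponding two parts of \<open>lam\<close> are equal.
\<close>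

definition block_value :: "nat list \<Rightarrow> (nat \<Rightarrow> nat) \<Rightarrow> nat set set \<Rightarrow> nat \<Rightarrow> nat" where
  "block_value lam chi P i =
     (if {i} \<in> P then part lam i div 2
      else if {i, i + 1} \<in> P then chi (part lam i)
      else part lam i - chi (part lam i))"

text \<open>
  The choice of \<open>s\<close> does not matter on \<^const>\<open>Omega\<close>, and the blocks are determined by \<open>s\<close>.
\<close>

definition iota :: "nat list \<Rightarrow> (nat \<Rightarrow> nat) \<Rightarrow> nat list \<times> nat list" where
  "iota lam chi =
     (THE mn. \<exists>s P. 2 * s \<ge> length lam \<and> is_blocks lam chi s P \<and>
        mn = (filter (\<lambda>p. 0 < p) (map (\<lambda>i. block_value lam chi P (2 * i + 1)) [0..<s + 1]),
              filter (\<lambda>p. 0 < p) (map (\<lambda>i. block_value lam chi P (2 * i)) [1..<s + 1])))"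


section \<open>The vector spaces\<close>

type_synonym ratfun = "rat poly fract"

definition x_ind :: ratfun where
  "x_ind = Fraction_Field.Fract [:0, 1:] 1"

text \<open>
  Exponents are integers because \<open>-1\<close> does occur as an exponent.
\<close>

abbreviation xp :: "int \<Rightarrow> ratfun" where
  "xp k \<equiv> x_ind powi k"

text \<open>
  The free vector space on all pairs of lists; the space \<open>E\<close> of level \<open>m\<close> is the subspace spanned
  by the basis vectors indexed by \<^term>\<open>P2 m\<close>.
\<close>

type_synonym free_space = "(nat list \<times> nat list) \<Rightarrow>\<^sub>0 ratfun"

definition E_space :: "nat \<Rightarrow> free_space set" where
  "E_space m = {v. Poly_Mapping.keys v \<subseteq> P2 m}"

definition e_vec :: "nat list \<times> nat list \<Rightarrow> free_space" where
  "e_vec mn = Poly_Mapping.single mn 1"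

definition scale_E :: "ratfun \<Rightarrow> free_space \<Rightarrow> free_space" (infixr "*\<^sub>E" 75) where
  "c *\<^sub>E v = Poly_Mapping.map ((*) c) v"


section \<open>The restriction formula for \<open>Lie Sp\<close> in characteristic 2\<close>

definition T_vec :: "nat list \<Rightarrow> (nat \<times> nat) set \<Rightarrow> free_space" where
  "T_vec lam Y = e_vec (iota lam (Psi lam Y))"

definition lower_two :: "nat list \<Rightarrow> nat \<Rightarrow> nat list" where
  "lower_two lam r = replace_part r (r - 1) (replace_part r (r - 1) lam)"

definition lower_one :: "nat list \<Rightarrow> nat \<Rightarrow> nat list" where
  "lower_one lam r = replace_part r (r - 2) lam"

definition j_A :: "nat list \<Rightarrow> (nat \<Rightarrow> nat) \<Rightarrow> nat \<Rightarrow> nat" where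
  "j_A lam chi r =
     Max {j \<in> set lam. chi j = chi r \<and> (\<forall>r'\<in>set lam. r' > j \<longrightarrow> r' - chi r' \<noteq> j - chi r)}"

definition tail_A ::
    "nat list \<Rightarrow> (nat \<Rightarrow> nat) \<Rightarrow> nat \<Rightarrow> nat list \<Rightarrow> (nat \<times> nat) set \<Rightarrow> free_space" where
  "tail_A lam chi r lam' Y =
     (let j = j_A lam chi r in
        xp (int (mult_gt lam j)) *\<^sub>E T_vec lam' Y
      + (\<Sum>k | k \<in> set lam \<and> r < k \<and> k \<le> j.
           (xp (int (mult_ge lam k)) - xp (int (mult_gt lam k))) *\<^sub>E
             T_vec lam' (Y \<union> {(k, chi r)})))"

text \<open>
  Terms with zero coefficient vanish as vectors, so they need no special treatment.
\<close>

definition A_noncrit :: "nat list \<Rightarrow> (nat \<Rightarrow> nat) \<Rightarrow> nat \<Rightarrow> free_space" where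
  "A_noncrit lam chi r =
     (let X = X_crit lam chi; mge = int (mult_ge lam r); mgt = int (mult_gt lam r) in
        ((xp (mge - 1) - xp (mgt - 1)) / (x_ind - 1)) *\<^sub>E T_vec (lower_two lam r) X
      + (xp (mge - 1) - xp (mgt - 1)) *\<^sub>E T_vec (lower_two lam r) (X \<union> {(r - 1, chi r)}))"

definition A_crit_generic :: "nat list \<Rightarrow> (nat \<Rightarrow> nat) \<Rightarrow> nat \<Rightarrow> free_space" where
  "A_crit_generic lam chi r =
     (let X = X_crit lam chi; mge = int (mult_ge lam r); mgt = int (mult_gt lam r);
          X' = (X \<union> {(r - 1, chi r - 1)}) - {(r, chi r)} in
        xp (mge - 1) *\<^sub>E T_vec (lower_two lam r) (X \<union> {(r - 1, chi r)})
      + ((xp (mge - 1) - xp (mgt + 1)) / (x_ind - 1)) *\<^sub>E T_vec (lower_two lam r) X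
      + tail_A lam chi r (lower_two lam r) X')"

definition A_crit_half_odd :: "nat list \<Rightarrow> (nat \<Rightarrow> nat) \<Rightarrow> nat \<Rightarrow> free_space" where
  "A_crit_half_odd lam chi r =
     (let X = X_crit lam chi; mge = int (mult_ge lam r); mgt = int (mult_gt lam r);
          X' = (X \<union> {(r - 2, (r - 2) div 2)}) - {(r, r div 2)} in
        ((xp (mge - 1) - xp mgt) / (x_ind - 1)) *\<^sub>E T_vec (lower_two lam r) X
      + (xp (mge - 1) - xp mgt) *\<^sub>E T_vec (lower_one lam r) (X \<union> {(r - 2, (r - 2) div 2)})
      + tail_A lam chi r (lower_one lam r) X')"

definition A_crit_half_even :: "nat list \<Rightarrow> (nat \<Rightarrow> nat) \<Rightarrow> nat \<Rightarrow> free_space" where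
  "A_crit_half_even lam chi r =
     (let X = X_crit lam chi; mge = int (mult_ge lam r); mgt = int (mult_gt lam r);
          X' = (X \<union> {(r - 1, (r - 2) div 2)}) - {(r, r div 2)} in
        xp (mge - 1) *\<^sub>E T_vec (lower_one lam r) (X \<union> {(r - 2, (r - 2) div 2)})
      + ((xp (mge - 1) - xp (mgt + 1)) / (x_ind - 1)) *\<^sub>E T_vec (lower_two lam r) X
      + tail_A lam chi r (lower_two lam r) X')"

definition A_elem :: "nat list \<Rightarrow> (nat \<Rightarrow> nat) \<Rightarrow> free_space" where
  "A_elem lam chi =
     (\<Sum>r | r \<in> set lam \<and> \<not> critical lam chi r. A_noncrit lam chi r)
   + (\<Sum>r | critical lam chi r \<and> 2 * chi r \<noteq> r. A_crit_generic lam chi r)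
   + (\<Sum>r | critical lam chi r \<and> 2 * chi r = r \<and> odd (count_list lam r). A_crit_half_odd lam chi r)
   + (\<Sum>r | critical lam chi r \<and> 2 * chi r = r \<and> even (count_list lam r). A_crit_half_even lam chi r)"


section \<open>The exotic restriction formula\<close>

text \<open>
  \<open>\<nabla>\<close> and \<open>\<Delta>\<close> are well defined since equal parts of \<open>\<mu> + \<nu>\<close> come from equal parts of \<open>\<mu>\<close> and
  of \<open>\<nu>\<close>; at 0 these definitions give 0 because partitions are extended by zeros.
\<close>

definition nabla :: "nat list \<Rightarrow> nat list \<Rightarrow> nat \<Rightarrow> nat" where
  "nabla mu nu r = (THE y. \<exists>i\<ge>1. part (part_add mu nu) i = r \<and> part mu i = y)"

definition Delta :: "nat list \<Rightarrow> nat list \<Rightarrow> nat \<Rightarrow> nat" where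
  "Delta mu nu r = (THE y. \<exists>i\<ge>1. part (part_add mu nu) i = r \<and> part nu i = y)"

definition kappa_v :: "nat list \<Rightarrow> nat list \<Rightarrow> nat set" where
  "kappa_v mu nu =
     {r \<in> set (part_add mu nu).
        \<forall>r'\<in>set (part_add mu nu) \<union> {0}. r' < r \<longrightarrow> nabla mu nu r > nabla mu nu r'}"

definition case2 :: "nat list \<Rightarrow> nat list \<Rightarrow> nat \<Rightarrow> bool" where
  "case2 mu nu r \<longleftrightarrow>
     (\<forall>r'\<in>set (part_add mu nu). r' > r \<longrightarrow>
        nabla mu nu r' > nabla mu nu r \<and> Delta mu nu r' > Delta mu nu r)"

definition case3 :: "nat list \<Rightarrow> nat list \<Rightarrow> nat \<Rightarrow> bool" where
  "case3 mu nu r \<longleftrightarrow> (\<exists>r'\<in>set (part_add mu nu). r' > r \<and> Delta mu nu r' = Delta mu nu r)"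

definition case4 :: "nat list \<Rightarrow> nat list \<Rightarrow> nat \<Rightarrow> bool" where
  "case4 mu nu r \<longleftrightarrow> (\<exists>r'\<in>set (part_add mu nu). r' > r \<and> nabla mu nu r' = nabla mu nu r)"

definition j_B :: "nat list \<Rightarrow> nat list \<Rightarrow> nat \<Rightarrow> nat" where
  "j_B mu nu r =
     Max {j \<in> set (part_add mu nu). nabla mu nu j = nabla mu nu r \<and>
            (\<forall>r'\<in>set (part_add mu nu). r' > j \<longrightarrow> Delta mu nu r' \<noteq> Delta mu nu j)}"

text \<open>
  The vector \<open>e(\<mu>\<^sup>+, \<nu>\<^sup>-)\<close> that occurs in cases 2 to 4; it is to be ignored when \<open>\<Delta>(r) = 0\<close>.
\<close>

definition up_down :: "nat list \<Rightarrow> nat list \<Rightarrow> nat \<Rightarrow> free_space" where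
  "up_down mu nu r =
     (let m = mult_ge (part_add mu nu) r; M = mult_ge nu (Delta mu nu r) in
      if Delta mu nu r = 0 then 0
      else e_vec (incr_parts (m + 1) M mu, decr_parts m M nu))"

text \<open>
  The vector \<open>e(\<mu>\<^sup>-, \<nu>\<^sup>+)\<close> with intervals starting at \<open>a\<close>. It is used only for \<open>r\<close> in
  \<^const>\<open>kappa_v\<close>; then \<open>\<nabla>(r) > 0\<close> and hence \<open>M \<ge> 1\<close>.
\<close>

definition down_up :: "nat list \<Rightarrow> nat list \<Rightarrow> nat \<Rightarrow> nat \<Rightarrow> free_space" where
  "down_up mu nu r a =
     (let M = mult_ge mu (nabla mu nu r) in
      e_vec (decr_parts a M mu, incr_parts a (M - 1) nu))"

definition mu_lowered :: "nat list \<Rightarrow> nat list \<Rightarrow> nat \<Rightarrow> free_space" where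
  "mu_lowered mu nu r =
     e_vec (replace_part (nabla mu nu r) (nabla mu nu r - 1) mu, nu)"

definition B_outside :: "nat list \<Rightarrow> nat list \<Rightarrow> nat \<Rightarrow> free_space" where
  "B_outside mu nu r =
     (let mge = int (mult_ge (part_add mu nu) r); mgt = int (mult_gt (part_add mu nu) r) in
        ((xp (2 * mge) - xp (2 * mgt)) / (x_ind - 1)) *\<^sub>E
          e_vec (mu, replace_part (Delta mu nu r) (Delta mu nu r - 1) nu))"

definition B_case2 :: "nat list \<Rightarrow> nat list \<Rightarrow> nat \<Rightarrow> free_space" where
  "B_case2 mu nu r =
     (let mge = int (mult_ge (part_add mu nu) r); mgt = int (mult_gt (part_add mu nu) r) in
        xp (2 * mge - 1) *\<^sub>E up_down mu nu r
      + ((xp (2 * mge - 1) - xp (2 * mgt + 1)) / (x_ind - 1)) *\<^sub>E mu_lowered mu nu r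
      + xp (2 * mgt) *\<^sub>E down_up mu nu r (mult_gt (part_add mu nu) r + 1))"

definition B_case3 :: "nat list \<Rightarrow> nat list \<Rightarrow> nat \<Rightarrow> free_space" where
  "B_case3 mu nu r =
     (let mge = int (mult_ge (part_add mu nu) r); mgt = int (mult_gt (part_add mu nu) r) in
        (xp (2 * mge - 1) - xp (2 * mgt - 1)) *\<^sub>E up_down mu nu r
      + ((xp (2 * mge - 1) - xp (2 * mgt - 1)) / (x_ind - 1)) *\<^sub>E mu_lowered mu nu r)"

definition B_case4 :: "nat list \<Rightarrow> nat list \<Rightarrow> nat \<Rightarrow> free_space" where
  "B_case4 mu nu r =
     (let kap = part_add mu nu; j = j_B mu nu r;
          mge = int (mult_ge kap r); mgt = int (mult_gt kap r) in
        xp (2 * mge - 1) *\<^sub>E up_down mu nu r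
      + ((xp (2 * mge - 1) - xp (2 * mgt + 1)) / (x_ind - 1)) *\<^sub>E mu_lowered mu nu r
      + xp (2 * int (mult_gt kap j)) *\<^sub>E down_up mu nu r (mult_gt kap j + 1)
      + (\<Sum>k | k \<in> set kap \<and> r < k \<and> k \<le> j.
           (xp (2 * int (mult_ge kap k)) - xp (2 * int (mult_gt kap k))) *\<^sub>E
             down_up mu nu r (mult_ge kap k + 1)))"

definition B_elem :: "nat list \<times> nat list \<Rightarrow> free_space" where
  "B_elem = (\<lambda>(mu, nu).
     (\<Sum>r\<in>set (part_add mu nu) - kappa_v mu nu. B_outside mu nu r)
   + (\<Sum>r | r \<in> kappa_v mu nu \<and> case2 mu nu r. B_case2 mu nu r)
   + (\<Sum>r | r \<in> kappa_v mu nu \<and> case3 mu nu r. B_case3 mu nu r)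
   + (\<Sum>r | r \<in> kappa_v mu nu \<and> case4 mu nu r. B_case4 mu nu r))"

end

(*
  Interlace a pair of partitions to the sequence c = (mu_1, nu_1, mu_2, nu_2, ...), which satisfies
  c_(i+2) <= c_i. Putting H_i = min(c_(i-1), c_i) and K_i = max(c_i, c_(i+1)), the preimage of (mu, nu)
  under iota is lambda_i = H_i + K_i, chi(lambda_i) = H_i: the blocks of two are the ascents of c.
  Every vector in either restriction formula is obtained from c in the same way: on a run of equal
  entries c_p = c_(p+2) = ... = c_q the entries decrease by one, and the entries between them increase
  by one. This is legal if p = q, or if c_(p+1) < c_(p-1), so that the entry after p can be raised.
  Collecting terms by p and q instead of by the parts of lambda or of mu + nu, both formulas turn into
  one sum over the positions of c that treats mu and nu symmetrically.
*)

theory Submission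
  imports Defs
begin

subsection \<open>Partitions as decreasing functions\<close>

text \<open>Positions are counted from 0, so that exponents become positions. In \<open>lam\<close>
  the first and last places of a part r are m(>r) and m(>=r) - 1; in \<open>c\<close> the first
  mu-entry and the last nu-entry belonging to a part r of mu + nu stand at 2m(>r) and 2m(>=r) - 1.
  Hence the differences of powers in both formulas compare two consecutive legal starts of one run,
  the quotients by x - 1 are geometric sums over a stretch of positions, and either coefficient can
  be described by \<open>c\<close> alone. Two obstacles shape the proof. The vectors of the first
  formula are known only through Psi, so each one has to be recognised from the points (H_i, K_i) of
  the changed sequence. And the groupings differ: the parts of lambda arise from overlapping
  neighbours, those of mu + nu from disjoint pairs, so the same vector can sit in brackets of
  different parts. Each grouping is therefore encoded by functions that assign every position to the
  part whose bracket contains it.\<close>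

lemma part_Suc: "part l (Suc i) = (if i < length l then l ! i else 0)"
  by (simp add: part_def)

lemma part_Cons_Suc [simp]: "part (a # l) (Suc (Suc i)) = part l (Suc i)"
  by (simp add: part_def)

lemma part_Cons_1 [simp]: "part (a # l) (Suc 0) = a"
  by (simp add: part_def)

lemma is_partition_Cons:
  "is_partition (a # l) \<longleftrightarrow> 0 < a \<and> (\<forall>b\<in>set l. b \<le> a) \<and> is_partition l"
  by (auto simp: is_partition_def)

text \<open>Conjugation: \<open>mult_ge l t\<close> is the length of column t, and a column fills an
  initial stretch of rows. Positivity of \<open>t\<close> matters, because for \<open>t = 0\<close>
  the zero parts that extend \<open>l\<close> would count on the right but not on the left.\<close>

lemma less_mult_ge_iff:
  assumes "is_partition l" "0 < t"
  shows "i < mult_ge l t \<longleftrightarrow> t \<le> part l (Suc i)"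
  using assms
proof (induction l arbitrary: i)
  case Nil
  then show ?case by (simp add: mult_ge_def part_def)
next
  case (Cons a l)
  have p: "is_partition l" "\<forall>b\<in>set l. b \<le> a"
    using Cons.prems by (auto simp: is_partition_Cons)
  show ?case
  proof (cases "t \<le> a")
    case True
    then show ?thesis
      using Cons.IH[OF p(1) Cons.prems(2)]
      by (cases i) (auto simp: mult_ge_def)
  next
    case False
    then have "mult_ge (a # l) t = 0"
      using p(2) by (auto simp: mult_ge_def filter_empty_conv)
    moreover have "part (a # l) (Suc i) \<le> a"
      using p(2) by (cases i) (auto simp: part_Suc)
    ultimately show ?thesis using False by simp
  qed
qed

lemma mult_gt_eq: "mult_gt l r = mult_ge l (Suc r)"
  by (simp add: mult_gt_def mult_ge_def Suc_le_eq)

lemma less_mult_gt_iff: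
  assumes "is_partition l"
  shows "i < mult_gt l r \<longleftrightarrow> r < part l (Suc i)"
  using less_mult_ge_iff[OF assms, of "Suc r" i] by (simp add: mult_gt_eq Suc_le_eq)

lemma mult_ge_eq_gt_count: "mult_ge l r = mult_gt l r + count_list l r"
  by (induction l) (auto simp: mult_gt_def mult_ge_def)

lemma partition_eqI:
  assumes "is_partition l" "is_partition l'" "\<And>i. part l (Suc i) = part l' (Suc i)"
  shows "l = l'"
  using assms
proof (induction l arbitrary: l')
  case Nil
  then show ?case
    by (cases l') (use Nil.prems(3)[of 0] in \<open>auto simp: is_partition_Cons part_Suc\<close>)
next
  case (Cons a l)
  show ?case
  proof (cases l')
    case Nil
    then show ?thesis using Cons.prems(1) Cons.prems(3)[of 0]
      by (auto simp: is_partition_Cons part_Suc)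
  next
    case (Cons b k)
    then show ?thesis
      using Cons.prems Cons.IH[of k] Cons.prems(3)[of 0] Cons.prems(3)[of "Suc _"]
      by (auto simp: is_partition_Cons)
  qed
qed

text \<open>A partition is determined by its columns. Column lengths ignore the order of a list, so
  sorted results of \<open>to_partition\<close> can be identified part by part without following the
  sort.\<close>

lemma part_eqI:
  assumes "is_partition l" "\<And>t i. 0 < t \<Longrightarrow> i < mult_ge l t \<longleftrightarrow> t \<le> f i"
  shows "part l (Suc i) = f i"
proof -
  have "\<And>t. 0 < t \<Longrightarrow> t \<le> part l (Suc i) \<longleftrightarrow> t \<le> f i"
    using assms less_mult_ge_iff by blast
  then show ?thesis
    by (metis bot_nat_0.not_eq_extremum le_antisym le_refl linorder_le_less_linear not_less)
qed

lemma in_set_partition_iff: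
  assumes "is_partition l"
  shows "r \<in> set l \<longleftrightarrow> 0 < r \<and> (\<exists>i. part l (Suc i) = r)"
  using assms by (auto simp: is_partition_def in_set_conv_nth part_Suc split: if_splits)

section \<open>Partitions given by decreasing functions, and the list operations on them\<close>

definition partition_of :: "(nat \<Rightarrow> nat) \<Rightarrow> nat list" where
  "partition_of f = map f [0..<(LEAST n. f n = 0)]"

definition finite_antimono :: "(nat \<Rightarrow> nat) \<Rightarrow> bool" where
  "finite_antimono f \<longleftrightarrow> antimono f \<and> (\<exists>n. f n = 0)"

lemma
  assumes "finite_antimono f"
  shows is_partition_partition_of: "is_partition (partition_of f)"
    and part_partition_of: "part (partition_of f) (Suc i) = f i"
proof -
  obtain n where "f n = 0" using assms by (auto simp: finite_antimono_def)
  define N where "N = (LEAST n. f n = 0)"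
  have N: "f N = 0" unfolding N_def using \<open>f n = 0\<close> by (rule LeastI)
  have pos: "f i \<noteq> 0" if "i < N" for i using not_less_Least that unfolding N_def by blast
  have anti: "f j \<le> f i" if "i \<le> j" for i j
    using assms that by (auto simp: finite_antimono_def antimono_def)
  show "is_partition (partition_of f)"
    unfolding is_partition_def partition_of_def N_def[symmetric] sorted_wrt_iff_nth_less
    using anti pos by (auto simp: image_iff)
  show "part (partition_of f) (Suc i) = f i"
    using N anti[of N i] by (auto simp: part_Suc partition_of_def N_def[symmetric])
qed

lemma partition_of_eqI:
  assumes "is_partition l" "\<And>i. part l (Suc i) = f i"
  shows "l = partition_of f"
proof -
  have "antimono f"
  proof (rule antimonoI)
    fix i j :: nat assume "i \<le> j"
    show "f j \<le> f i"
    proof (cases "f j = 0")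
      case False
      then have "j < mult_ge l (f j)"
        using less_mult_ge_iff[OF assms(1), of "f j" j] assms(2) by simp
      then show ?thesis using \<open>i \<le> j\<close> less_mult_ge_iff[OF assms(1), of "f j" i] assms(2) False
        by simp
    qed simp
  qed
  moreover have "f (length l) = 0" using assms(2)[of "length l", symmetric] by (simp add: part_Suc)
  ultimately have "finite_antimono f" by (auto simp: finite_antimono_def)
  then show ?thesis
    using assms by (intro partition_eqI) (auto simp: is_partition_partition_of part_partition_of)
qed

lemma is_partition_to_partition: "is_partition (to_partition xs)"
  by (auto simp: is_partition_def to_partition_def sorted_wrt_rev)

lemma mult_ge_eq_size: "mult_ge l t = size (filter_mset (\<lambda>p. t \<le> p) (mset l))"
  by (simp add: mult_ge_def flip: mset_filter)

lemma mult_ge_to_partition: "0 < t \<Longrightarrow> mult_ge (to_partition xs) t = mult_ge xs t"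
  unfolding mult_ge_eq_size to_partition_def
  by (simp add: filter_filter_mset conj_commute) (metis (mono_tags, lifting) filter_mset_cong order_less_le_trans)

text \<open>Additions on both sides replace a subtraction that could truncate: the indicators are
  the boxes taken out of column \<open>t\<close> and put back into it.\<close>

lemma mult_ge_replace_part:
  assumes "a \<in> set l" "0 < t"
  shows "mult_ge (replace_part a b l) t + of_bool (t \<le> a) = mult_ge l t + of_bool (t \<le> b)"
proof -
  have "mset l = add_mset a (mset (remove1 a l))" using assms by simp
  then have "mult_ge l t = of_bool (t \<le> a) + mult_ge (remove1 a l) t"
    unfolding mult_ge_eq_size by (simp del: mset_remove1)
  then show ?thesis
    unfolding replace_part_def mult_ge_to_partition[OF assms(2)] by (simp add: mult_ge_def)
qed

text \<open>The sort in \<open>to_partition\<close> is bypassed by comparing columns: a level set of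
  a decreasing function is an initial segment, so its cardinality decides membership.\<close>

lemma to_partition_map:
  assumes "antimono f" "\<And>i. N \<le> i \<Longrightarrow> f i = 0"
  shows "to_partition (map f [0..<N]) = partition_of f"
proof (rule partition_of_eqI[OF is_partition_to_partition], rule part_eqI[OF is_partition_to_partition])
  fix t i :: nat assume "0 < t"
  have anti: "f j \<le> f i" if "i \<le> j" for i j using assms that by (auto simp: antimono_def)
  have m: "mult_ge (map f [0..<N]) t = card {i. t \<le> f i}"
  proof -
    have "mult_ge (map f [0..<N]) t = card (set (filter (\<lambda>i. t \<le> f i) [0..<N]))"
      unfolding mult_ge_def by (subst distinct_card) (auto simp: filter_map o_def)
    also have "set (filter (\<lambda>i. t \<le> f i) [0..<N]) = {i. t \<le> f i}"
      using assms(2) \<open>0 < t\<close> by (auto simp: set_filter) (metis not_less less_le_not_le)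
    finally show ?thesis .
  qed
  have fin: "finite {i. t \<le> f i}"
    
  proof (rule finite_subset)
    show "{i. t \<le> f i} \<subseteq> {..<N}"
    proof
      fix i assume "i \<in> {i. t \<le> f i}"
      then show "i \<in> {..<N}" using assms(2)[of i] \<open>0 < t\<close> by (cases "N \<le> i") auto
    qed
  qed simp
  have "i < card {i. t \<le> f i} \<longleftrightarrow> t \<le> f i"
  proof
    assume "t \<le> f i"
    then have "{..i} \<subseteq> {i. t \<le> f i}" using anti order_trans by (auto; blast)
    from card_mono[OF fin this] show "i < card {i. t \<le> f i}" by simp
  next
    assume "i < card {i. t \<le> f i}"
    show "t \<le> f i"
    proof (rule ccontr)
      assume "\<not> t \<le> f i"
      then have "{i. t \<le> f i} \<subseteq> {..<i}" using anti by (auto simp: not_le[symmetric]) (meson le_trans)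
      from card_mono[OF _ this] \<open>i < card {i. t \<le> f i}\<close> show False by simp
    qed
  qed
  then show "i < mult_ge (to_partition (map f [0..<N])) t \<longleftrightarrow> t \<le> f i"
    using m mult_ge_to_partition[OF \<open>0 < t\<close>] by simp
qed

lemma map_shift_upt: "map f [1..<Suc N] = map (\<lambda>i. f (Suc i)) [0..<N]"
  by (induction N) auto

text \<open>The reordering built into \<open>incr_parts\<close> never acts here: the increased
  sequence is assumed decreasing, and so it is wherever the lemma is applied.\<close>

lemma incr_parts_eq:
  assumes "\<And>i. f i = part l (Suc i) + (if a \<le> Suc i \<and> Suc i \<le> b then 1 else 0)" "antimono f"
  shows "incr_parts a b l = partition_of f"
proof -
  have "incr_parts a b l = to_partition (map f [0..<max (length l) b])"
    unfolding incr_parts_def Suc_eq_plus1[symmetric] map_shift_upt assms(1) ..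
  also have "\<dots> = partition_of f"
    by (rule to_partition_map) (use assms in \<open>auto simp: part_Suc\<close>)
  finally show ?thesis .
qed

lemma decr_parts_eq:
  assumes "\<And>i. f i = part l (Suc i) - (if a \<le> Suc i \<and> Suc i \<le> b then 1 else 0)" "antimono f"
  shows "decr_parts a b l = partition_of f"
proof -
  have "decr_parts a b l = to_partition (map f [0..<length l])"
    unfolding decr_parts_def Suc_eq_plus1[symmetric] map_shift_upt assms(1) ..
  also have "\<dots> = partition_of f"
    by (rule to_partition_map) (use assms in \<open>auto simp: part_Suc\<close>)
  finally show ?thesis .
qed

text \<open>Position \<open>i\<close> is the last occurrence of \<open>a\<close>, so lowering there
  keeps the list decreasing, whichever occurrence \<open>remove1\<close> deletes.\<close>

lemma replace_part_pred_eq: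
  assumes "is_partition l" "part l (Suc i) = a" "part l (Suc (Suc i)) < a"
  shows "replace_part a (a - 1) l = partition_of (\<lambda>k. part l (Suc k) - (if k = i then 1 else 0))"
proof (rule partition_of_eqI)
  show "is_partition (replace_part a (a - 1) l)"
    by (simp add: replace_part_def is_partition_to_partition)
  then show "part (replace_part a (a - 1) l) (Suc k) = part l (Suc k) - (if k = i then 1 else 0)" for k
  proof (rule part_eqI)
    fix t k :: nat assume "0 < t"
    have a: "a \<in> set l" using assms in_set_partition_iff by auto
    note m = mult_ge_replace_part[OF a \<open>0 < t\<close>, of "a - 1"]
    have "mult_ge l a = Suc i"
      using less_mult_ge_iff[OF assms(1), of a i] less_mult_ge_iff[OF assms(1), of a "Suc i"] assms(2,3)
      by simp
    then show "k < mult_ge (replace_part a (a - 1) l) t \<longleftrightarrow> t \<le> part l (Suc k) - (if k = i then 1 else 0)"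
      using m less_mult_ge_iff[OF assms(1) \<open>0 < t\<close>, of k] assms(2,3)
      by (cases "t = a") (auto simp: of_bool_def split: if_splits)
  qed
qed

lemma partition_eq_mult_geI:
  assumes "is_partition l" "is_partition l'" "\<And>t. 0 < t \<Longrightarrow> mult_ge l t = mult_ge l' t"
  shows "l = l'"
proof (rule partition_eqI[OF assms(1,2)])
  fix i
  show "part l (Suc i) = part l' (Suc i)"
    by (rule part_eqI[OF assms(1)]) (simp add: assms(3) less_mult_ge_iff[OF assms(2)])
qed

text \<open>\<open>iota\<close> drops zeros but does not sort, so its lists need this variant; a
  decreasing list of positive numbers is its own \<open>to_partition\<close>.\<close>

lemma filter_pos_map:
  assumes "antimono f" "\<And>i. N \<le> i \<Longrightarrow> f i = 0"
  shows "filter (\<lambda>p. 0 < p) (map f [0..<N]) = partition_of f"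
proof -
  let ?l = "filter (\<lambda>p. 0 < p) (map f [0..<N])"
  have "sorted_wrt (\<ge>) ?l"
    using assms(1) by (intro sorted_wrt_filter) (auto simp: sorted_wrt_iff_nth_less antimono_def)
  then have "is_partition ?l" by (simp add: is_partition_def)
  then have "?l = to_partition ?l"
    by (intro partition_eq_mult_geI) (auto simp: is_partition_to_partition mult_ge_to_partition)
  also have "\<dots> = to_partition (map f [0..<N])" by (simp add: to_partition_def)
  also have "\<dots> = partition_of f" by (rule to_partition_map[OF assms])
  finally show ?thesis .
qed

subsection \<open>Interlaced sequences\<close>

definition interlaced :: "(nat \<Rightarrow> nat) \<Rightarrow> bool" where
  "interlaced c \<longleftrightarrow> (\<forall>i. c (Suc (Suc i)) \<le> c i) \<and> (\<exists>n. \<forall>i\<ge>n. c i = 0)"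

text \<open>The missing entry before position 0 counts as infinite, so position 0 is never the upper
  end of an ascent.\<close>

definition cmin :: "(nat \<Rightarrow> nat) \<Rightarrow> nat \<Rightarrow> nat" where
  "cmin c i = (if i = 0 then c 0 else min (c (i - 1)) (c i))"

definition cmax :: "(nat \<Rightarrow> nat) \<Rightarrow> nat \<Rightarrow> nat" where
  "cmax c i = max (c i) (c (Suc i))"

definition csum :: "(nat \<Rightarrow> nat) \<Rightarrow> nat \<Rightarrow> nat" where
  "csum c i = cmin c i + cmax c i"

lemma interlacedD: "interlaced c \<Longrightarrow> c (Suc (Suc i)) \<le> c i"
  by (simp add: interlaced_def)

lemma interlaced_le:
  assumes "interlaced c" "i \<le> j" "even (j - i)"
  shows "c j \<le> c i"
proof -
  obtain k where k: "j = i + 2 * k" using assms(2,3) by (metis evenE le_add_diff_inverse)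
  have "c (i + 2 * k) \<le> c i"
    by (induction k) (auto intro: order_trans interlacedD[OF assms(1)])
  then show ?thesis using k by simp
qed

lemma cmin_le: "cmin c i \<le> c i" and le_cmax: "c i \<le> cmax c i"
  by (auto simp: cmin_def cmax_def)

lemma cmin_le_cmax: "cmin c i \<le> cmax c i"
  using cmin_le le_cmax order_trans by blast

lemma
  assumes "interlaced c" "i \<le> j"
  shows cmin_antimono: "cmin c j \<le> cmin c i"
    and cmax_antimono: "cmax c j \<le> cmax c i"
    and csum_antimono: "csum c j \<le> csum c i"
proof -
  have "cmin c (Suc n) \<le> cmin c n" for n
    using interlacedD[OF assms(1), of "n - 1"] by (auto simp: cmin_def min_def)
  from lift_Suc_antimono_le[of "cmin c", OF this assms(2)] show a: "cmin c j \<le> cmin c i" .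
  have "cmax c (Suc n) \<le> cmax c n" for n
    using interlacedD[OF assms(1), of "n"] by (auto simp: cmax_def max_def)
  from lift_Suc_antimono_le[of "cmax c", OF this assms(2)] show b: "cmax c j \<le> cmax c i" .
  show "csum c j \<le> csum c i" using a b by (simp add: csum_def)
qed

text \<open>Both summands decrease along the sequence, so equal sums force equal summands. This
  makes \<open>cmin\<close> a function of the part, as \<open>chi\<close> has to be.\<close>

lemma csum_eqD:
  assumes "interlaced c" "csum c i = csum c j"
  shows "cmin c i = cmin c j" "cmax c i = cmax c j"
  using assms cmin_antimono[of c i j] cmin_antimono[of c j i] cmax_antimono[of c i j]
    cmax_antimono[of c j i] by (cases "i \<le> j"; simp add: csum_def)+

lemma csum_pos_iff: "0 < csum c i \<longleftrightarrow> 0 < cmax c i"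
  using cmin_le_cmax[of c i] by (auto simp: csum_def)

text \<open>Ascents are isolated since \<open>c (i + 2)\<close> is at most \<open>c i\<close>: the
  two positions of an ascent share both minimum and maximum and hence carry equal parts.\<close>

lemma interlaced_ascent:
  assumes "interlaced c" "c i < c (Suc i)"
  shows "cmin c i = c i" "cmax c i = c (Suc i)" "cmin c (Suc i) = c i" "cmax c (Suc i) = c (Suc i)"
    "csum c (Suc i) = csum c i" "\<not> c (Suc i) < c (Suc (Suc i))" "0 < i \<Longrightarrow> \<not> c (i - 1) < c i"
  using assms(2) interlacedD[OF assms(1), of i] interlacedD[OF assms(1), of "i - 1"]
  by (auto simp: cmin_def cmax_def csum_def)

text \<open>The left side is the condition \<open>2 * chi r = r\<close> for the part at position
  \<open>i\<close>, so the singletons among the blocks are the positions outside all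
  ascents.\<close>

lemma cmin_eq_cmax_iff:
  "cmin c i = cmax c i \<longleftrightarrow> \<not> c i < c (Suc i) \<and> (i = 0 \<or> \<not> c (i - 1) < c i)"
  by (auto simp: cmin_def cmax_def)

section \<open>The map iota in terms of interlaced sequences\<close>

definition bipartition_of :: "(nat \<Rightarrow> nat) \<Rightarrow> nat list \<times> nat list" where
  "bipartition_of c = (partition_of (\<lambda>i. c (2 * i)), partition_of (\<lambda>i. c (Suc (2 * i))))"

lemma finite_antimono_subseq:
  assumes "interlaced c"
  shows "finite_antimono (\<lambda>i. c (2 * i))" "finite_antimono (\<lambda>i. c (Suc (2 * i)))"
proof -
  obtain n where n: "\<And>i. n \<le> i \<Longrightarrow> c i = 0" using assms by (auto simp: interlaced_def)
  have "c (2 * n) = 0" "c (Suc (2 * n)) = 0" by (auto intro: n)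
  then show "finite_antimono (\<lambda>i. c (2 * i))" "finite_antimono (\<lambda>i. c (Suc (2 * i)))"
    unfolding finite_antimono_def by (auto intro!: antimonoI interlaced_le[OF assms])
qed

text \<open>Serves both for the given pair and for the altered partitions equipped with
  \<open>Psi\<close>; the latter never have to be shown to lie in \<open>Omega\<close>.\<close>

definition fits :: "nat list \<Rightarrow> (nat \<Rightarrow> nat) \<Rightarrow> (nat \<Rightarrow> nat) \<Rightarrow> bool" where
  "fits lam chi c \<longleftrightarrow> is_partition lam \<and> (\<forall>i. part lam (Suc i) = csum c i) \<and>
     (\<forall>i. chi (csum c i) = cmin c i)"

text \<open>\<open>is_blocks\<close> names only the singletons. Reading from the left, every other
  position pairs with its predecessor or its successor, and the first alternative is already
  decided, so the pairs are forced to be the ascents.\<close>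

lemma fits_block_value:
  assumes c: "interlaced c" and f: "fits lam chi c" and P: "is_blocks lam chi s P" and j: "j \<le> 2 * s"
  shows "block_value lam chi P (Suc j) = c j"
proof -
  have fs: "part lam (Suc i) = csum c i" "chi (csum c i) = cmin c i" for i
    using f by (auto simp: fits_def)
  have un: "\<Union>P = {1..2 * s + 1}" and dj: "\<And>A B. A \<in> P \<Longrightarrow> B \<in> P \<Longrightarrow> A \<noteq> B \<Longrightarrow> A \<inter> B = {}"
    using P by (auto simp: is_blocks_def partition_on_def disjoint_def)
  have sh: "\<exists>i. B = {i} \<or> B = {i, i + 1}" if "B \<in> P" for B
    using P that by (auto simp: is_blocks_def)
  have sg: "{Suc i} \<in> P \<longleftrightarrow> cmin c i = cmax c i" if "i \<le> 2 * s" for i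
  proof -
    have "{Suc i} \<in> P \<longleftrightarrow> 2 * chi (part lam (Suc i)) = part lam (Suc i)"
      using P that by (auto simp: is_blocks_def)
    then show ?thesis unfolding fs by (auto simp: csum_def)
  qed
  have key: "{Suc i, Suc (Suc i)} \<in> P \<longleftrightarrow> c i < c (Suc i)" if "i \<le> 2 * s" for i
    using that
  proof (induction i rule: less_induct)
    case (less i)
    have mem: "Suc i \<in> \<Union>P" using un less.prems by simp
    then obtain B where B: "B \<in> P" "Suc i \<in> B" by blast
    obtain k where k: "B = {k} \<or> B = {k, k + 1}" using sh[OF B(1)] by (elim exE) (rule that)
    have ninj: "{Suc i} \<noteq> {Suc i, Suc (Suc i)}" "{i, Suc i} \<noteq> {Suc i, Suc (Suc i)}"
      by (simp_all add: doubleton_eq_iff)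
    show ?case
    proof
      assume l: "{Suc i, Suc (Suc i)} \<in> P"
      show "c i < c (Suc i)"
      proof (rule ccontr)
        assume n: "\<not> c i < c (Suc i)"
        have "{Suc i} \<notin> P" using dj[OF l, of "{Suc i}"] by auto
        then have "cmin c i \<noteq> cmax c i" using sg less.prems by blast
        then have "0 < i" "c (i - 1) < c i" using n cmin_eq_cmax_iff[of c i] by auto
        then have "{i, Suc i} \<in> P" using less.IH[of "i - 1"] less.prems by simp
        with dj[OF l, of "{i, Suc i}"] ninj show False by auto
      qed
    next
      assume up: "c i < c (Suc i)"
      have "{Suc i} \<notin> P" using sg[OF less.prems] up cmin_eq_cmax_iff[of c i] by simp
      moreover have "{i, Suc i} \<notin> P"
      proof
        assume l: "{i, Suc i} \<in> P"
        then have "i \<in> {1..2 * s + 1}" using un by blast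
        then have "0 < i" by simp
        then have "c (i - 1) < c i" using l less.IH[of "i - 1"] less.prems by simp
        then show False using interlaced_ascent(7)[OF c up \<open>0 < i\<close>] by simp
      qed
      ultimately show "{Suc i, Suc (Suc i)} \<in> P" using k B by auto
    qed
  qed
  show ?thesis
  proof (cases "cmin c j = cmax c j")
    case True
    then have "c j = cmin c j" using cmin_le[of c j] le_cmax[of c j] by simp
    then show ?thesis using sg[OF j] True by (simp add: block_value_def fs csum_def)
  next
    case False
    moreover have "csum c j - cmin c j = cmax c j" by (simp add: csum_def)
    ultimately show ?thesis
      using sg[OF j] key[OF j] interlaced_ascent(1)[OF c, of j] interlaced_ascent(4)[OF c, of "j - 1"]
        cmin_eq_cmax_iff[of c j]
      by (auto simp: block_value_def fs)
  qed
qed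

lemma ex_blocks:
  assumes c: "interlaced c" and f: "fits lam chi c" and s: "length lam \<le> 2 * s"
  shows "\<exists>P. is_blocks lam chi s P"
proof -
  have fs: "part lam (Suc i) = csum c i" "chi (csum c i) = cmin c i" for i
    using f by (auto simp: fits_def)
  have sgl: "2 * chi (part lam (Suc i)) = part lam (Suc i) \<longleftrightarrow> cmin c i = cmax c i" for i
    unfolding fs by (auto simp: csum_def)
  define P where "P = {{Suc i} |i. i \<le> 2 * s \<and> cmin c i = cmax c i} \<union>
    {{Suc i, Suc (Suc i)} |i. c i < c (Suc i)}"
  \<comment> \<open>The upper entry of an ascent is positive, so it lies over a positive part of
    \<open>lam\<close>; thus no pair sticks out of \<open>{1..2 * s + 1}\<close>.\<close>
  have bound: "Suc i < 2 * s" if "c i < c (Suc i)" for i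
  proof -
    have "0 < csum c (Suc i)" using that le_cmax[of c "Suc i"] csum_pos_iff by fastforce
    then have "Suc i < length lam" using fs(1)[of "Suc i"] by (auto simp: part_Suc split: if_splits)
    then show ?thesis using s by simp
  qed
  have "\<Union>P = {1..2 * s + 1}"
  proof
    show "\<Union>P \<subseteq> {1..2 * s + 1}" using bound by (fastforce simp: P_def)
    show "{1..2 * s + 1} \<subseteq> \<Union>P"
    proof
      fix k assume "k \<in> {1..2 * s + 1}"
      then obtain i where i: "k = Suc i" "i \<le> 2 * s" by (cases k) auto
      show "k \<in> \<Union>P"
      proof (cases "cmin c i = cmax c i")
        case True
        then show ?thesis using i by (auto simp: P_def)
      next
        case False
        then consider "c i < c (Suc i)" | "0 < i" "c (i - 1) < c i" using cmin_eq_cmax_iff by blast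
        then show ?thesis
        proof cases
          case 1
          then have "{Suc i, Suc (Suc i)} \<in> P" by (auto simp: P_def)
          then show ?thesis using i by blast
        next
          case 2
          then obtain m where "i = Suc m" "c m < c (Suc m)" by (cases i) auto
          then have "{Suc m, Suc i} \<in> P" by (auto simp: P_def)
          then show ?thesis using i by blast
        qed
      qed
    qed
  qed
  moreover have "disjoint P"
    unfolding disjoint_def P_def
    using interlaced_ascent[OF c] cmin_eq_cmax_iff[of c]
    by (auto simp: doubleton_eq_iff)
  moreover have "{} \<notin> P" by (auto simp: P_def)
  moreover have "\<forall>B\<in>P. \<exists>i. B = {i} \<or> B = {i, i + 1}" by (auto simp: P_def)
  moreover have "\<forall>i\<in>{1..2 * s + 1}. {i} \<in> P \<longleftrightarrow> 2 * chi (part lam i) = part lam i"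
  proof
    fix i assume "i \<in> {1..2 * s + 1}"
    then obtain k where k: "i = Suc k" "k \<le> 2 * s" by (cases i) auto
    show "{i} \<in> P \<longleftrightarrow> 2 * chi (part lam i) = part lam i"
      using k sgl[of k] by (auto simp: P_def)
  qed
  ultimately show ?thesis by (auto simp: is_blocks_def partition_on_def)
qed

text \<open>\<open>THE\<close> needs a witness, for which \<open>s = length lam\<close> serves, and
  one value for all choices of \<open>s\<close> and of the blocks; both follow because the block
  values are the entries of \<open>c\<close>.\<close>

lemma iota_eq_bipartition_of:
  assumes c: "interlaced c" and f: "fits lam chi c"
  shows "iota lam chi = bipartition_of c"
proof -
  have pr: "(filter (\<lambda>p. 0 < p) (map (\<lambda>i. block_value lam chi P (2 * i + 1)) [0..<s + 1]),
      filter (\<lambda>p. 0 < p) (map (\<lambda>i. block_value lam chi P (2 * i)) [1..<s + 1])) = bipartition_of c"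
    if s: "length lam \<le> 2 * s" and P: "is_blocks lam chi s P" for s P
  proof -
    note bv = fits_block_value[OF c f P]
    have z: "c i = 0" if "2 * s \<le> i" for i
    proof -
      have "csum c i = 0" using f that s by (auto simp: fits_def part_Suc dest!: spec[of _ i])
      then show ?thesis using csum_pos_iff[of c i] le_cmax[of c i] by simp
    qed
    have "map (\<lambda>i. block_value lam chi P (2 * i + 1)) [0..<s + 1] = map (\<lambda>i. c (2 * i)) [0..<s + 1]"
      using bv by auto
    moreover have "map (\<lambda>i. block_value lam chi P (2 * i)) [1..<s + 1] = map (\<lambda>i. c (Suc (2 * i))) [0..<s]"
      unfolding Suc_eq_plus1[symmetric] map_shift_upt using bv[of "Suc (2 * _)"] by auto
    ultimately show ?thesis
      unfolding bipartition_of_def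
      using finite_antimono_subseq[OF c] z
      by (simp only: prod.inject) (intro conjI filter_pos_map; simp add: finite_antimono_def)
  qed
  obtain P where P: "is_blocks lam chi (length lam) P" using ex_blocks[OF c f, of "length lam"] by auto
  show ?thesis
    unfolding iota_def
  proof (rule the_equality)
    show "\<exists>s P. length lam \<le> 2 * s \<and> is_blocks lam chi s P \<and> bipartition_of c =
        (filter (\<lambda>p. 0 < p) (map (\<lambda>i. block_value lam chi P (2 * i + 1)) [0..<s + 1]),
         filter (\<lambda>p. 0 < p) (map (\<lambda>i. block_value lam chi P (2 * i)) [1..<s + 1]))"
      using pr[OF _ P, symmetric] P by (intro exI[of _ "length lam"] exI[of _ P] conjI) simp_all
  next
    fix mn
    assume "\<exists>s P. length lam \<le> 2 * s \<and> is_blocks lam chi s P \<and> mn =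
        (filter (\<lambda>p. 0 < p) (map (\<lambda>i. block_value lam chi P (2 * i + 1)) [0..<s + 1]),
         filter (\<lambda>p. 0 < p) (map (\<lambda>i. block_value lam chi P (2 * i)) [1..<s + 1]))"
    then show "mn = bipartition_of c" using pr by blast
  qed
qed

text \<open>The inverse passage from \<open>lam\<close> to \<open>c\<close>: along each block of
  equal parts r, \<open>c\<close> alternates between \<open>chi r\<close> and
  \<open>r - chi r\<close>, beginning with the smaller. A block whose two values differ has even
  length by the parity condition in \<open>Omega\<close>, hence it ends with the larger.\<close>

lemma Omega_fits:
  assumes "(lam, chi) \<in> Omega n"
  obtains c where "interlaced c" "fits lam chi c"
proof -
  have p: "is_partition lam" and z: "\<And>r. r \<notin> set lam \<Longrightarrow> chi r = 0"
    and half: "\<And>r. r \<in> set lam \<Longrightarrow> 2 * chi r \<le> r"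
    and odd: "\<And>r. r \<in> set lam \<Longrightarrow> 2 * chi r \<noteq> r \<Longrightarrow> even (count_list lam r)"
    and mono: "\<And>r r'. r \<in> set lam \<Longrightarrow> r' \<in> set lam \<Longrightarrow> r' \<le> r \<Longrightarrow>
      chi r' \<le> chi r \<and> r' - chi r' \<le> r - chi r"
    using assms by (auto simp: Omega_def)
  define l where "l i = part lam (Suc i)" for i
  define lo where "lo i = chi (l i)" for i
  define hi where "hi i = l i - chi (l i)" for i
  have mem: "l i \<in> set lam" if "0 < l i" for i
    using that unfolding in_set_partition_iff[OF p] l_def by blast
  have chi0: "chi 0 = 0" using z[of 0] p by (simp add: is_partition_def)
  have len: "l i = 0" if "length lam \<le> i" for i using that by (simp add: l_def part_Suc)
  have lanti: "l j \<le> l i" if "i \<le> j" for i j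
    using less_mult_ge_iff[OF p, of "l j" j] less_mult_ge_iff[OF p, of "l j" i] that
    by (cases "l j = 0") (auto simp: l_def)
  have lohi: "lo i \<le> hi i" for i
    using half[OF mem[of i]] chi0 by (cases "l i = 0") (auto simp: lo_def hi_def)
  have l_sum: "l i = lo i + hi i" for i using lohi[of i] by (auto simp: lo_def hi_def)
  have anti: "lo j \<le> lo i \<and> hi j \<le> hi i" if "i \<le> j" for i j
    using mono[OF mem[of i] mem[of j] lanti[OF that]] lanti[OF that] chi0
    by (cases "l j = 0") (auto simp: lo_def hi_def)
  \<comment> \<open>\<open>g i\<close> is the first position of the block of parts equal to
    \<open>l i\<close>, so \<open>i - g i\<close> is the offset inside the block.\<close>
  define g where "g i = mult_gt lam (l i)" for i
  have g: "j < g i \<longleftrightarrow> l i < l j" for i j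
    using less_mult_gt_iff[OF p] by (simp add: g_def l_def)
  have g_le: "g i \<le> i" for i using g[of i i] by simp
  have g_eq: "g i = g j" if "l i = l j" for i j using that by (simp add: g_def)
  define c where "c i = (if even (i - g i) then lo i else hi i)" for i
  have first: "l (Suc i) = l i \<and> c (Suc i) = hi i" if "even (i - g i)" "lo i < hi i" for i
  proof -
    have pos: "0 < l i" using that(2) l_sum[of i] by simp
    have "even (count_list lam (l i))" using odd[OF mem[OF pos]] that(2) by (auto simp: lo_def hi_def)
    then have ev: "even (mult_ge lam (l i) - g i)" by (simp add: mult_ge_eq_gt_count g_def)
    have "i < mult_ge lam (l i)" using less_mult_ge_iff[OF p pos] by (simp add: l_def)
    moreover have "mult_ge lam (l i) \<noteq> Suc i"
      using ev that(1) g_le[of i] by (auto simp: Suc_diff_le)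
    ultimately have "l i \<le> l (Suc i)" using less_mult_ge_iff[OF p pos, of "Suc i"] by (simp add: l_def)
    then have e: "l (Suc i) = l i" using lanti[of i "Suc i"] by simp
    then show ?thesis using g_eq[OF e] that(1) g_le[of i]
      by (simp add: c_def hi_def Suc_diff_le)
  qed
  have second: "0 < i \<and> l (i - 1) = l i \<and> c (i - 1) = lo i" if "odd (i - g i)" for i
  proof -
    have "g i \<noteq> i" using that by auto
    then have i: "0 < i" "g i \<le> i - 1" using g_le[of i] by auto
    then have "l (i - 1) = l i" using g[of "i - 1" i] lanti[of "i - 1" i] by auto
    then show ?thesis using g_eq[of "i - 1" i] i that
      by (auto simp: c_def lo_def)
  qed
  have c_le: "c i \<le> hi i" "lo i \<le> c i" for i using lohi by (auto simp: c_def)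
  have inter: "c (Suc (Suc i)) \<le> c i" for i
  proof (cases "c i = hi i")
    case True
    then show ?thesis using c_le(1)[of "Suc (Suc i)"] anti[of i "Suc (Suc i)"] by simp
  next
    case False
    then have ci: "c i = lo i" "even (i - g i)" "lo i < hi i"
      using lohi[of i] by (auto simp: c_def split: if_splits)
    note f = first[OF ci(2,3)]
    \<comment> \<open>After a smaller value comes its partner in the same block. Two steps on,
      either the offset is even again or a new block begins, so \<open>c\<close> takes a smaller
      value there as well.\<close>
    have "even (Suc (Suc i) - g (Suc (Suc i)))"
    proof (cases "l (Suc (Suc i)) = l i")
      case True
      then show ?thesis using g_eq[OF True] ci(2) g_le[of i] by (simp add: Suc_diff_le)
    next
      case False
      then have "Suc i < g (Suc (Suc i))" using g f lanti[of i "Suc (Suc i)"] by simp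
      then have "g (Suc (Suc i)) = Suc (Suc i)" using g_le[of "Suc (Suc i)"] by simp
      then show ?thesis by simp
    qed
    then show ?thesis using ci(1) anti[of i "Suc (Suc i)"] by (simp add: c_def)
  qed
  have "c i = 0" if "length lam \<le> i" for i using len[OF that] chi0 by (simp add: c_def lo_def hi_def)
  then have c: "interlaced c" using inter by (auto simp: interlaced_def)
  have cmin: "cmin c i = lo i" for i
  proof (cases "even (i - g i)")
    case True
    then have "c i = lo i" by (simp add: c_def)
    then show ?thesis using c_le(2)[of "i - 1"] anti[of "i - 1" i] by (auto simp: cmin_def)
  next
    case False
    then show ?thesis using second[of i] c_le(2)[of i] by (auto simp: cmin_def)
  qed
  have cmax: "cmax c i = hi i" for i
  proof (cases "c i = hi i")
    case True
    then show ?thesis using c_le(1)[of "Suc i"] anti[of i "Suc i"] by (auto simp: cmax_def)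
  next
    case False
    then have "even (i - g i)" "lo i < hi i" using lohi[of i] by (auto simp: c_def split: if_splits)
    from first[OF this] show ?thesis using c_le(1)[of i] by (simp add: cmax_def)
  qed
  have "fits lam chi c"
    using p l_sum lo_def unfolding fits_def by (simp add: csum_def cmin cmax l_def)
  with c that show ?thesis by blast
qed

subsection \<open>Critical values and the function \<open>\<Psi>\<close>\<close>

text \<open>
  Read a pair \<open>(a, b)\<close> as the point \<open>(b, a - b)\<close>: then \<open>\<Psi>(r)\<close> is the least \<open>h\<close> such that no point
  of \<open>Y\<close> lies strictly to the right of and strictly below \<open>(h, r - h)\<close>.
\<close>

lemma Psi_eqI:
  assumes "r \<in> set lam" "finite Y" "h \<le> r"
    and le: "\<And>a b. (a, b) \<in> Y \<Longrightarrow> b \<le> a \<and> (b \<le> h \<or> r - h \<le> a - b)"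
    and attained: "h = 0 \<or> (\<exists>a b. (a, b) \<in> Y \<and> h \<le> b \<and> a - b \<le> r - h)"
  shows "Psi lam Y r = h"
proof -
  let ?M = "{int r - (int a - int b) |a b. (a, b) \<in> Y \<and> a \<ge> r} \<union>
    {int b |a b. (a, b) \<in> Y \<and> a < r} \<union> {0}"
  have "?M \<subseteq> (\<lambda>(a, b). int r - (int a - int b)) ` Y \<union> (\<lambda>(a, b). int b) ` Y \<union> {0}" by force
  then have fin: "finite ?M" by (rule finite_subset) (use assms(2) in auto)
  have "Max ?M = int h"
  proof (rule Max_eqI[OF fin])
    fix y assume "y \<in> ?M"
    then consider a b where "(a, b) \<in> Y" "a \<ge> r" "y = int r - (int a - int b)"
      | a b where "(a, b) \<in> Y" "a < r" "y = int b" | "y = 0" by blast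
    then show "y \<le> int h"
    proof cases
      case 1
      then show ?thesis using le[OF 1(1)] by auto
    next
      case 2
      then show ?thesis using le[OF 2(1)] by auto
    qed simp
  next
    show "int h \<in> ?M"
    proof (cases "h = 0")
      case False
      then obtain a b where ab: "(a, b) \<in> Y" "h \<le> b" "a - b \<le> r - h" using attained by blast
      show ?thesis
      proof (cases "r \<le> a")
        case True
        then have "int h = int r - (int a - int b)" using ab le[OF ab(1)] assms(3) by auto
        then show ?thesis using ab(1) True by blast
      next
        case False
        then have "int h = int b" using ab le[OF ab(1)] assms(3) by auto
        then show ?thesis using ab(1) False by force
      qed
    qed simp
  qed
  then show ?thesis using assms(1) by (simp add: Psi_def)
qed

text \<open>Interface to all vectors of the first formula. Columns fix the partition; in the
  coordinates (cmin, cmax) it then remains to see that no point of \<open>Y\<close> lies strictly to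
  the lower right of a position, and that some point of \<open>Y\<close> lies weakly there.\<close>

lemma T_vec_eqI:
  assumes c: "interlaced c" and p: "is_partition lam"
    and ge: "\<And>t i. 0 < t \<Longrightarrow> i < mult_ge lam t \<longleftrightarrow> t \<le> csum c i"
    and fin: "finite Y"
    and le: "\<And>a b i. (a, b) \<in> Y \<Longrightarrow> b \<le> a \<and> (b \<le> cmin c i \<or> cmax c i \<le> a - b)"
    and attained: "\<And>i. 0 < cmin c i \<Longrightarrow> \<exists>a b. (a, b) \<in> Y \<and> cmin c i \<le> b \<and> a - b \<le> cmax c i"
  shows "T_vec lam Y = e_vec (bipartition_of c)"
proof -
  have part: "part lam (Suc i) = csum c i" for i using part_eqI[OF p] ge by blast
  have "Psi lam Y (csum c i) = cmin c i" for i
  proof (cases "csum c i = 0")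
    case True
    then show ?thesis using p by (simp add: Psi_def is_partition_def csum_def)
  next
    case False
    then have "csum c i \<in> set lam" using in_set_partition_iff[OF p] part by blast
    moreover have "csum c i - cmin c i = cmax c i" by (simp add: csum_def)
    ultimately show ?thesis using fin le[of _ _ i] attained[of i]
      by (intro Psi_eqI) (auto simp: csum_def)
  qed
  then have "fits lam (Psi lam Y) c" using p part by (simp add: fits_def)
  then show ?thesis by (simp add: T_vec_def iota_eq_bipartition_of[OF c])
qed

text \<open>Quantifies over positions, hence also over zero parts. These have \<open>cmin\<close> 0
  and are never larger, so they impose nothing beyond positivity.\<close>

definition critical_at :: "(nat \<Rightarrow> nat) \<Rightarrow> nat \<Rightarrow> bool" where
  "critical_at c i \<longleftrightarrow> 0 < cmin c i \<and> (\<forall>j. csum c j < csum c i \<longrightarrow> cmin c j < cmin c i) \<and>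
     (\<forall>j. csum c i < csum c j \<longrightarrow> cmax c i < cmax c j)"

lemma fits_in_set_iff:
  assumes "fits lam chi c"
  shows "r \<in> set lam \<longleftrightarrow> 0 < r \<and> (\<exists>i. csum c i = r)"
  using assms in_set_partition_iff[of lam r] by (auto simp: fits_def)

lemma fits_chi:
  assumes "fits lam chi c"
  shows "chi (csum c i) = cmin c i" "csum c i - chi (csum c i) = cmax c i" "csum c i - cmin c i = cmax c i"
  using assms by (auto simp: fits_def csum_def)

lemma critical_iff:
  assumes f: "fits lam chi c"
  shows "critical lam chi (csum c i) \<longleftrightarrow> critical_at c i"
proof -
  have chi: "chi (csum c j) = cmin c j" "csum c j - cmin c j = cmax c j" for j
    using fits_chi[OF f] by auto
  have p: "0 < csum c j" if "csum c i < csum c j" for j using that by simp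
  have z: "cmin c j = 0" if "csum c j = 0" for j using that by (simp add: csum_def)
  have mem: "csum c j \<in> set lam" if "0 < csum c j" for j using that fits_in_set_iff[OF f] by blast
  show ?thesis
  proof
    assume cr: "critical lam chi (csum c i)"
    then have pos: "0 < cmin c i" by (simp add: critical_def chi)
    have "cmin c j < cmin c i" if "csum c j < csum c i" for j
      using cr mem[of j] that z[of j] pos by (cases "csum c j = 0") (auto simp: critical_def chi)
    moreover have "cmax c i < cmax c j" if "csum c i < csum c j" for j
      using cr mem[of j] that by (auto simp: critical_def chi)
    ultimately show "critical_at c i" using pos by (simp add: critical_at_def)
  next
    assume "critical_at c i"
    then show "critical lam chi (csum c i)"
      unfolding critical_def critical_at_def fits_in_set_iff[OF f] chi
      by (auto simp: chi csum_def fits_in_set_iff[OF f]) (metis chi csum_def)+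
  qed
qed

lemma X_crit_eq:
  assumes f: "fits lam chi c"
  shows "X_crit lam chi = {(csum c i, cmin c i) |i. critical_at c i}"
proof -
  have "\<exists>i. r = csum c i" if "critical lam chi r" for r
    using that fits_in_set_iff[OF f] by (auto simp: critical_def)
  then show ?thesis using critical_iff[OF f] fits_chi(1)[OF f]
    by (fastforce simp: X_crit_def)
qed

lemma finite_X_crit: "finite (X_crit lam chi)"
proof -
  have "X_crit lam chi \<subseteq> (\<lambda>r. (r, chi r)) ` set lam" by (auto simp: X_crit_def critical_def)
  then show ?thesis by (rule finite_subset) simp
qed

text \<open>The points (cmin, cmax) form a chain that increases weakly in both coordinates with the
  part; criticality at \<open>i\<close> makes one coordinate strict in each direction.\<close>

lemma critical_at_trichotomy:
  assumes "interlaced c" "critical_at c i"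
  obtains "cmin c j = cmin c i" "cmax c j = cmax c i" "csum c j = csum c i"
  | "cmin c j < cmin c i" "cmax c j \<le> cmax c i" "csum c j < csum c i"
  | "cmin c i \<le> cmin c j" "cmax c i < cmax c j" "csum c i < csum c j"
proof -
  consider "csum c j = csum c i" | "csum c j < csum c i" | "csum c i < csum c j" by linarith
  then show ?thesis
  proof cases
    case 1
    then show ?thesis using that(1) csum_eqD[OF assms(1)] by blast
  next
    case 2
    then have "i \<le> j" using csum_antimono[OF assms(1), of j i] by linarith
    then show ?thesis using that(2) cmax_antimono[OF assms(1)] assms(2) 2 by (auto simp: critical_at_def)
  next
    case 3
    then have "j \<le> i" using csum_antimono[OF assms(1), of i j] by linarith
    then show ?thesis using that(3) cmin_antimono[OF assms(1)] assms(2) 3 by (auto simp: critical_at_def)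
  qed
qed

text \<open>This is why the critical points determine \<open>chi\<close>. From the point of
  \<open>i\<close> go down the column of equal \<open>cmin\<close> to its lowest point, then right
  along the row of equal \<open>cmax\<close>: where this ends, nothing lies below in the column or
  to the right in the row.\<close>

lemma ex_critical_at:
  assumes c: "interlaced c" and pos: "0 < cmin c i"
  shows "\<exists>k. critical_at c k \<and> cmin c i \<le> cmin c k \<and> cmax c k \<le> cmax c i"
proof -
  obtain n where n: "\<And>j. n \<le> j \<Longrightarrow> c j = 0" using c by (auto simp: interlaced_def)
  have bound: "j \<le> n" if "cmin c j = cmin c i" for j
    using n[of j] cmin_le[of c j] that pos by (cases "n \<le> j") auto
  define k where "k = (GREATEST j. cmin c j = cmin c i)"
  have k: "cmin c k = cmin c i" unfolding k_def
    by (rule GreatestI_nat[where b = n]) (use bound in auto)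
  have k_max: "j \<le> k" if "cmin c j = cmin c i" for j
    unfolding k_def by (rule Greatest_le_nat[where b = n]) (use bound that in auto)
  have ik: "i \<le> k" using k_max by simp
  have low: "cmin c j < cmin c k" if "csum c j < csum c k" for j
  proof -
    have "k < j" using csum_antimono[OF c, of j k] that by (metis leD le_less_linear)
    then show ?thesis using cmin_antimono[OF c, of k j] k_max[of j] k by fastforce
  qed
  show ?thesis
  proof (cases "critical_at c k")
    case True
    then show ?thesis using k cmax_antimono[OF c ik] by auto
  next
    case False
    then obtain j where j: "csum c k < csum c j" "\<not> cmax c k < cmax c j"
      using low k pos by (auto simp: critical_at_def)
    have jk: "j < k" using csum_antimono[OF c, of k j] j(1) by (metis leD le_less_linear)
    then have mj: "cmax c j = cmax c k" using cmax_antimono[OF c, of j k] j(2) by simp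
    \<comment> \<open>The least position in the row of \<open>k\<close> is the rightmost point of
      that row. It has gained in \<open>cmin\<close>, and any lower point of its column would stand
      between \<open>m\<close> and \<open>k\<close>, hence in the same row.\<close>
    define m where "m = (LEAST l. cmax c l = cmax c k)"
    have m: "cmax c m = cmax c k" unfolding m_def by (rule LeastI[of _ j]) (rule mj)
    have m_min: "m \<le> l" if "cmax c l = cmax c k" for l unfolding m_def using that by (rule Least_le)
    have mk: "cmin c k < cmin c m"
      using cmin_antimono[OF c m_min[OF mj]] j(1) mj by (simp add: csum_def)
    have "critical_at c m"
      unfolding critical_at_def
    proof (intro conjI allI impI)
      show "0 < cmin c m" using mk by simp
    next
      fix l assume l: "csum c l < csum c m"
      then have "m < l" using csum_antimono[OF c, of l m] by (metis leD le_less_linear)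
      show "cmin c l < cmin c m"
      proof (rule ccontr)
        assume "\<not> cmin c l < cmin c m"
        then have e: "cmin c l = cmin c m" using cmin_antimono[OF c, of m l] \<open>m < l\<close> by simp
        then have "l \<le> k" using cmin_antimono[OF c, of k l] mk by (metis leD nat_le_linear)
        then have "cmax c l = cmax c m"
          using cmax_antimono[OF c, of l k] cmax_antimono[OF c, of m l] \<open>m < l\<close> m by simp
        then show False using e l by (simp add: csum_def)
      qed
    next
      fix l assume l: "csum c m < csum c l"
      then have "l < m" using csum_antimono[OF c, of m l] by (metis leD le_less_linear)
      then show "cmax c m < cmax c l"
        using cmax_antimono[OF c, of l m] m_min[of l] m by fastforce
    qed
    then show ?thesis using m mk k cmax_antimono[OF c ik] by auto
  qed
qed

subsection \<open>Removing a box\<close>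

text \<open>The end of the run is not named: among the positions of the parity of \<open>p\<close>
  from \<open>p\<close> on, those with value \<open>c p\<close> are consecutive once
  \<open>c\<close> is interlaced. An entry between two of them is recognised by its right
  neighbour.\<close>

definition lower :: "(nat \<Rightarrow> nat) \<Rightarrow> nat \<Rightarrow> nat \<Rightarrow> nat" where
  "lower c p i =
     (if p \<le> i \<and> even (i - p) \<and> c i = c p then c i - 1
      else if p \<le> i \<and> odd (i - p) \<and> c (Suc i) = c p then c i + 1 else c i)"

definition admissible :: "(nat \<Rightarrow> nat) \<Rightarrow> nat \<Rightarrow> bool" where
  "admissible c p \<longleftrightarrow> p = 0 \<or> c (Suc p) < c (p - 1)"

definition corner :: "(nat \<Rightarrow> nat) \<Rightarrow> nat \<Rightarrow> bool" where
  "corner c q \<longleftrightarrow> c (Suc (Suc q)) < c q"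

lemma lower_less [simp]: "i < p \<Longrightarrow> lower c p i = c i"
  by (simp add: lower_def)

lemma lower_even: "lower c p (p + 2 * k) = (if c (p + 2 * k) = c p then c p - 1 else c (p + 2 * k))"
  by (simp add: lower_def)

lemma lower_odd:
  "lower c p (Suc (p + 2 * k)) =
     (if c (Suc (Suc (p + 2 * k))) = c p then Suc (c (Suc (p + 2 * k))) else c (Suc (p + 2 * k)))"
  by (simp add: lower_def Suc_diff_le)

lemma even_odd_ge_cases:
  fixes i p :: nat
  obtains "i < p" | k where "i = p + 2 * k" | k where "i = Suc (p + 2 * k)"
proof (cases "i < p")
  case False
  then obtain m where m: "i = p + m" using le_Suc_ex not_le by blast
  show ?thesis by (cases "even m") (use m that in \<open>auto elim!: evenE oddE\<close>)
qed (rule that(1))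

text \<open>The only inequality at risk joins \<open>p - 1\<close> to \<open>p + 1\<close>, an
  untouched entry to one that may be raised. Admissibility leaves room for it; at a corner the run
  is \<open>p\<close> alone and nothing is raised.\<close>

lemma interlaced_lower:
  assumes c: "interlaced c" and pos: "0 < c p" and ad: "admissible c p \<or> corner c p"
  shows "interlaced (lower c p)"
proof -
  obtain n where n: "\<And>j. n \<le> j \<Longrightarrow> c j = 0" using c by (auto simp: interlaced_def)
  have "lower c p j = 0" if "n \<le> j" for j using n[of j] n[of "Suc j"] that pos by (simp add: lower_def)
  moreover have "lower c p (Suc (Suc i)) \<le> lower c p i" for i
  proof (rule even_odd_ge_cases[of i p])
    assume i: "i < p"
    then consider "p = Suc i" | "p = Suc (Suc i)" | "Suc (Suc i) < p" by linarith
    then show ?thesis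
    proof cases
      case 1
      then show ?thesis using lower_odd[of c p 0] ad interlacedD[OF c, of i]
        by (auto simp: admissible_def corner_def)
    next
      case 2
      then show ?thesis using lower_even[of c p 0] interlacedD[OF c, of i] by auto
    next
      case 3
      then show ?thesis using interlacedD[OF c] by simp
    qed
  next
    fix k assume i: "i = p + 2 * k"
    have "c i \<le> c p" unfolding i by (rule interlaced_le[OF c]) auto
    then show ?thesis using lower_even[of c p k] lower_even[of c p "Suc k"] interlacedD[OF c, of i] i
      by (auto split: if_splits)
  next
    fix k assume i: "i = Suc (p + 2 * k)"
    have "c (Suc i) \<le> c p" unfolding i using interlaced_le[OF c, of p "p + 2 * Suc k"] by simp
    then show ?thesis using lower_odd[of c p k] lower_odd[of c p "Suc k"] interlacedD[OF c, of i]
        interlacedD[OF c, of "Suc i"] i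
      by (auto split: if_splits)
  qed
  ultimately show ?thesis by (auto simp: interlaced_def)
qed

lemma cmin_Suc: "cmin c (Suc i) = min (c i) (c (Suc i))"
  by (simp add: cmin_def)

text \<open>The run consists of the smaller entries of its pairs. Dropped minima and raised maxima
  cancel before \<open>q\<close>, so the sums change only at \<open>q\<close> and
  \<open>q + 1\<close>, by -1 each: two parts r have become r - 1.\<close>

lemma lower_down:
  assumes c: "interlaced c" and pq: "q = p + 2 * k" and v: "0 < c p"
    and cm: "\<And>i. p \<le> i \<Longrightarrow> i \<le> Suc q \<Longrightarrow> cmin c i = c p" and q: "c (Suc (Suc q)) < c p"
  shows "cmin (lower c p) i = (if p \<le> i \<and> i \<le> Suc q then c p - 1 else cmin c i)"
    and "cmax (lower c p) i = (if p \<le> i \<and> i < q then Suc (cmax c i) else cmax c i)"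
proof -
  have ev: "c (p + 2 * j) = c p" if "j \<le> k" for j
    using cm[of "p + 2 * j"] that pq cmin_le[of c "p + 2 * j"] interlaced_le[OF c, of p "p + 2 * j"] by simp
  have od: "c p \<le> c (Suc (p + 2 * j))" if "j \<le> k" for j
    using cm[of "Suc (p + 2 * j)"] that pq cmin_le[of c "Suc (p + 2 * j)"] by simp
  have past: "c (p + 2 * j) < c p" if "k < j" for j
  proof -
    have "c (p + 2 * j) \<le> c (Suc (Suc q))"
      using that pq by (intro interlaced_le[OF c]) (auto simp: Suc_diff_le)
    then show ?thesis using q by simp
  qed
  have le: "lower c p (p + 2 * j) = (if j \<le> k then c p - 1 else c (p + 2 * j))" for j
    using lower_even[of c p j] ev[of j] past[of j] by (auto simp: not_le)
  have lo: "lower c p (Suc (p + 2 * j)) = (if j < k then Suc (c (Suc (p + 2 * j))) else c (Suc (p + 2 * j)))" for j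
    using lower_odd[of c p j] ev[of "Suc j"] past[of "Suc j"] by (cases "j < k") auto
  have pm: "p = 0 \<or> c p \<le> c (p - 1)" using cm[of p] pq by (auto simp: cmin_def split: if_splits)
  show "cmin (lower c p) i = (if p \<le> i \<and> i \<le> Suc q then c p - 1 else cmin c i)"
  proof (rule even_odd_ge_cases[of i p])
    assume "i < p"
    then show ?thesis by (simp add: cmin_def)
  next
    fix j assume i: "i = p + 2 * j"
    show ?thesis
    proof (cases j)
      case 0
      then show ?thesis using i le[of 0] pm pq by (auto simp: cmin_def)
    next
      case (Suc m)
      then show ?thesis using i le[of j] lo[of m] od[of m] ev[of j] past[of j] pq
        by (auto simp: cmin_Suc not_le)
    qed
  next
    fix j assume i: "i = Suc (p + 2 * j)"
    then show ?thesis using le[of j] lo[of j] od[of j] pq by (auto simp: cmin_Suc)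
  qed
  show "cmax (lower c p) i = (if p \<le> i \<and> i < q then Suc (cmax c i) else cmax c i)"
  proof (rule even_odd_ge_cases[of i p])
    assume "i < p"
    then show ?thesis using le[of 0] pm by (cases "Suc i = p") (auto simp: cmax_def)
  next
    fix j assume i: "i = p + 2 * j"
    then show ?thesis using le[of j] lo[of j] od[of j] ev[of j] pq by (auto simp: cmax_def)
  next
    fix j assume i: "i = Suc (p + 2 * j)"
    then show ?thesis using lo[of j] le[of "Suc j"] od[of j] ev[of "Suc j"] pq by (auto simp: cmax_def)
  qed
qed

text \<open>The mirror case, where the run consists of larger entries and \<open>p - 1\<close> is
  the partner of \<open>p\<close>. Dropped maxima and raised minima cancel after \<open>p\<close>,
  so the sums lose one at \<open>p - 1\<close> and \<open>p\<close> only.\<close>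

lemma lower_up:
  assumes c: "interlaced c" and p: "0 < p" "c (p - 1) < c p" and ad: "admissible c p \<or> corner c p"
  shows "cmin (lower c p) i = (if p < i \<and> cmax c i = c p then Suc (cmin c i) else cmin c i)"
    and "cmax (lower c p) i = (if p \<le> Suc i \<and> cmax c i = c p then c p - 1 else cmax c i)"
proof -
  obtain p' where p': "p = Suc p'" using p(1) by (cases p) auto
  have ev: "c (p + 2 * j) \<le> c p" for j by (rule interlaced_le[OF c]) auto
  have od: "c (Suc (p + 2 * j)) < c p" for j
    using interlaced_le[OF c, of p' "Suc (p + 2 * j)"] p p' by simp
  \<comment> \<open>If the run goes on, \<open>p\<close> is no corner and hence admissible, so
    \<open>c (Suc p) < c p' < c p\<close>. A raised entry then does not exceed the lowered value
    \<open>c p - 1\<close>, and minima remain minima.\<close>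
  have od2: "Suc (c (Suc (p + 2 * j))) < c p" if "c (p + 2 * Suc j) = c p" for j
  proof -
    have "c (p + 2 * Suc j) \<le> c (Suc (Suc p))" by (rule interlaced_le[OF c]) auto
    then have "\<not> corner c p" using that by (auto simp: corner_def)
    then have "c (Suc p) < c p'" using ad p' by (auto simp: admissible_def)
    moreover have "c (Suc (p + 2 * j)) \<le> c (Suc p)" by (rule interlaced_le[OF c]) auto
    ultimately show ?thesis using p p' by simp
  qed
  note od2 = od2[simplified]
  note le = lower_even[of c p] and lo = lower_odd[of c p]
  show "cmin (lower c p) i = (if p < i \<and> cmax c i = c p then Suc (cmin c i) else cmin c i)"
  proof (rule even_odd_ge_cases[of i p])
    assume "i < p"
    then show ?thesis by (simp add: cmin_def)
  next
    fix j assume i: "i = p + 2 * j"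
    show ?thesis
    proof (cases j)
      case 0
      then show ?thesis using i le[of 0] p p' by (auto simp: cmin_Suc)
    next
      case (Suc m)
      then show ?thesis using i le[of j] lo[of m] od2[of m] od[of m] od[of j] ev[of j]
        by (auto simp: cmin_Suc cmax_def max_def)
    qed
  next
    fix j assume i: "i = Suc (p + 2 * j)"
    have "c (p + 2 * j) = c p" if "c (p + 2 * Suc j) = c p"
      using that ev[of j] interlacedD[OF c, of "p + 2 * j"] by simp
    then show ?thesis using i le[of j] lo[of j] od[of j] od2[of j] ev[of j] ev[of "Suc j"]
      by (auto simp: cmin_Suc cmax_def max_def)
  qed
  show "cmax (lower c p) i = (if p \<le> Suc i \<and> cmax c i = c p then c p - 1 else cmax c i)"
  proof (rule even_odd_ge_cases[of i p])
    assume "i < p"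
    then show ?thesis using le[of 0] p p' by (cases "i = p'") (auto simp: cmax_def)
  next
    fix j assume i: "i = p + 2 * j"
    have "c (p + 2 * j) = c p" if "c (p + 2 * Suc j) = c p"
      using that ev[of j] interlacedD[OF c, of "p + 2 * j"] by simp
    then show ?thesis using i le[of j] lo[of j] od[of j] od2[of j] ev[of j] by (auto simp: cmax_def max_def)
  next
    fix j assume i: "i = Suc (p + 2 * j)"
    then show ?thesis using lo[of j] le[of "Suc j"] od[of j] od2[of j] ev[of "Suc j"]
      by (auto simp: cmax_def max_def)
  qed
qed

text \<open>Here the run changes sides at \<open>e\<close>: up to \<open>e\<close> its entries are
  the smaller ones, afterwards the larger ones, and \<open>e\<close> itself is a single position.
  Past \<open>e\<close> a raised entry may reach \<open>c p\<close> and overtake its lowered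
  neighbour; the exceptional clauses record this exchange of minimum and maximum.\<close>

lemma lower_turn:
  assumes c: "interlaced c" and e: "e = p + 2 * k" and v: "0 < c p"
    and cm: "\<And>i. p \<le> i \<Longrightarrow> i \<le> e \<Longrightarrow> cmin c i = c p" and ce: "c (Suc e) < c p"
  shows "cmin (lower c p) i =
      (if i < p then cmin c i else if i \<le> e then c p - 1
       else if cmax c i = c p \<and> Suc (cmin c i) < c p then Suc (cmin c i) else cmin c i)"
    and "cmax (lower c p) i =
      (if i < p then cmax c i else if i < e then Suc (cmax c i)
       else if cmax c i = c p then (if Suc (cmin c (Suc i)) = c p \<and> cmax c (Suc i) = c p then c p else c p - 1)
       else cmax c i)"
proof -
  have ev: "c (p + 2 * j) = c p" if "j \<le> k" for j
    using cm[of "p + 2 * j"] that e cmin_le[of c "p + 2 * j"] interlaced_le[OF c, of p "p + 2 * j"] by simp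
  have od: "c p \<le> c (Suc (p + 2 * j))" if "j < k" for j
    using cm[of "Suc (p + 2 * j)"] that e cmin_le[of c "Suc (p + 2 * j)"] by simp
  have ev': "c (p + 2 * j) \<le> c p" for j by (rule interlaced_le[OF c]) auto
  have od': "c (Suc (p + 2 * j)) < c p" if "k \<le> j" for j
    using interlaced_le[OF c, of "Suc e" "Suc (p + 2 * j)"] ce e that by simp
  have pm: "p = 0 \<or> c p \<le> c (p - 1)" using cm[of p] e by (auto simp: cmin_def split: if_splits)
  have bk: "c (p + 2 * j) = c p" if "c (p + 2 * Suc j) = c p" for j
    using that ev'[of j] interlacedD[OF c, of "p + 2 * j"] by simp
  note le = lower_even[of c p] and lo = lower_odd[of c p]
  show "cmin (lower c p) i =
      (if i < p then cmin c i else if i \<le> e then c p - 1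
       else if cmax c i = c p \<and> Suc (cmin c i) < c p then Suc (cmin c i) else cmin c i)"
  proof (rule even_odd_ge_cases[of i p])
    assume "i < p"
    then show ?thesis by (simp add: cmin_def)
  next
    fix j assume i: "i = p + 2 * j"
    show ?thesis
    proof (cases j)
      case 0
      then show ?thesis using i le[of 0] pm e by (auto simp: cmin_def)
    next
      case (Suc m)
      show ?thesis
      proof (cases "j \<le> k")
        case True
        then show ?thesis using i Suc le[of j] lo[of m] ev[of j] od[of m] e by (auto simp: cmin_Suc)
      next
        case False
        then show ?thesis using i Suc le[of j] lo[of m] od'[of m] od'[of j] ev'[of j] e
          by (auto simp: cmin_Suc cmax_def max_def min_def)
      qed
    qed
  next
    fix j assume i: "i = Suc (p + 2 * j)"
    show ?thesis
    proof (cases "j < k")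
      case True
      then show ?thesis using i le[of j] lo[of j] ev[of j] ev[of "Suc j"] od[of j] e by (auto simp: cmin_Suc)
    next
      case False
      then show ?thesis using i le[of j] lo[of j] od'[of j] ev'[of j] ev'[of "Suc j"] bk[of j] e v
        by (auto simp: cmin_Suc cmax_def max_def min_def)
    qed
  qed
  show "cmax (lower c p) i =
      (if i < p then cmax c i else if i < e then Suc (cmax c i)
       else if cmax c i = c p then (if Suc (cmin c (Suc i)) = c p \<and> cmax c (Suc i) = c p then c p else c p - 1)
       else cmax c i)"
  proof (rule even_odd_ge_cases[of i p])
    assume "i < p"
    then show ?thesis using le[of 0] pm by (cases "Suc i = p") (auto simp: cmax_def)
  next
    fix j assume i: "i = p + 2 * j"
    show ?thesis
    proof (cases "j < k")
      case True
      then show ?thesis using i le[of j] lo[of j] ev[of j] ev[of "Suc j"] od[of j] e by (auto simp: cmax_def)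
    next
      case False
      then show ?thesis using i le[of j] lo[of j] od'[of j] ev'[of j] ev'[of "Suc j"] bk[of j] od'[of "Suc j"] e v
        by (auto simp: cmin_Suc cmax_def max_def min_def)
    qed
  next
    fix j assume i: "i = Suc (p + 2 * j)"
    show ?thesis
    proof (cases "j < k")
      case True
      then show ?thesis using i le[of "Suc j"] lo[of j] ev[of "Suc j"] od[of j] e by (auto simp: cmax_def)
    next
      case False
      then show ?thesis using i le[of "Suc j"] lo[of j] od'[of j] ev'[of "Suc j"] od'[of "Suc j"] e v
        by (auto simp: cmin_Suc cmax_def max_def min_def)
    qed
  qed
qed

subsection \<open>The terms of the restriction formula for the Lie algebra\<close>

locale fitting =
  fixes lam :: "nat list" and chi :: "nat \<Rightarrow> nat" and c :: "nat \<Rightarrow> nat"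
  assumes interlaced: "interlaced c" and fits: "fits lam chi c"
begin

lemma is_partition_lam: "is_partition lam"
  using fits by (simp add: fits_def)

lemma less_mult_ge: "0 < t \<Longrightarrow> i < mult_ge lam t \<longleftrightarrow> t \<le> csum c i"
  using less_mult_ge_iff[OF is_partition_lam] fits by (simp add: fits_def)

lemma less_mult_gt: "i < mult_gt lam r \<longleftrightarrow> r < csum c i"
  using less_mult_gt_iff[OF is_partition_lam] fits by (simp add: fits_def)

lemma mult_ge_last: "csum c (Suc e) < csum c e \<Longrightarrow> mult_ge lam (csum c e) = Suc e"
  using less_mult_ge[of "csum c e" e] less_mult_ge[of "csum c e" "Suc e"] by auto

lemma in_set_lam: "0 < csum c i \<Longrightarrow> csum c i \<in> set lam"
  using fits_in_set_iff[OF fits] by blast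

lemma mult_ge_lower_one:
  assumes e: "csum c (Suc e) < csum c e" and t: "0 < t"
  shows "mult_ge (lower_one lam (csum c e)) t = mult_ge lam t - of_bool (t = csum c e \<or> Suc t = csum c e)"
  using mult_ge_replace_part[OF in_set_lam t, of e "csum c e - 2"] e t
    less_mult_ge[OF t, of e]
  by (auto simp: lower_one_def of_bool_def split: if_splits)

text \<open>The two lowered parts can be taken at the last two places of their block, where the
  result is decreasing without any reordering.\<close>

lemma less_mult_ge_lower_two:
  assumes q: "csum c (Suc q) = csum c q" and e: "csum c (Suc (Suc q)) < csum c q" and t: "0 < t"
  shows "i < mult_ge (lower_two lam (csum c q)) t \<longleftrightarrow> t \<le> csum c i - of_bool (i = q \<or> i = Suc q)"
proof -
  let ?r = "csum c q"
  have r: "0 < ?r" using e by simp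
  let ?l = "replace_part ?r (?r - 1) lam"
  have l: "mult_ge ?l s = mult_ge lam s - of_bool (s = ?r)" if "0 < s" for s
    using mult_ge_replace_part[OF in_set_lam[OF r] that, of "?r - 1"] that less_mult_ge[OF that, of q]
    by (auto simp: of_bool_def split: if_splits)
  have h: "mult_ge lam ?r = Suc (Suc q)" using mult_ge_last[of "Suc q"] q e by simp
  have "mult_gt lam ?r \<le> q" using less_mult_gt[of q ?r] by simp
  \<comment> \<open>After the first replacement one part \<open>?r\<close> must be left for the
    second; the block has at least two members.\<close>
  then have "mult_gt ?l ?r < mult_ge ?l ?r" using l r h by (simp add: mult_gt_eq)
  then have "?r \<in> set ?l" using mult_ge_eq_gt_count[of ?l ?r] by (simp add: count_list_0_iff flip: neq0_conv)
  from mult_ge_replace_part[OF this t, of "?r - 1"]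
  have "mult_ge (lower_two lam ?r) t = mult_ge lam t - (if t = ?r then 2 else 0)"
    using l[OF t] t r h unfolding lower_two_def by (auto simp: of_bool_def split: if_splits)
  then show ?thesis
    using less_mult_ge[OF t, of i] q e t h csum_antimono[OF interlaced, of i q]
      csum_antimono[OF interlaced, of "Suc (Suc q)" i] by (cases "i < q"; cases "i = q"; cases "i = Suc q"; auto)
qed

lemma X_crit_le:
  assumes "(a, b) \<in> X_crit lam chi"
  obtains k where "a = csum c k" "b = cmin c k" "critical_at c k" "a - b = cmax c k" "b \<le> a"
  using assms fits_chi(3)[OF fits] unfolding X_crit_eq[OF fits] by (auto simp: csum_def)

lemma X_crit_attained:
  assumes "0 < cmin c i"
  obtains k where "critical_at c k" "(csum c k, cmin c k) \<in> X_crit lam chi" "csum c k - cmin c k = cmax c k"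
    "cmin c i \<le> cmin c k" "cmax c k \<le> cmax c i"
  using ex_critical_at[OF interlaced assms] fits_chi(3)[OF fits] unfolding X_crit_eq[OF fits] by blast

lemma X_crit_constraint:
  assumes "critical_at c k"
  shows "cmin c k \<le> cmin c i \<or> cmax c i \<le> cmax c k"
  by (rule critical_at_trichotomy[OF interlaced assms, of i]) auto

text \<open>In the opposite order \<open>c (Suc q) < c q\<close>, the maximum at
  \<open>q + 1\<close> would have to be \<open>c (q + 2)\<close>, and then the part at
  \<open>q + 2\<close> would be no smaller than the one at \<open>q\<close>.\<close>

lemma block_end_cmin:
  assumes "csum c (Suc q) = csum c q" "csum c (Suc (Suc q)) < csum c q"
  shows "c q = cmin c q" "c (Suc q) = cmax c q"
proof -
  have "cmin c (Suc q) = cmin c q" "cmax c (Suc q) = cmax c q"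
    using csum_eqD[OF interlaced assms(1)] by simp_all
  then have eqs: "min (c q) (c (Suc q)) = cmin c q" "max (c (Suc q)) (c (Suc (Suc q))) = cmax c q"
    by (simp_all add: cmin_Suc cmax_def[of c "Suc q"])
  have "c q \<le> c (Suc q)"
  proof (rule ccontr)
    assume "\<not> c q \<le> c (Suc q)"
    then have "cmin c q = c (Suc q)" "c (Suc (Suc q)) = cmax c q"
      using eqs le_cmax[of c q] by (auto simp: max_def split: if_splits)
    then have "cmin c q \<le> cmin c (Suc (Suc q))" "cmax c q \<le> cmax c (Suc (Suc q))"
      using le_cmax[of c "Suc (Suc q)"] cmin_le_cmax[of c q] by (auto simp: cmin_Suc)
    then show False using assms(2) by (simp add: csum_def)
  qed
  then show "c q = cmin c q" "c (Suc q) = cmax c q"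
    using eqs interlacedD[OF interlaced, of q] by auto
qed

text \<open>At a corner only the entry \<open>q\<close> changes: minima drop at \<open>q\<close> and
  \<open>q + 1\<close>, maxima stay. \<open>X_crit\<close> still fits, because a critical point from
  behind the block has \<open>cmin\<close> at most \<open>c (q + 2) < c q\<close> and so does not
  hold the dropped minimum up.\<close>

lemma T_lower_two_critical:
  assumes q: "csum c (Suc q) = csum c q" and e: "csum c (Suc (Suc q)) < csum c q" and co: "corner c q"
  shows "T_vec (lower_two lam (csum c q)) (X_crit lam chi) = e_vec (bipartition_of (lower c q))"
proof -
  note cq = block_end_cmin[OF q e]
  have cm: "cmin c (Suc q) = cmin c q" "cmax c (Suc q) = cmax c q" using csum_eqD[OF interlaced q] by simp_all
  have pos: "0 < c q" using co by (simp add: corner_def)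
  have cmi: "cmin c i = c q" if "q \<le> i" "i \<le> Suc q" for i
    using that cm cq by (cases "i = q") (auto simp: le_Suc_eq)
  have low: "cmin (lower c q) i = (if q \<le> i \<and> i \<le> Suc q then c q - 1 else cmin c i)"
    "cmax (lower c q) i = cmax c i" for i
    using lower_down[OF interlaced, of q q 0 i] pos cmi co by (auto simp: corner_def)
  show ?thesis
  proof (rule T_vec_eqI)
    show "interlaced (lower c q)" by (rule interlaced_lower[OF interlaced pos]) (use co in simp)
    show "is_partition (lower_two lam (csum c q))"
      by (simp add: lower_two_def replace_part_def is_partition_to_partition)
    show "finite (X_crit lam chi)" by (rule finite_X_crit)
  next
    fix t i :: nat assume t: "0 < t"
    have "csum (lower c q) i = csum c i - of_bool (i = q \<or> i = Suc q)"
      using pos cmi[of i] by (auto simp: csum_def low)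
    then show "i < mult_ge (lower_two lam (csum c q)) t \<longleftrightarrow> t \<le> csum (lower c q) i"
      using less_mult_ge_lower_two[OF q e t] by simp
  next
    fix a b i assume "(a, b) \<in> X_crit lam chi"
    then obtain k where k: "a = csum c k" "b = cmin c k" "critical_at c k" "a - b = cmax c k" "b \<le> a"
      by (rule X_crit_le)
    have "cmin c k \<le> c q - 1 \<or> cmax c i \<le> cmax c k" if i: "q \<le> i" "i \<le> Suc q"
    proof (rule critical_at_trichotomy[OF interlaced k(3), of i])
      assume "csum c k < csum c i"
      then have "csum c k < csum c q" using i q by (cases "i = q") (auto simp: le_Suc_eq)
      then have "Suc (Suc q) \<le> k" using csum_antimono[OF interlaced, of k "Suc q"] q by (cases "Suc (Suc q) \<le> k") auto
      then have "cmin c k \<le> c (Suc (Suc q))" 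
        using cmin_antimono[OF interlaced, of "Suc (Suc q)" k] cmin_le[of c "Suc (Suc q)"] by simp
      then have "cmin c k \<le> c q - 1" using co by (simp add: corner_def)
      then show ?thesis ..
    qed auto
    then show "b \<le> a \<and> (b \<le> cmin (lower c q) i \<or> cmax (lower c q) i \<le> a - b)"
      using k X_crit_constraint[OF k(3), of i] by (auto simp: low)
  next
    fix i assume "0 < cmin (lower c q) i"
    then have "0 < cmin c i" "cmin (lower c q) i \<le> cmin c i" using cmi[of i] by (auto simp: low split: if_splits)
    then show "\<exists>a b. (a, b) \<in> X_crit lam chi \<and> cmin (lower c q) i \<le> b \<and> a - b \<le> cmax (lower c q) i"
      using X_crit_attained[of i] low(2)[of i] by (metis order_trans less_irrefl le_less_trans)
  qed
qed

text \<open>The partner of \<open>c q\<close> is lowered, so the value \<open>c q\<close> must now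
  be supported by a point one step lower: the added pair. If \<open>Suc q\<close> is not admissible,
  the next position has the same minimum and a smaller maximum, and a critical point found from
  there already gives this support.\<close>

lemma T_lower_two_up:
  assumes q: "c q < c (Suc q)" and e: "csum c (Suc (Suc q)) < csum c q"
    and ad: "admissible c (Suc q) \<or> corner c (Suc q)"
    and Y: "Y = X_crit lam chi \<union> {(csum c q - 1, cmin c q)} \<or> (Y = X_crit lam chi \<and> \<not> admissible c (Suc q))"
  shows "T_vec (lower_two lam (csum c q)) Y = e_vec (bipartition_of (lower c (Suc q)))"
proof -
  note as = interlaced_ascent[OF interlaced q]
  note qe = as(5)
  note low = lower_up[OF interlaced, of "Suc q", simplified, OF q ad]
  have XY: "X_crit lam chi \<subseteq> Y" using Y by auto
  have new: "csum c q - 1 - cmin c q = c (Suc q) - 1" "cmin c q \<le> csum c q - 1"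
    using as q by (auto simp: csum_def)
  have past: "cmin c i < c q" if "Suc q < i" "cmax c i = c (Suc q)" for i
    using csum_antimono[OF interlaced, of "Suc (Suc q)" i] that e as by (simp add: csum_def)
  show ?thesis
  proof (rule T_vec_eqI)
    show "interlaced (lower c (Suc q))" by (rule interlaced_lower[OF interlaced _ ad]) (use q in simp)
    show "is_partition (lower_two lam (csum c q))"
      by (simp add: lower_two_def replace_part_def is_partition_to_partition)
    show "finite Y" using Y finite_X_crit by auto
  next
    fix t i :: nat assume t: "0 < t"
    have "csum (lower c (Suc q)) i = csum c i - of_bool (i = q \<or> i = Suc q)"
      using as q by (cases "i = q"; cases "i = Suc q") (auto simp: csum_def low)
    then show "i < mult_ge (lower_two lam (csum c q)) t \<longleftrightarrow> t \<le> csum (lower c (Suc q)) i"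
      using less_mult_ge_lower_two[OF qe e t] by simp
  next
    fix a b i assume "(a, b) \<in> Y"
    then consider "(a, b) \<in> X_crit lam chi" | "a = csum c q - 1" "b = cmin c q" using Y by auto
    then show "b \<le> a \<and> (b \<le> cmin (lower c (Suc q)) i \<or> cmax (lower c (Suc q)) i \<le> a - b)"
    proof cases
      case 1
      then obtain k where k: "a = csum c k" "b = cmin c k" "critical_at c k" "a - b = cmax c k" "b \<le> a"
        by (rule X_crit_le)
      then show ?thesis using X_crit_constraint[OF k(3), of i] by (auto simp: low)
    next
      case 2
      have "cmin c q \<le> cmin c i" if "i \<le> Suc q" using cmin_antimono[OF interlaced that] as by simp
      moreover have "cmax c i \<le> c (Suc q)" if "Suc q < i" using cmax_antimono[OF interlaced, of "Suc q" i] that as by simp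
      ultimately show ?thesis using 2 new by (cases "i \<le> Suc q") (auto simp: low)
    qed
  next
    fix i assume pos: "0 < cmin (lower c (Suc q)) i"
    show "\<exists>a b. (a, b) \<in> Y \<and> cmin (lower c (Suc q)) i \<le> b \<and> a - b \<le> cmax (lower c (Suc q)) i"
    proof (cases "q \<le> i \<and> cmax c i = c (Suc q)")
      case True
      have le: "cmin (lower c (Suc q)) i \<le> c q"
        using past[of i] True as by (cases "i = q"; cases "i = Suc q") (auto simp: low)
      show ?thesis
      proof (cases "Y = X_crit lam chi \<union> {(csum c q - 1, cmin c q)}")
        case True
        then show ?thesis using le new as \<open>q \<le> i \<and> _\<close>
          by (intro exI[of _ "csum c q - 1"] exI[of _ "cmin c q"]) (auto simp: low)
      next
        case False
        then have "\<not> admissible c (Suc q)" using Y by auto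
        then have z: "c (Suc (Suc q)) = c q" using interlacedD[OF interlaced, of q] by (simp add: admissible_def)
        then have cm: "cmin c (Suc (Suc q)) = c q" using q by (simp add: cmin_Suc)
        then have cx: "cmax c (Suc (Suc q)) < c (Suc q)" using e as by (simp add: csum_def)
        have "0 < c q" using pos le by simp
        then obtain k where "critical_at c k" "(csum c k, cmin c k) \<in> X_crit lam chi"
          "csum c k - cmin c k = cmax c k" "c q \<le> cmin c k" "cmax c k \<le> cmax c (Suc (Suc q))"
          using X_crit_attained[of "Suc (Suc q)"] cm by auto
        then show ?thesis using le cx True XY
          by (intro exI[of _ "csum c k"] exI[of _ "cmin c k"]) (auto simp: low)
      qed
    next
      case False
      then have "cmin (lower c (Suc q)) i = cmin c i" "cmax (lower c (Suc q)) i = cmax c i"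
        by (auto simp: low)
      then show ?thesis using X_crit_attained[of i] pos XY by (metis subsetD)
    qed
  qed
qed

lemma critical_at_neqD:
  assumes "critical_at c e" "critical_at c k" "csum c k \<noteq> csum c e"
  shows "(cmin c k < cmin c e \<and> cmax c k \<le> cmax c e \<and> csum c k < csum c e) \<or>
    (cmin c e < cmin c k \<and> cmax c e < cmax c k \<and> csum c e < csum c k)"
  by (rule critical_at_trichotomy[OF interlaced assms(1), of k])
    (use assms in \<open>auto simp: critical_at_def\<close>)

lemma run_start_cmax_less:
  assumes "admissible c p" "0 < p" "cmin c p = c p" "cmin c (Suc p) = c p"
  shows "cmax c p < cmax c (p - 1)"
proof -
  have "c p \<le> c (Suc p)" using assms(4) by (auto simp: cmin_Suc)
  then have "cmax c p = c (Suc p)" by (simp add: cmax_def)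
  then show ?thesis using assms(1,2) le_cmax[of c "p - 1"] by (auto simp: admissible_def)
qed

text \<open>Maxima inside a run rise by one, so a critical point further right must beforehand lie
  strictly higher than they do. Admissibility of \<open>p\<close> supplies the strict step, just
  before the run.\<close>

lemma run_start_cmax_less_critical:
  assumes ad: "admissible c p" and cm: "cmin c p = c p" "cmin c (Suc p) = c p"
    and k: "c p < cmin c k" and i: "p \<le> i"
  shows "cmax c i < cmax c k"
proof -
  have "k < p" using cmin_antimono[OF interlaced, of p k] k cm(1) by (cases "k < p") auto
  then have "cmax c p < cmax c (p - 1)" using run_start_cmax_less[OF ad _ cm] by simp
  moreover have "cmax c (p - 1) \<le> cmax c k" using \<open>k < p\<close> by (intro cmax_antimono[OF interlaced]) simp
  ultimately show ?thesis using cmax_antimono[OF interlaced i] by simp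
qed

text \<open>
  The tails of the formula remove a critical point from \<open>X\<close>. The parts before position \<open>p\<close> whose value
  of \<open>\<Psi>\<close> was attained only there must get it from \<open>Z\<close>, or from a critical point with the same \<open>r - \<chi>(r)\<close>.
\<close>

definition tail_extension :: "nat \<Rightarrow> (nat \<times> nat) set \<Rightarrow> bool" where
  "tail_extension p Z \<longleftrightarrow>
     (Z = {} \<and> (\<forall>i<p. cmin c i = c p \<longrightarrow> (\<exists>j. cmax c j = cmax c i \<and> c p < cmin c j))) \<or>
     (0 < p \<and> cmin c (p - 1) = c p \<and> Z = {(csum c (p - 1), c p)})"

lemma tail_extension_attained:
  assumes Z: "tail_extension p Z" and e: "cmin c e = c p" and pe: "p \<le> e" and i: "i < p" "0 < cmin c i"
  shows "\<exists>a b. (a, b) \<in> (X_crit lam chi - {(csum c e, cmin c e)}) \<union> Z \<and> cmin c i \<le> b \<and> a - b \<le> cmax c i"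
proof -
  obtain k where k: "critical_at c k" "(csum c k, cmin c k) \<in> X_crit lam chi"
    "csum c k - cmin c k = cmax c k" "cmin c i \<le> cmin c k" "cmax c k \<le> cmax c i"
    using X_crit_attained[OF i(2)] .
  show ?thesis
  proof (cases "(csum c k, cmin c k) = (csum c e, cmin c e)")
    case False
    then show ?thesis using k by (metis Diff_iff UnI1 singletonD)
  next
    case eq: True
    have "cmin c e \<le> cmin c i" by (rule cmin_antimono[OF interlaced]) (use i pe in simp)
    then have True: "cmin c k = c p \<and> cmin c i = c p" using eq e k by simp
    from Z[unfolded tail_extension_def] show ?thesis
    proof
      assume "Z = {} \<and> (\<forall>i<p. cmin c i = c p \<longrightarrow> (\<exists>j. cmax c j = cmax c i \<and> c p < cmin c j))"
      then obtain j where j: "cmax c j = cmax c i" "c p < cmin c j" using i True by auto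
      then obtain k' where k': "critical_at c k'" "(csum c k', cmin c k') \<in> X_crit lam chi"
        "csum c k' - cmin c k' = cmax c k'" "cmin c j \<le> cmin c k'" "cmax c k' \<le> cmax c j"
        using X_crit_attained[of j] by auto
      then show ?thesis using j e i True by (intro exI[of _ "csum c k'"] exI[of _ "cmin c k'"]) auto
    next
      assume "0 < p \<and> cmin c (p - 1) = c p \<and> Z = {(csum c (p - 1), c p)}"
      moreover have "csum c (p - 1) - cmin c (p - 1) = cmax c (p - 1)" by (simp add: csum_def)
      moreover have "cmax c (p - 1) \<le> cmax c i" using i by (intro cmax_antimono[OF interlaced]) simp
      ultimately show ?thesis using True
        by (intro exI[of _ "csum c (p - 1)"] exI[of _ "c p"] conjI) simp_all
    qed
  qed
qed

text \<open>The removed critical point moves one step to the left, to (cmin - 1, cmax), which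
  accounts for the dropped minima from \<open>p\<close> to \<open>q + 1\<close>. For 2 chi(r) = r
  the pair with second entry (r - 2) / 2 is this same point, so both critical cases with
  \<open>lower_two\<close> in their tail are covered.\<close>

lemma T_lower_two_tail:
  assumes q: "csum c (Suc q) = csum c q" and e: "csum c (Suc (Suc q)) < csum c q"
    and cr: "critical_at c q" and pq: "q = p + 2 * k" and ad: "admissible c p"
    and cm: "\<And>i. p \<le> i \<Longrightarrow> i \<le> Suc q \<Longrightarrow> cmin c i = c p"
    and Z: "tail_extension p Z"
  shows "T_vec (lower_two lam (csum c q))
      (((X_crit lam chi \<union> {(csum c q - 1, cmin c q - 1)}) - {(csum c q, cmin c q)}) \<union> Z) =
    e_vec (bipartition_of (lower c p))" (is "T_vec _ ?Y = _")
proof -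
  note cq = block_end_cmin[OF q e]
  have cmq: "cmin c q = c p" "cmin c (Suc q) = c p" "cmin c p = c p" using cm[of q] cm[of "Suc q"] cm[of p] pq by auto
  have cxq: "cmax c (Suc q) = cmax c q" using csum_eqD[OF interlaced q] by simp_all
  have pos: "0 < c p" using cr cmq by (simp add: critical_at_def)
  have past: "cmin c i < c p" if "Suc q < i" for i
  proof -
    have "csum c i < csum c q" using csum_antimono[OF interlaced, of "Suc (Suc q)" i] that e by simp
    then show ?thesis using cr cmq by (simp add: critical_at_def)
  qed
  have cqp: "c (Suc (Suc q)) < c p"
    using past[of "Suc (Suc q)"] cq cmq cmin_le_cmax[of c q] by (auto simp: cmin_Suc min_def split: if_splits)
  note low = lower_down[OF interlaced pq pos cm cqp]
  have new: "csum c q - 1 - (cmin c q - 1) = cmax c q" "cmin c q - 1 \<le> csum c q - 1"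
    using pos cmq by (auto simp: csum_def)
  have newY: "(csum c q - 1, cmin c q - 1) \<in> ?Y" using pos cmq by (auto simp: csum_def)
  have XY: "X_crit lam chi - {(csum c q, cmin c q)} \<union> Z \<subseteq> ?Y" by auto
  show ?thesis
  proof (rule T_vec_eqI)
    show "interlaced (lower c p)" by (rule interlaced_lower[OF interlaced pos]) (use ad in simp)
    show "is_partition (lower_two lam (csum c q))"
      by (simp add: lower_two_def replace_part_def is_partition_to_partition)
    show "finite ?Y" using Z finite_X_crit by (auto simp: tail_extension_def)
  next
    fix t i :: nat assume t: "0 < t"
    have "csum (lower c p) i = csum c i - of_bool (i = q \<or> i = Suc q)"
      using pos cm[of i] pq by (auto simp: csum_def low)
    then show "i < mult_ge (lower_two lam (csum c q)) t \<longleftrightarrow> t \<le> csum (lower c p) i"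
      using less_mult_ge_lower_two[OF q e t] by simp
  next
    fix a b i assume "(a, b) \<in> ?Y"
    then consider "(a, b) \<in> X_crit lam chi" "(a, b) \<noteq> (csum c q, cmin c q)"
      | "a = csum c q - 1" "b = cmin c q - 1" | "(a, b) \<in> Z" by auto
    then show "b \<le> a \<and> (b \<le> cmin (lower c p) i \<or> cmax (lower c p) i \<le> a - b)"
    proof cases
      case 1
      then obtain k' where k: "a = csum c k'" "b = cmin c k'" "critical_at c k'" "a - b = cmax c k'" "b \<le> a"
        by (auto elim: X_crit_le)
      have neq: "csum c k' \<noteq> csum c q" using 1(2) k csum_eqD(1)[OF interlaced, of k' q] by auto
      show ?thesis
      proof (cases "p \<le> i \<and> i \<le> Suc q")
        case False
        then show ?thesis using k X_crit_constraint[OF k(3), of i] by (auto simp: low)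
      next
        case True
        from critical_at_neqD[OF cr k(3) neq] show ?thesis
        proof (elim disjE conjE)
          assume "cmin c k' < cmin c q"
          then show ?thesis using k True cmq by (auto simp: low)
        next
          assume a: "cmin c q < cmin c k'" "cmax c q < cmax c k'"
          show ?thesis
          proof (cases "i < q")
            case iq: True
            have "cmin c (Suc p) = c p" using cm[of "Suc p"] True iq by simp
            from run_start_cmax_less_critical[OF ad cmq(3) this _ conjunct1[OF True], of k']
            show ?thesis using a k True iq cmq by (auto simp: low)
          next
            case False
            then have "cmax c i = cmax c q" using True cxq by (cases "i = q") (auto simp: le_Suc_eq)
            then show ?thesis using a k False by (simp add: low)
          qed
        qed
      qed
    next
      case 2
      have "c p - 1 \<le> cmin c i" if "i \<le> Suc q" using cmin_antimono[OF interlaced that] cmq by simp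
      moreover have "cmax c i \<le> cmax c q" if "Suc q < i" using cmax_antimono[OF interlaced, of q i] that by simp
      ultimately show ?thesis using 2 new cmq by (cases "i \<le> Suc q") (auto simp: low)
    next
      case 3
      then have z: "0 < p" "cmin c (p - 1) = c p" "a = csum c (p - 1)" "b = c p"
        using Z by (auto simp: tail_extension_def)
      then have ab: "b \<le> a" "a - b = cmax c (p - 1)" by (auto simp: csum_def)
      have "c p \<le> cmin c i" if "i < p" using cmin_antimono[OF interlaced, of i "p - 1"] that z by simp
      moreover have "cmax c i \<le> cmax c (p - 1)" if "p \<le> i" using cmax_antimono[OF interlaced, of "p - 1" i] that by simp
      moreover have "cmax c i < cmax c (p - 1)" if "p \<le> i" "i < q"
      proof -
        have "cmin c (Suc p) = c p" using cm[of "Suc p"] that by simp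
        from run_start_cmax_less[OF ad z(1) cmq(3) this] show ?thesis
          using cmax_antimono[OF interlaced that(1)] by simp
      qed
      ultimately show ?thesis using z ab by (cases "i < p") (auto simp: low)
    qed
  next
    fix i assume p0: "0 < cmin (lower c p) i"
    show "\<exists>a b. (a, b) \<in> ?Y \<and> cmin (lower c p) i \<le> b \<and> a - b \<le> cmax (lower c p) i"
    proof (cases "i < p")
      case True
      then have l: "cmin (lower c p) i = cmin c i" "cmax (lower c p) i = cmax c i" by (auto simp: low)
      have "p \<le> q" using pq by simp
      from tail_extension_attained[OF Z cmq(1) this True] p0 l obtain a b
        where ab: "(a, b) \<in> X_crit lam chi - {(csum c q, cmin c q)} \<union> Z" "cmin c i \<le> b" "a - b \<le> cmax c i"
        by auto
      show ?thesis
        unfolding l using ab(2,3) subsetD[OF XY ab(1)] by (intro exI[of _ a] exI[of _ b] conjI)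
    next
      case ip: False
      show ?thesis
      proof (cases "i \<le> Suc q")
        case True
        have "cmax c q \<le> cmax (lower c p) i"
          using True ip cmax_antimono[OF interlaced, of i q] cxq by (cases "i = Suc q") (auto simp: low)
        then show ?thesis using newY new True ip cmq
          by (intro exI[of _ "csum c q - 1"] exI[of _ "cmin c q - 1"]) (auto simp: low)
      next
        case False
        then have l: "cmin (lower c p) i = cmin c i" "cmax (lower c p) i = cmax c i" by (auto simp: low)
        then obtain k' where k: "critical_at c k'" "(csum c k', cmin c k') \<in> X_crit lam chi"
          "csum c k' - cmin c k' = cmax c k'" "cmin c i \<le> cmin c k'" "cmax c k' \<le> cmax c i"
          using X_crit_attained[of i] p0 by auto
        show ?thesis
        proof (cases "(csum c k', cmin c k') = (csum c q, cmin c q)")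
          case True
          \<comment> \<open>A position behind the block that relied on the removed point has a
            strictly smaller minimum, so the moved point still serves it.\<close>
          then have "cmax c k' = cmax c q" by (simp add: csum_def)
          then show ?thesis using newY new k past[of i] False l cmq
            by (intro exI[of _ "csum c q - 1"] exI[of _ "cmin c q - 1"]) auto
        next
          case neq: False
          then show ?thesis using k l by (intro exI[of _ "csum c k'"] exI[of _ "cmin c k'"]) auto
        qed
      qed
    qed
  qed
qed

text \<open>Such a position lies on the diagonal. Since \<open>cmin\<close> never exceeds
  \<open>cmax\<close>, a smaller sum has a smaller \<open>cmin\<close>, and a larger sum a larger
  \<open>cmax\<close>.\<close>

lemma critical_at_single:
  assumes e: "csum c (Suc e) < csum c e" and single: "cmin c e = cmax c e"
  shows "critical_at c e"
  unfolding critical_at_def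
proof (intro conjI allI impI)
  show "0 < cmin c e" using e single by (simp add: csum_def)
next
  fix j assume "csum c j < csum c e"
  then show "cmin c j < cmin c e" using cmin_le_cmax[of c j] single by (simp add: csum_def)
next
  fix j assume "csum c e < csum c j"
  then show "cmax c e < cmax c j" using cmin_le_cmax[of c j] single by (simp add: csum_def)
qed

text \<open>The inclusions for \<open>Y\<close> and the disjunction for \<open>Z\<close> cover two
  uses at once: adding the point for r - 2 to all of \<open>X_crit\<close> with
  \<open>p = e\<close>, and replacing the critical point of \<open>e\<close> by it for a run
  starting at \<open>p\<close>. The added point is (c p - 1, c p - 1), again on the
  diagonal.\<close>

lemma T_lower_one:
  assumes e: "csum c (Suc e) < csum c e" and single: "cmin c e = cmax c e"
    and pe: "e = p + 2 * k" and ad: "admissible c p"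
    and cm: "\<And>i. p \<le> i \<Longrightarrow> i \<le> e \<Longrightarrow> cmin c i = c p"
    and newY: "(csum c e - 2, (csum c e - 2) div 2) \<in> Y"
    and sub: "Y \<subseteq> X_crit lam chi \<union> {(csum c e - 2, (csum c e - 2) div 2)} \<union> Z"
    and sup: "X_crit lam chi - {(csum c e, cmin c e)} \<union> Z \<subseteq> Y"
    and Z: "(p = e \<and> Z = {} \<and> X_crit lam chi \<subseteq> Y) \<or> ((csum c e, cmin c e) \<notin> Y \<and> tail_extension p Z)"
  shows "T_vec (lower_one lam (csum c e)) Y = e_vec (bipartition_of (lower c p))"
proof -
  have cr: "critical_at c e" by (rule critical_at_single[OF e single])
  have cme: "cmin c e = c p" "cmin c p = c p" using cm[of e] cm[of p] pe by auto
  have cxe: "cmax c e = c p" using cme single by simp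
  have pos: "0 < c p" using cr cme by (simp add: critical_at_def)
  have past: "cmin c i < c p" "cmax c i \<le> c p" if "e < i" for i
  proof -
    have "csum c i < csum c e" using csum_antimono[OF interlaced, of "Suc e" i] that e by simp
    then show "cmin c i < c p" using cr cme by (simp add: critical_at_def)
    show "cmax c i \<le> c p" using cmax_antimono[OF interlaced, of e i] that cxe by simp
  qed
  have "c e = c p" using cmin_le[of c e] le_cmax[of c e] cme cxe by simp
  then have ce: "c (Suc e) < c p" using past(1)[of "Suc e"] by (auto simp: cmin_Suc min_def split: if_splits)
  note low = lower_turn[OF interlaced pe pos cm ce]
  have csume: "csum c e = 2 * c p" using cme cxe by (simp add: csum_def)
  have new: "(csum c e - 2) div 2 = c p - 1" "csum c e - 2 - (c p - 1) = c p - 1" "c p - 1 \<le> csum c e - 2"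
    using pos csume by auto
  have high: "c p \<le> cmin c i" if "i \<le> e" for i using cmin_antimono[OF interlaced that] cme by simp
  show ?thesis
  proof (rule T_vec_eqI)
    show "interlaced (lower c p)" by (rule interlaced_lower[OF interlaced pos]) (use ad in simp)
    show "is_partition (lower_one lam (csum c e))"
      by (simp add: lower_one_def replace_part_def is_partition_to_partition)
    have "finite Z" using Z by (auto simp: tail_extension_def)
    then show "finite Y" using finite_subset[OF sub] finite_X_crit by simp
  next
    fix t i :: nat assume t: "0 < t"
    \<comment> \<open>Replacing 2 c(p) by 2 c(p) - 2 may have to pass parts equal to 2 c(p) - 1.
      After sorting this appears as a shift: those parts move up one place, beginning at
      \<open>e\<close>, and the last place concerned receives 2 c(p) - 2.\<close>
    have csum: "csum (lower c p) i = (if i < e then csum c i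
        else if i = e \<or> Suc (csum c i) = 2 * c p
        then (if Suc (csum c (Suc i)) = 2 * c p then 2 * c p - 1 else 2 * c p - 2) else csum c i)"
    proof -
      have "Suc (csum c j) = 2 * c p \<longleftrightarrow> Suc (cmin c j) = c p \<and> cmax c j = c p" if "e < j" for j
        using past[OF that] by (auto simp: csum_def)
      note next_block = this
      have nxt: "Suc (cmin c (Suc i)) = c p \<and> cmax c (Suc i) = c p \<longleftrightarrow> Suc (csum c (Suc i)) = 2 * c p" if "e \<le> i"
        using next_block[of "Suc i"] that by simp
      have sums: "csum (lower c p) i = cmin (lower c p) i + cmax (lower c p) i" "csum c i = cmin c i + cmax c i"
        by (simp_all add: csum_def)
      have double: "n - 1 + n = 2 * n - 1" "n - 1 + (n - 1) = 2 * n - 2" for n :: nat by simp_all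
      consider "i < p" | "p \<le> i" "i < e" | "i = e" | "e < i" "cmax c i \<noteq> c p" | "e < i" "cmax c i = c p" by linarith
      then show ?thesis
      proof cases
        case 1
        then show ?thesis using pe by (simp add: sums low)
      next
        case 2
        then show ?thesis using pos cm[of i] by (simp add: sums low)
      next
        case 3
        then have "cmin (lower c p) i = c p - 1"
          "cmax (lower c p) i = (if Suc (csum c (Suc i)) = 2 * c p then c p else c p - 1)"
          using pe cxe nxt by (simp_all add: low)
        then show ?thesis using 3 double sums(1) by auto
      next
        case 4
        then have "Suc (csum c i) \<noteq> 2 * c p" using next_block[of i] by simp
        then show ?thesis using 4 pe by (simp add: sums low)
      next
        case 5
        then have x: "cmax (lower c p) i = (if Suc (csum c (Suc i)) = 2 * c p then c p else c p - 1)"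
          using pe nxt by (simp add: low)
        show ?thesis
        proof (cases "Suc (cmin c i) = c p")
          case True
          then have "Suc (csum c i) = 2 * c p" using next_block[of i] 5 by simp
          moreover have "cmin (lower c p) i = c p - 1" using 5 True pe by (auto simp: low)
          ultimately show ?thesis using x 5 double sums(1) by auto
        next
          case False
          then have m: "Suc (cmin c i) < c p" "Suc (csum c i) \<noteq> 2 * c p"
            using past(1)[of i] 5 next_block[of i] by auto
          then have "Suc (csum c i) < 2 * c p" using 5 sums(2) by simp
          moreover have "csum c (Suc i) \<le> csum c i" by (rule csum_antimono[OF interlaced]) simp
          ultimately have "cmax (lower c p) i = c p - 1" using x by simp
          moreover have "cmin (lower c p) i = Suc (cmin c i)" using 5 m pe by (simp add: low)
          ultimately show ?thesis using 5 m sums by simp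
        qed
      qed
    qed
    have "i < mult_ge lam t - of_bool (t = csum c e \<or> Suc t = csum c e) \<longleftrightarrow>
      (if t = csum c e then i < e else if Suc t = csum c e then t \<le> csum c (Suc i) else t \<le> csum c i)"
      using less_mult_ge[OF t, of i] less_mult_ge[OF t, of "Suc i"] mult_ge_last[OF e]
      by auto
    also have "\<dots> \<longleftrightarrow> t \<le> csum (lower c p) i"
      using csum csume pos e csum_antimono[OF interlaced, of i e] csum_antimono[OF interlaced, of "Suc i" e]
        csum_antimono[OF interlaced, of "Suc e" i] csum_antimono[OF interlaced, of "Suc e" "Suc i"]
        csum_antimono[OF interlaced, of i "Suc i"]
      by (cases "i < e"; cases "i = e") auto
    finally show "i < mult_ge (lower_one lam (csum c e)) t \<longleftrightarrow> t \<le> csum (lower c p) i"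
      by (simp add: mult_ge_lower_one[OF e t])
  next
    fix a b i assume ab: "(a, b) \<in> Y"
    then consider "(a, b) \<in> X_crit lam chi"
      | "a = csum c e - 2" "b = c p - 1" | "(a, b) \<in> Z" using sub new by auto
    then show "b \<le> a \<and> (b \<le> cmin (lower c p) i \<or> cmax (lower c p) i \<le> a - b)"
    proof cases
      case 1
      then obtain k' where k: "a = csum c k'" "b = cmin c k'" "critical_at c k'" "a - b = cmax c k'" "b \<le> a"
        by (auto elim: X_crit_le)
      consider "i < p" | "p \<le> i" "i < e" | "i = e" | "e < i" by linarith
      then show ?thesis
      proof cases
        case 1
        then show ?thesis using k X_crit_constraint[OF k(3), of i] by (auto simp: low)
      next
        case 2
        then have "(csum c e, cmin c e) \<notin> Y" using Z by auto
        then have neq: "csum c k' \<noteq> csum c e" using k ab csum_eqD(1)[OF interlaced, of k' e] by auto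
        have "cmin c (Suc p) = c p" using cm[of "Suc p"] 2 by simp
        from run_start_cmax_less_critical[OF ad cme(2) this _ 2(1), of k']
        show ?thesis using critical_at_neqD[OF cr k(3) neq] k 2 cme by (auto simp: low)
      next
        case 3
        show ?thesis
        proof (rule critical_at_trichotomy[OF interlaced k(3), of e])
          assume "cmin c k' \<le> cmin c e" "cmax c k' < cmax c e"
          then show ?thesis using k 3 cme cxe cmin_le_cmax[of c k'] pe by (auto simp: low)
        qed (use k 3 cxe pe in \<open>auto simp: low\<close>)
      next
        case 4
        then show ?thesis using k X_crit_constraint[OF k(3), of i] pe by (auto simp: low)
      qed
    next
      case 2
      show ?thesis
      proof (cases "i \<le> e")
        case True
        then have "c p - 1 \<le> cmin c i" using high[of i] by linarith
        then show ?thesis using 2 new True by (auto simp: low)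
      next
        case False
        then show ?thesis using 2 new past[of i] pe cmin_antimono[OF interlaced, of i "Suc i"]
          by (auto simp: low)
      qed
    next
      case 3
      then have z: "0 < p" "cmin c (p - 1) = c p" "a = csum c (p - 1)" "b = c p"
        using Z by (auto simp: tail_extension_def)
      then have abz: "b \<le> a" "a - b = cmax c (p - 1)" by (auto simp: csum_def)
      have "c p \<le> cmin c i" if "i < p" using high[of i] that pe by simp
      moreover have "cmax c i \<le> cmax c (p - 1)" if "p \<le> i" using cmax_antimono[OF interlaced, of "p - 1" i] that by simp
      moreover have "cmax c i < cmax c (p - 1)" if "p \<le> i" "i < e"
      proof -
        have "cmin c (Suc p) = c p" using cm[of "Suc p"] that by simp
        from run_start_cmax_less[OF ad z(1) cme(2) this] show ?thesis
          using cmax_antimono[OF interlaced that(1)] by simp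
      qed
      ultimately show ?thesis using z abz by (cases "i < p") (auto simp: low)
    qed
  next
    fix i assume p0: "0 < cmin (lower c p) i"
    \<comment> \<open>The added diagonal point is the witness from \<open>p\<close> to
      \<open>e\<close>, and beyond \<open>e\<close> as long as the maximum was \<open>c p\<close>;
      in these places the new minimum is at most \<open>c p - 1\<close>.\<close>
    have viaNew: "\<exists>a b. (a, b) \<in> Y \<and> cmin (lower c p) i \<le> b \<and> a - b \<le> cmax (lower c p) i"
      if "cmin (lower c p) i \<le> c p - 1" "c p - 1 \<le> cmax (lower c p) i"
      using that newY new by (intro exI[of _ "csum c e - 2"] exI[of _ "c p - 1"]) auto
    show "\<exists>a b. (a, b) \<in> Y \<and> cmin (lower c p) i \<le> b \<and> a - b \<le> cmax (lower c p) i"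
    proof (cases "i < p")
      case True
      then have l: "cmin (lower c p) i = cmin c i" "cmax (lower c p) i = cmax c i" by (auto simp: low)
      have "\<exists>a b. (a, b) \<in> Y \<and> cmin c i \<le> b \<and> a - b \<le> cmax c i"
        using Z
      proof
        assume "p = e \<and> Z = {} \<and> X_crit lam chi \<subseteq> Y"
        then show ?thesis using X_crit_attained[of i] p0 l by (metis subsetD)
      next
        assume z: "(csum c e, cmin c e) \<notin> Y \<and> tail_extension p Z"
        have "p \<le> e" using pe by simp
        from tail_extension_attained[OF conjunct2[OF z] cme(1) this True] p0 l show ?thesis
          using sup by auto
      qed
      then show ?thesis unfolding l .
    next
      case ip: False
      consider "i \<le> e" | "e < i" "cmax c i = c p" | "e < i" "cmax c i < c p" using past(2)[of i] by linarith
      then show ?thesis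
      proof cases
        case 1
        then show ?thesis using ip cmax_antimono[OF interlaced, of i e] cxe by (intro viaNew) (auto simp: low)
      next
        case 2
        then show ?thesis using ip past[of i] pe by (intro viaNew) (auto simp: low)
      next
        case 3
        then have l: "cmin (lower c p) i = cmin c i" "cmax (lower c p) i = cmax c i" using pe by (auto simp: low)
        then obtain k' where k: "critical_at c k'" "(csum c k', cmin c k') \<in> X_crit lam chi"
          "csum c k' - cmin c k' = cmax c k'" "cmin c i \<le> cmin c k'" "cmax c k' \<le> cmax c i"
          using X_crit_attained[of i] p0 by auto
        then have "csum c k' \<noteq> csum c e" using csum_eqD(2)[OF interlaced, of k' e] cxe 3 by auto
        then show ?thesis using k l sup by (intro exI[of _ "csum c k'"] exI[of _ "cmin c k'"]) auto
      qed
    qed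
  qed
qed

end

subsection \<open>A formula symmetric in the two partitions\<close>

lemma lookup_scale_E: "Poly_Mapping.lookup (a *\<^sub>E v) k = a * Poly_Mapping.lookup v k"
  by (auto simp: scale_E_def map.rep_eq when_def)

lemma scale_E_add_left: "(a + b) *\<^sub>E v = a *\<^sub>E v + b *\<^sub>E v"
  by (rule poly_mapping_eqI) (simp add: lookup_scale_E lookup_add distrib_right)

lemma scale_E_zero [simp]: "0 *\<^sub>E v = 0" "a *\<^sub>E 0 = 0"
  by (rule poly_mapping_eqI; simp add: lookup_scale_E)+

definition lower_vec :: "(nat \<Rightarrow> nat) \<Rightarrow> nat \<Rightarrow> free_space" where
  "lower_vec c p = e_vec (bipartition_of (lower c p))"

definition previous_starts :: "(nat \<Rightarrow> nat) \<Rightarrow> nat \<Rightarrow> nat set" where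
  "previous_starts c p = {p'. p' < p \<and> even (p - p') \<and> admissible c p' \<and> c p' = c p}"

text \<open>Differences of consecutive starts of a run telescope. The first start has nothing to
  subtract, which accounts for the lone powers in both formulas.\<close>

definition start_weight :: "(nat \<Rightarrow> nat) \<Rightarrow> nat \<Rightarrow> ratfun" where
  "start_weight c p = xp (int p) -
     (if previous_starts c p = {} then 0 else xp (int (Max (previous_starts c p))))"

text \<open>The geometric sum ending at \<open>q\<close> is stopped by the last position of its
  parity that is a legal start or has a larger value; with no such position it goes down to 0. If
  \<open>q\<close> itself is a legal start the sum is empty, so its vector is counted among the
  starts only.\<close>

definition corner_base :: "(nat \<Rightarrow> nat) \<Rightarrow> nat \<Rightarrow> nat" where
  "corner_base c q = Max (insert 0 {Suc p |p. p \<le> q \<and> even (q - p) \<and> (admissible c p \<or> c q < c p)})"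

definition corner_weight :: "(nat \<Rightarrow> nat) \<Rightarrow> nat \<Rightarrow> ratfun" where
  "corner_weight c q = (xp (int q + 1) - xp (int (corner_base c q))) / (x_ind - 1)"

definition box_sum :: "(nat \<Rightarrow> nat) \<Rightarrow> free_space" where
  "box_sum c = (\<Sum>p | admissible c p \<and> 0 < c p. start_weight c p *\<^sub>E lower_vec c p) +
     (\<Sum>q | corner c q. corner_weight c q *\<^sub>E lower_vec c q)"

text \<open>\<open>own\<close> says which part's bracket contains the term of a position. The two
  formulas turn out to differ only in these assignments.\<close>

abbreviation owned_starts :: "(nat \<Rightarrow> nat) \<Rightarrow> (nat \<Rightarrow> nat) \<Rightarrow> nat \<Rightarrow> free_space" where
  "owned_starts c own r \<equiv>
     (\<Sum>p | admissible c p \<and> 0 < c p \<and> own p = r. start_weight c p *\<^sub>E lower_vec c p)"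

abbreviation owned_corners :: "(nat \<Rightarrow> nat) \<Rightarrow> (nat \<Rightarrow> nat) \<Rightarrow> nat \<Rightarrow> free_space" where
  "owned_corners c own r \<equiv> (\<Sum>q | corner c q \<and> own q = r. corner_weight c q *\<^sub>E lower_vec c q)"

lemma start_weight_first:
  assumes "\<And>p'. p' < p \<Longrightarrow> even (p - p') \<Longrightarrow> admissible c p' \<Longrightarrow> c p' \<noteq> c p"
  shows "start_weight c p = xp (int p)"
proof -
  have "previous_starts c p = {}" using assms by (auto simp: previous_starts_def)
  then show ?thesis by (simp add: start_weight_def)
qed

lemma start_weight_next:
  assumes "b < p" "even (p - b)" "admissible c b" "c b = c p"
    and "\<And>p'. b < p' \<Longrightarrow> p' < p \<Longrightarrow> even (p - p') \<Longrightarrow> \<not> admissible c p'"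
  shows "start_weight c p = xp (int p) - xp (int b)"
proof -
  have "finite (previous_starts c p)" by (rule finite_subset[of _ "{..<p}"]) (auto simp: previous_starts_def)
  moreover have "b \<in> previous_starts c p" using assms by (simp add: previous_starts_def)
  ultimately have "Max (previous_starts c p) = b"
    using assms(5) by (intro Max_eqI) (auto simp: previous_starts_def not_le[symmetric])
  then show ?thesis using \<open>b \<in> _\<close> by (auto simp: start_weight_def)
qed

lemma corner_weight_eq:
  assumes "b \<le> Suc q" "b = 0 \<or> even (Suc q - b) \<and> (admissible c (b - 1) \<or> c q < c (b - 1))"
    and "\<And>p. b \<le> p \<Longrightarrow> p \<le> q \<Longrightarrow> even (q - p) \<Longrightarrow> \<not> admissible c p \<and> c p \<le> c q"
  shows "corner_weight c q = (xp (int q + 1) - xp (int b)) / (x_ind - 1)"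
proof -
  let ?M = "insert 0 {Suc p |p. p \<le> q \<and> even (q - p) \<and> (admissible c p \<or> c q < c p)}"
  have "finite ?M" by (rule finite_subset[of _ "{..Suc q}"]) auto
  then have "Max ?M = b"
  proof (rule Max_eqI)
    fix y assume "y \<in> ?M"
    then show "y \<le> b" using assms(3) by (fastforce simp: not_less_eq_eq not_le)
  next
    show "b \<in> ?M"
    proof (cases b)
      case (Suc p)
      then show ?thesis using assms(1,2) by auto
    qed simp
  qed
  then show ?thesis by (simp add: corner_weight_def corner_base_def)
qed

lemma corner_weight_admissible:
  assumes "admissible c q"
  shows "corner_weight c q = 0"
  using corner_weight_eq[of "Suc q" q c] assms by (simp add: add.commute)

lemma
  assumes "interlaced c"
  shows finite_admissible: "finite {p. admissible c p \<and> 0 < c p}"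
    and finite_corner: "finite {q. corner c q}"
proof -
  obtain n where n: "\<And>j. n \<le> j \<Longrightarrow> c j = 0" using assms by (auto simp: interlaced_def)
  have "j < n" if "0 < c j" for j using n[of j] that by (cases "j < n") auto
  then show "finite {p. admissible c p \<and> 0 < c p}" "finite {q. corner c q}"
    by (auto intro!: finite_subset[of _ "{..<n}"] simp: corner_def)
qed

lemma box_sum_grouped:
  assumes c: "interlaced c" and S: "finite S"
    and own: "\<And>p. admissible c p \<Longrightarrow> 0 < c p \<Longrightarrow> own p \<in> S" and own': "\<And>q. corner c q \<Longrightarrow> own' q \<in> S"
  shows "box_sum c = (\<Sum>r\<in>S. owned_starts c own r + owned_corners c own' r)"
proof -
  have "(\<Sum>p | admissible c p \<and> 0 < c p. start_weight c p *\<^sub>E lower_vec c p) =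
      (\<Sum>r\<in>S. \<Sum>p | p \<in> {p. admissible c p \<and> 0 < c p} \<and> own p = r. start_weight c p *\<^sub>E lower_vec c p)"
    by (rule sum.group[symmetric]) (use finite_admissible[OF c] S own in auto)
  moreover have "(\<Sum>q | corner c q. corner_weight c q *\<^sub>E lower_vec c q) =
      (\<Sum>r\<in>S. \<Sum>q | q \<in> {q. corner c q} \<and> own' q = r. corner_weight c q *\<^sub>E lower_vec c q)"
    by (rule sum.group[symmetric]) (use finite_corner[OF c] S own' in auto)
  ultimately show ?thesis by (simp add: box_sum_def sum.distrib conj_assoc)
qed

section \<open>Blocks of equal parts of lambda and legal starts\<close>

context fitting
begin

definition block_start :: "nat \<Rightarrow> bool" where
  "block_start p \<longleftrightarrow> p = 0 \<or> csum c p < csum c (p - 1)"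

definition block_end :: "nat \<Rightarrow> bool" where
  "block_end p \<longleftrightarrow> csum c (Suc p) < csum c p"

lemma block_start_Suc: "block_start (Suc p) \<longleftrightarrow> block_end p"
  by (simp add: block_start_def block_end_def)

text \<open>An ascent joins two positions with equal sums, so it never crosses the boundary of a
  block; the entry before a block start is therefore not the smaller one.\<close>

lemma block_start_c: "block_start p \<Longrightarrow> c p = cmin c p"
proof (cases p)
  case (Suc i)
  assume "block_start p"
  then have "\<not> c i < c (Suc i)" using Suc interlaced_ascent(5)[OF interlaced, of i] by (auto simp: block_start_def)
  then show ?thesis using Suc by (simp add: cmin_Suc)
qed (simp add: cmin_def)

lemma block_end_c: "block_end e \<Longrightarrow> c e = cmax c e"
  using interlaced_ascent(5)[OF interlaced, of e] by (force simp: block_end_def cmax_def)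

text \<open>\<open>c\<close> falls strictly across the boundary of a block, so the legality test
  against \<open>c (e - 1)\<close> may be made against the minimum at \<open>e\<close>. The result
  is a drop of chi after the block, one half of criticality.\<close>

lemma block_end_admissible:
  assumes "block_end e"
  shows "admissible c e \<longleftrightarrow> cmin c (Suc e) < cmin c e"
proof -
  have ce: "c e = cmax c e" by (rule block_end_c[OF assms])
  then have le: "c (Suc e) \<le> c e" by (simp add: cmax_def)
  then have m: "cmin c (Suc e) = c (Suc e)" by (simp add: cmin_Suc)
  have "csum c (Suc e) < csum c e" using assms by (simp add: block_end_def)
  moreover have "csum c e \<le> 2 * c e" using ce cmin_le[of c e] by (simp add: csum_def)
  moreover have "2 * c (Suc e) \<le> csum c (Suc e)" using m le_cmax[of c "Suc e"] by (simp add: csum_def)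
  ultimately have "c (Suc e) < c e" by simp
  then show ?thesis using m by (cases e) (auto simp: admissible_def cmin_def)
qed

text \<open>The other half of criticality: the comparison of r - chi(r) with the preceding
  block.\<close>

lemma block_start_admissible:
  assumes "block_start (Suc i)"
  shows "admissible c (Suc i) \<longleftrightarrow> cmax c (Suc i) < cmax c i"
proof -
  have be: "block_end i" using assms by (simp add: block_start_Suc)
  have ci: "c i = cmax c i" by (rule block_end_c[OF be])
  have m: "c (Suc i) = cmin c (Suc i)" by (rule block_start_c[OF assms])
  have "csum c (Suc i) < csum c i" using be by (simp add: block_end_def)
  moreover have "csum c i \<le> 2 * c i" using ci cmin_le[of c i] by (simp add: csum_def)
  moreover have "2 * c (Suc i) \<le> csum c (Suc i)" using m le_cmax[of c "Suc i"] by (simp add: csum_def)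
  ultimately have "c (Suc i) < c i" by simp
  then show ?thesis by (simp add: admissible_def cmax_def[of c "Suc i"] flip: ci)
qed

lemma inside_block:
  assumes "\<not> block_start (Suc i)" "\<not> block_end (Suc i)"
  shows "c i = c (Suc (Suc i))"
proof -
  have s: "csum c (Suc i) = csum c i" "csum c (Suc (Suc i)) = csum c i"
    using assms csum_antimono[OF interlaced, of i "Suc i"] csum_antimono[OF interlaced, of "Suc i" "Suc (Suc i)"]
    by (auto simp: block_start_def block_end_def)
  have "min (c i) (c (Suc i)) = min (c (Suc i)) (c (Suc (Suc i)))"
    "max (c i) (c (Suc i)) = max (c (Suc i)) (c (Suc (Suc i)))"
    using csum_eqD[OF interlaced, of "Suc i" "Suc (Suc i)"] csum_eqD[OF interlaced, of "i" "Suc i"] s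
    by (simp_all add: cmin_Suc cmax_def)
  then show ?thesis by (auto simp: min_def max_def split: if_splits)
qed

text \<open>Strictly inside a block \<open>c\<close> has period two, so no entry can be raised
  there.\<close>

lemma admissible_cases: "admissible c p \<Longrightarrow> block_start p \<or> block_end p"
  using inside_block[of "p - 1"] by (cases p) (auto simp: admissible_def block_start_def)

lemma constant_cmin_even:
  assumes "\<And>i. p \<le> i \<Longrightarrow> i \<le> e \<Longrightarrow> cmin c i = c p" "p + 2 * j \<le> e"
  shows "c (p + 2 * j) = c p"
  using assms(1)[of "p + 2 * j"] assms(2) cmin_le[of c "p + 2 * j"] interlaced_le[OF interlaced, of p "p + 2 * j"]
  by simp

definition part_start :: "nat \<Rightarrow> nat" where
  "part_start r = mult_gt lam r"

definition part_end :: "nat \<Rightarrow> nat" where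
  "part_end r = mult_ge lam r - 1"

lemma in_set_lamE:
  assumes "r \<in> set lam"
  obtains i where "r = csum c i" "0 < r"
proof -
  have "0 < r \<and> (\<exists>i. csum c i = r)" using assms by (simp add: fits_in_set_iff[OF fits])
  then show ?thesis using that by auto
qed

lemma part_block:
  assumes "r \<in> set lam"
  shows "csum c i = r \<longleftrightarrow> part_start r \<le> i \<and> i \<le> part_end r"
    and "mult_ge lam r = Suc (part_end r)" "part_start r \<le> part_end r"
    and "csum c (part_start r) = r" "csum c (part_end r) = r"
    and "block_start (part_start r)" "block_end (part_end r)"
proof -
  obtain k where k: "r = csum c k" "0 < r" by (rule in_set_lamE[OF assms])
  have lt: "\<And>i. i < mult_ge lam r \<longleftrightarrow> r \<le> csum c i" using less_mult_ge k by blast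
  have gt: "\<And>i. i < part_start r \<longleftrightarrow> r < csum c i" using less_mult_gt by (simp add: part_start_def)
  have "k < mult_ge lam r" using lt k by simp
  then show e: "mult_ge lam r = Suc (part_end r)" by (simp add: part_end_def)
  show iff: "csum c i = r \<longleftrightarrow> part_start r \<le> i \<and> i \<le> part_end r" for i
    using lt[of i] gt[of i] e by auto
  show le: "part_start r \<le> part_end r" using iff[of k] k by simp
  then show cs: "csum c (part_start r) = r" "csum c (part_end r) = r" using iff by auto
  show "block_start (part_start r)"
    using gt[of "part_start r - 1"] cs by (auto simp: block_start_def)
  show "block_end (part_end r)"
    using lt[of "Suc (part_end r)"] cs e by (auto simp: block_end_def)
qed

lemma block_start_eq: "block_start p \<Longrightarrow> 0 < csum c p \<Longrightarrow> part_start (csum c p) = p"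
proof -
  assume p: "block_start p" "0 < csum c p"
  note b = part_block[OF in_set_lam[OF p(2)]]
  have "part_start (csum c p) \<le> p" using b(1)[of p] by simp
  moreover have "csum c (p - 1) \<noteq> csum c p \<or> p = 0" using p by (auto simp: block_start_def)
  then have "p - 1 < part_start (csum c p) \<or> p = 0" using b(1)[of p] b(1)[of "p - 1"] by auto
  ultimately show ?thesis by linarith
qed

lemma block_end_eq: "block_end p \<Longrightarrow> part_end (csum c p) = p"
proof -
  assume p: "block_end p"
  then have "0 < csum c p" by (simp add: block_end_def)
  note b = part_block[OF in_set_lam[OF this]]
  have "p \<le> part_end (csum c p)" using b(1)[of p] by simp
  moreover have "csum c (Suc p) \<noteq> csum c p" using p by (auto simp: block_end_def)
  then have "\<not> Suc p \<le> part_end (csum c p)" using b(1)[of p] b(1)[of "Suc p"] by auto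
  ultimately show ?thesis by linarith
qed

lemma not_admissible_inside:
  assumes "r \<in> set lam" "part_start r < i" "i < part_end r"
  shows "\<not> admissible c i"
proof
  assume "admissible c i"
  then have "block_start i \<or> block_end i" by (rule admissible_cases)
  moreover have "csum c i = r" using part_block(1)[OF assms(1)] assms(2,3) by simp
  moreover have "0 < r" by (rule in_set_lamE[OF assms(1)])
  ultimately show False using block_start_eq[of i] block_end_eq[of i] assms(2,3) by auto
qed

lemma block_cmin_cmax:
  assumes "r \<in> set lam" "part_start r \<le> i" "i \<le> part_end r"
  shows "cmin c i = chi r" "cmax c i = r - chi r"
  using assms part_block(1)[OF assms(1), of i] fits_chi[OF fits, of i] by auto

lemma block_even:
  assumes "r \<in> set lam" "part_start r + 2 * j \<le> part_end r"
  shows "c (part_start r + 2 * j) = chi r"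
proof -
  note b = part_block[OF assms(1)]
  have "c (part_start r) = chi r" using block_start_c[OF b(6)] block_cmin_cmax[OF assms(1)] b(3) by simp
  then show ?thesis
    using constant_cmin_even[of "part_start r" "part_end r" j] block_cmin_cmax(1)[OF assms(1)] assms(2) by simp
qed

text \<open>A block alternates between its two values, starting with the smaller and ending with the
  larger; if they differ, its length is even.\<close>

lemma block_parity:
  assumes "r \<in> set lam" "2 * chi r \<noteq> r"
  shows "odd (part_end r - part_start r)"
proof
  assume "even (part_end r - part_start r)"
  then obtain j where j: "part_end r = part_start r + 2 * j"
    using part_block(3)[OF assms(1)] by (metis evenE le_add_diff_inverse)
  have "c (part_end r) = chi r" unfolding j by (rule block_even[OF assms(1)]) (simp add: j)
  moreover have "c (part_end r) = r - chi r"
    using block_end_c[OF part_block(7)[OF assms(1)]] block_cmin_cmax[OF assms(1)] part_block(3)[OF assms(1)] by simp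
  moreover have "csum c (part_end r) = chi r + (r - chi r)"
    using block_cmin_cmax[OF assms(1), of "part_end r"] part_block(3)[OF assms(1)] by (simp add: csum_def)
  ultimately show False using assms(2) part_block(5)[OF assms(1)] by simp
qed

lemma part_end_admissible:
  assumes "r \<in> set lam"
  shows "admissible c (part_end r) \<longleftrightarrow> cmin c (Suc (part_end r)) < chi r"
  using block_end_admissible[OF part_block(7)[OF assms]] block_cmin_cmax[OF assms, of "part_end r"]
    part_block(3)[OF assms] by simp

lemma part_start_admissible:
  assumes "r \<in> set lam"
  shows "admissible c (part_start r) \<longleftrightarrow> part_start r = 0 \<or> r - chi r < cmax c (part_start r - 1)"
proof (cases "part_start r")
  case (Suc i)
  then show ?thesis
    using block_start_admissible[of i] part_block(6)[OF assms] block_cmin_cmax[OF assms, of "part_start r"]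
      part_block(3)[OF assms] by simp
qed (simp add: admissible_def)

text \<open>By monotonicity the two strict inequalities of criticality need to be tested on the
  neighbouring blocks only, where they are the legality conditions of the two ends; positivity of
  \<open>chi r\<close> comes with a legal end.\<close>

lemma critical_iff_admissible:
  assumes r: "r \<in> set lam"
  shows "critical lam chi r \<longleftrightarrow> admissible c (part_start r) \<and> admissible c (part_end r)"
proof -
  note b = part_block[OF r] and m = block_cmin_cmax[OF r]
  have "critical lam chi r \<longleftrightarrow> critical_at c (part_end r)" using critical_iff[OF fits, of "part_end r"] b by simp
  also have "\<dots> \<longleftrightarrow> admissible c (part_start r) \<and> admissible c (part_end r)"
    unfolding part_end_admissible[OF r] part_start_admissible[OF r]
  proof (intro iffI conjI)
    assume cr: "critical_at c (part_end r)"
    have "csum c (Suc (part_end r)) < csum c (part_end r)" using b(7) by (simp add: block_end_def)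
    then show "cmin c (Suc (part_end r)) < chi r" using cr m(1)[of "part_end r"] b(3) by (simp add: critical_at_def)
    show "part_start r = 0 \<or> r - chi r < cmax c (part_start r - 1)"
      using b(3,4,5,6) cr m(2)[of "part_end r"] by (auto simp: block_start_def critical_at_def)
  next
    assume a: "(part_start r = 0 \<or> r - chi r < cmax c (part_start r - 1)) \<and> cmin c (Suc (part_end r)) < chi r"
    show "critical_at c (part_end r)"
      unfolding critical_at_def
    proof (intro conjI allI impI)
      show "0 < cmin c (part_end r)" using a m(1)[of "part_end r"] b(3) by simp
    next
      fix j assume "csum c j < csum c (part_end r)"
      then have "Suc (part_end r) \<le> j"
        using csum_antimono[OF interlaced, of j "part_end r"] by (cases "Suc (part_end r) \<le> j") auto
      from cmin_antimono[OF interlaced this] show "cmin c j < cmin c (part_end r)"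
        using a m(1)[of "part_end r"] b(3) by simp
    next
      fix j assume "csum c (part_end r) < csum c j"
      then have j: "j < part_start r" using b(1)[of j] b(5) less_mult_gt[of j r] by (simp add: part_start_def)
      then have "cmax c (part_start r - 1) \<le> cmax c j" by (intro cmax_antimono[OF interlaced]) simp
      then show "cmax c (part_end r) < cmax c j" using a j m(2)[of "part_end r"] b(3) by simp
    qed
  qed
  finally show ?thesis .
qed

end

lemma x_ind_neq: "x_ind \<noteq> 0" "x_ind \<noteq> 1"
  by (simp_all add: x_ind_def Zero_fract_def One_fract_def eq_fract one_pCons)

lemma xp_Suc: "xp (k + 1) = x_ind * xp k"
  using x_ind_neq by (simp add: power_int_add)

section \<open>The tails of the first formula and their telescoping weights\<close>

context fitting
begin

text \<open>The positions from which the vectors in the tail of \<open>r\<close> are lowered; the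
  least of them will be the start of the block of j.\<close>

definition tail_starts :: "nat \<Rightarrow> nat set" where
  "tail_starts r = {p. block_start p \<and> admissible c p \<and> cmin c p = chi r \<and> p \<le> part_start r}"

lemma tail_startsD:
  assumes "p \<in> tail_starts r" "r \<in> set lam"
  shows "block_start p" "admissible c p" "cmin c p = chi r" "c p = chi r" "p \<le> part_start r"
    "\<And>i. p \<le> i \<Longrightarrow> i \<le> part_end r \<Longrightarrow> cmin c i = chi r"
proof -
  show p: "block_start p" "admissible c p" "cmin c p = chi r" "p \<le> part_start r"
    using assms(1) by (auto simp: tail_starts_def)
  then show "c p = chi r" using block_start_c by simp
  fix i assume i: "p \<le> i" "i \<le> part_end r"
  have "cmin c (part_end r) = chi r" using block_cmin_cmax(1)[OF assms(2)] part_block(3)[OF assms(2)] by simp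
  then show "cmin c i = chi r"
    using cmin_antimono[OF interlaced i(1)] cmin_antimono[OF interlaced i(2)] p(3) by simp
qed

lemma two_chi_le: "r \<in> set lam \<Longrightarrow> 2 * chi r \<le> r"
proof -
  assume "r \<in> set lam"
  then obtain i where "r = csum c i" by (rule in_set_lamE)
  then show ?thesis using fits_chi(1)[OF fits, of i] cmin_le_cmax[of c i] by (simp add: csum_def)
qed

text \<open>At odd distance the position before the block of \<open>r\<close> would be a block end
  in the run, so its maximum would be \<open>chi r\<close> and its part at most
  \<open>2 * chi r\<close>, hence at most \<open>r\<close>. But parts before the block of
  \<open>r\<close> exceed \<open>r\<close>.\<close>

lemma tail_starts_parity:
  assumes p: "p \<in> tail_starts r" and r: "r \<in> set lam"
  shows "even (part_start r - p)"
proof (rule ccontr)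
  assume odd: "odd (part_start r - p)"
  note P = tail_startsD[OF p r] and b = part_block[OF r]
  from odd obtain j where "part_start r - p = 2 * j + 1" by (rule oddE)
  then have j: "part_start r = Suc (p + 2 * j)" using P(5) by linarith
  have be: "block_end (p + 2 * j)" using b(6) j block_start_Suc by simp
  have "c (p + 2 * j) = c p"
    by (rule constant_cmin_even[of p "part_end r"]) (use P(4,6) j b(3) in auto)
  then have "cmax c (p + 2 * j) = chi r" using block_end_c[OF be] P(4) by simp
  moreover have "cmin c (p + 2 * j) \<le> chi r" using cmin_antimono[OF interlaced, of p "p + 2 * j"] P(3) by simp
  ultimately have "csum c (p + 2 * j) \<le> r" using two_chi_le[OF r] by (simp add: csum_def)
  then show False using be b(4) j by (simp add: block_end_def)
qed

lemma finite_tail_starts: "finite (tail_starts r)"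
  by (rule finite_subset[of _ "{..part_start r}"]) (auto simp: tail_starts_def)

text \<open>Neighbouring blocks with the same chi must differ in r - chi(r), and that is the
  legality test at a block start.\<close>

lemma start_of_same_chi:
  assumes "block_start p" "0 < p" "cmin c (p - 1) = cmin c p"
  shows "admissible c p"
proof -
  obtain i where i: "p = Suc i" using assms(2) by (cases p) auto
  have "csum c (Suc i) < csum c i" using assms(1) i by (simp add: block_start_def)
  then show ?thesis using block_start_admissible[of i] assms(1,3) i by (simp add: csum_def)
qed

lemma csum_less_imp_less: "csum c j < csum c i \<Longrightarrow> i < j"
  using csum_antimono[OF interlaced, of j i] by (cases "i < j") auto

text \<open>The lone power belongs to the least start \<open>p0\<close>, with j the part at
  \<open>p0\<close>, and the summand for k belongs to the start directly after the block of k. The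
  hypothesis \<open>T\<close> separates the identification of the vectors, which varies from case to
  case, from this computation of weights.\<close>

lemma tail_A_eq:
  assumes r: "r \<in> set lam" and cr: "critical lam chi r"
    and T: "\<And>p Z. p \<in> tail_starts r \<Longrightarrow> tail_extension p Z \<Longrightarrow> T_vec lam' (Y \<union> Z) = lower_vec c p"
  shows "tail_A lam chi r lam' Y = (\<Sum>p\<in>tail_starts r. start_weight c p *\<^sub>E lower_vec c p)"
proof -
  note b = part_block[OF r]
  define g where "g = part_start r"
  have chi_pos: "0 < chi r" and chi_low: "\<And>r'. r' \<in> set lam \<Longrightarrow> r' < r \<Longrightarrow> chi r' < chi r"
    using cr by (auto simp: critical_def)
  have adm_g: "admissible c g" using cr critical_iff_admissible[OF r] by (simp add: g_def)
  have cmin_g: "cmin c g = chi r" and csum_g: "csum c g = r"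
    using block_cmin_cmax(1)[OF r] b(3,4) by (auto simp: g_def)
  have g_in: "g \<in> tail_starts r" using b(6) adm_g cmin_g by (simp add: tail_starts_def g_def)
  define p0 where "p0 = Min (tail_starts r)"
  have p0_in: "p0 \<in> tail_starts r" unfolding p0_def using g_in finite_tail_starts by (intro Min_in) auto
  have p0_le: "p0 \<le> p" if "p \<in> tail_starts r" for p unfolding p0_def using that finite_tail_starts by simp
  note P0 = tail_startsD[OF p0_in r]
  have p0g: "p0 \<le> g" using P0(5) by (simp add: g_def)
  have csum_p0: "r \<le> csum c p0" using csum_antimono[OF interlaced p0g] csum_g by simp
  have rpos: "0 < r" by (rule in_set_lamE[OF r])
  have chi_csum: "chi (csum c i) = cmin c i" for i by (rule fits_chi[OF fits])
  have diff_csum: "csum c i - cmin c i = cmax c i" for i by (rule fits_chi[OF fits])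
  have cmin_mid: "cmin c i = chi r" if "p0 \<le> i" "i \<le> g" for i
    using P0(6)[OF that(1)] that(2) b(3) by (simp add: g_def)
  have j: "j_A lam chi r = csum c p0"
    unfolding j_A_def
  proof (rule Max_eqI)
    fix y assume "y \<in> {j \<in> set lam. chi j = chi r \<and> (\<forall>r'\<in>set lam. j < r' \<longrightarrow> r' - chi r' \<noteq> j - chi r)}"
    then have y: "y \<in> set lam" "chi y = chi r" "\<And>r'. r' \<in> set lam \<Longrightarrow> y < r' \<Longrightarrow> r' - chi r' \<noteq> y - chi r"
      by auto
    note by' = part_block[OF y(1)]
    have my: "cmin c (part_start y) = chi r" "cmax c (part_start y) = y - chi r"
      using block_cmin_cmax[OF y(1), of "part_start y"] by'(3) y(2) by auto
    have "r \<le> y" using chi_low[OF y(1)] y(2) by (cases "y < r") auto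
    then have "part_start y \<le> g" using less_mult_gt[of g y] csum_g by (simp add: part_start_def not_less[symmetric])
    moreover have "admissible c (part_start y)"
    proof (cases "part_start y")
      case (Suc i)
      then have lt: "y < csum c i" using by'(4,6) by (simp add: block_start_def)
      then have "csum c i \<in> set lam" by (intro in_set_lam) simp
      then have "cmax c i \<noteq> cmax c (part_start y)" using y(3)[OF _ lt] my chi_csum diff_csum by simp
      moreover have "cmax c (part_start y) \<le> cmax c i" using Suc by (intro cmax_antimono[OF interlaced]) simp
      ultimately show ?thesis using block_start_admissible[of i] by'(6) Suc by simp
    qed (simp add: admissible_def)
    ultimately have "part_start y \<in> tail_starts r" using by'(6) my by (simp add: tail_starts_def g_def)
    then show "y \<le> csum c p0" using csum_antimono[OF interlaced p0_le] by'(4) by metis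
  next
    have "r' - chi r' \<noteq> csum c p0 - chi r" if r': "r' \<in> set lam" "csum c p0 < r'" for r'
    proof -
      obtain i where i: "r' = csum c i" by (rule in_set_lamE[OF r'(1)])
      then have "i < p0" using r'(2) csum_less_imp_less by simp
      then obtain l where l: "p0 = Suc l" "i \<le> l" by (cases p0) auto
      have "cmax c p0 < cmax c l" using block_start_admissible[of l] P0(1,2) l by simp
      also have "\<dots> \<le> cmax c i" by (rule cmax_antimono[OF interlaced l(2)])
      finally show ?thesis using i P0(3) chi_csum[of i] diff_csum[of i] diff_csum[of p0] by simp
    qed
    moreover have "csum c p0 \<in> set lam" using csum_p0 rpos by (intro in_set_lam) simp
    ultimately show "csum c p0 \<in> {j \<in> set lam. chi j = chi r \<and> (\<forall>r'\<in>set lam. j < r' \<longrightarrow> r' - chi r' \<noteq> j - chi r)}"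
      using P0(3) chi_csum by simp
  qed simp
  have ps0: "mult_gt lam (csum c p0) = p0"
    using block_start_eq[OF P0(1)] csum_p0 rpos by (simp add: part_start_def)
  have ge_p0: "p0 \<le> i" if "csum c i \<le> csum c p0" for i
  proof (rule ccontr)
    assume "\<not> p0 \<le> i"
    then obtain l where l: "p0 = Suc l" "i \<le> l" by (cases p0) auto
    then have "csum c p0 < csum c l" using P0(1) by (simp add: block_start_def)
    then show False using csum_antimono[OF interlaced l(2)] that by simp
  qed
  have adm_mid: "admissible c p" if "block_start p" "p0 < p" "p \<le> g" for p
    by (rule start_of_same_chi) (use that cmin_mid[of p] cmin_mid[of "p - 1"] in auto)
  \<comment> \<open>No earlier legal start lies in this run: a block start would contradict the
    minimality of \<open>p0\<close>, and at a block end of value \<open>chi r\<close> the part would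
    be at most \<open>r\<close>.\<close>
  have weight0: "start_weight c p0 = xp (int p0)"
  proof (rule start_weight_first, rule notI)
    fix p assume p: "p < p0" "admissible c p" "c p = c p0"
    from admissible_cases[OF p(2)] show False
    proof
      assume "block_start p"
      then have "p \<in> tail_starts r" using p P0(4,5) block_start_c[of p] by (simp add: tail_starts_def)
      then show False using p0_le p(1) by force
    next
      assume be: "block_end p"
      then have "cmax c p = chi r" using block_end_c p(3) P0(4) by simp
      then have "csum c p \<le> r" using cmin_le_cmax[of c p] two_chi_le[OF r] by (simp add: csum_def)
      moreover have "csum c p0 < csum c p"
        using be csum_antimono[OF interlaced, of "Suc p" p0] p(1) by (simp add: block_end_def)
      ultimately show False using csum_p0 by simp
    qed
  qed
  \<comment> \<open>An earlier block with the same chi cannot begin legally, by minimality. So the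
    block before it has the same maximum and a larger minimum, and its last position is the one
    required.\<close>
  have "tail_extension p0 {}"
    unfolding tail_extension_def
  proof (intro disjI1 conjI allI impI)
    fix i assume i: "i < p0" "cmin c i = c p0"
    have ipos: "0 < csum c i" using i(2) P0(4) chi_pos by (simp add: csum_def)
    note bi = part_block[OF in_set_lam[OF ipos]]
    let ?s = "part_start (csum c i)"
    have si: "?s \<le> i" using bi(1)[of i] by simp
    have s: "cmin c ?s = chi r" "cmax c ?s = cmax c i" using csum_eqD[OF interlaced bi(4)] i(2) P0(4) by auto
    have "?s \<notin> tail_starts r" using p0_le[of ?s] si i(1) by auto
    then have nad: "\<not> admissible c ?s" using bi(6) s si i(1) P0(5) by (simp add: tail_starts_def)
    then obtain l where l: "?s = Suc l" by (cases ?s) (auto simp: admissible_def)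
    have "cmax c l = cmax c ?s"
      using block_start_admissible[of l] bi(6) nad l cmax_antimono[OF interlaced, of l "Suc l"] by simp
    moreover have "csum c ?s < csum c l" using bi(6) l by (simp add: block_start_def)
    ultimately have "chi r < cmin c l" using s by (simp add: csum_def)
    then show "\<exists>j. cmax c j = cmax c i \<and> c p0 < cmin c j"
      using \<open>cmax c l = _\<close> s(2) P0(4) by (intro exI[of _ l]) simp
  qed simp
  then have first: "T_vec lam' Y = lower_vec c p0" using T[OF p0_in, of "{}"] by simp
  have "(\<Sum>k | k \<in> set lam \<and> r < k \<and> k \<le> csum c p0.
      (xp (int (mult_ge lam k)) - xp (int (mult_gt lam k))) *\<^sub>E T_vec lam' (Y \<union> {(k, chi r)})) =
    (\<Sum>p\<in>tail_starts r - {p0}. start_weight c p *\<^sub>E lower_vec c p)"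
  proof (rule sum.reindex_bij_witness[of _ "\<lambda>p. csum c (p - 1)" "\<lambda>k. Suc (part_end k)"])
    fix p assume "p \<in> tail_starts r - {p0}"
    then have p: "p \<in> tail_starts r" "p0 < p" using p0_le[of p] by auto
    note P = tail_startsD[OF p(1) r]
    obtain i where i: "p = Suc i" using p(2) by (cases p) auto
    have be: "block_end i" using P(1) i by (simp add: block_start_Suc)
    then show "Suc (part_end (csum c (p - 1))) = p" using block_end_eq i by simp
    have "csum c p < csum c i" using be i by (simp add: block_end_def)
    moreover have "r \<le> csum c p" using csum_antimono[OF interlaced, of p g] P(5) csum_g by (simp add: g_def)
    moreover have "csum c i \<le> csum c p0" using p i by (intro csum_antimono[OF interlaced]) simp
    ultimately show "csum c (p - 1) \<in> {k \<in> set lam. r < k \<and> k \<le> csum c p0}"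
      using i by (auto intro!: in_set_lam)
  next
    fix k assume "k \<in> {k \<in> set lam. r < k \<and> k \<le> csum c p0}"
    then have k: "k \<in> set lam" "r < k" "k \<le> csum c p0" by auto
    note bk = part_block[OF k(1)]
    let ?e = "part_end k" and ?s = "part_start k"
    show "csum c (Suc ?e - 1) = k" using bk(5) by simp
    have e: "p0 \<le> ?e" "?e < g" using ge_p0[of ?e] bk(5) k csum_less_imp_less[of g ?e] csum_g by auto
    have s: "p0 \<le> ?s" using ge_p0[of ?s] bk(4) k by auto
    have start: "block_start (Suc ?e)" using bk(7) by (simp add: block_start_Suc)
    have adm: "admissible c (Suc ?e)" using adm_mid[OF start] e by simp
    have inT: "Suc ?e \<in> tail_starts r"
      using start adm cmin_mid[of "Suc ?e"] e by (simp add: tail_starts_def g_def)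
    then show "Suc ?e \<in> tail_starts r - {p0}" using e by auto
    have "tail_extension (Suc ?e) {(k, chi r)}"
      unfolding tail_extension_def using tail_startsD(4)[OF inT r] cmin_mid[of ?e] e bk(5) by simp
    then have vec: "T_vec lam' (Y \<union> {(k, chi r)}) = lower_vec c (Suc ?e)" by (rule T[OF inT])
    have chik: "chi k = chi r" using chi_csum[of ?e] cmin_mid[of ?e] e bk(5) by simp
    \<comment> \<open>Exactly the block of \<open>k\<close> lies between the two starts. Its length
      is even because \<open>2 * chi k < k\<close>, so both belong to one run, and the parity
      excludes \<open>?e\<close> as an intermediate start.\<close>
    have "start_weight c (Suc ?e) = xp (int (Suc ?e)) - xp (int ?s)"
    proof (rule start_weight_next)
      show "?s < Suc ?e" using bk(3) by simp
      have "odd (?e - ?s)" using block_parity[OF k(1)] chik two_chi_le[OF r] k(2) by simp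
      then show "even (Suc ?e - ?s)" using bk(3) by (simp add: Suc_diff_le)
      show "admissible c ?s" using P0(2) adm_mid[OF bk(6)] s e bk(3) by (cases "?s = p0") auto
      show "c ?s = c (Suc ?e)"
        using tail_startsD(4)[OF inT r] block_start_c[OF bk(6)] chi_csum[of ?s] bk(4) chik by simp
    next
      fix p' assume p': "?s < p'" "p' < Suc ?e" "even (Suc ?e - p')"
      then have "p' \<noteq> ?e" by auto
      then show "\<not> admissible c p'" using not_admissible_inside[OF k(1), of p'] p' by simp
    qed
    then show "start_weight c (Suc ?e) *\<^sub>E lower_vec c (Suc ?e) =
      (xp (int (mult_ge lam k)) - xp (int (mult_gt lam k))) *\<^sub>E T_vec lam' (Y \<union> {(k, chi r)})"
      using vec bk(2) by (simp add: part_start_def)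
  qed
  then show ?thesis
    unfolding tail_A_def j Let_def ps0 first weight0[symmetric]
    by (simp add: sum.remove[OF finite_tail_starts p0_in])
qed

end

section \<open>Grouping by the parts of lambda\<close>

context fitting
begin

text \<open>A block end is charged to its own part. The start of a longer block is charged to the
  smallest part with the same chi, since the first formula collects a tail at the last block with
  that chi.\<close>

definition start_owner :: "nat \<Rightarrow> nat" where
  "start_owner p = (if csum c (Suc p) \<noteq> csum c p then csum c p
     else (LEAST r. \<exists>i. r = csum c i \<and> cmin c i = cmin c p))"

lemma start_owner_block_end: "block_end p \<Longrightarrow> start_owner p = csum c p"
  by (simp add: start_owner_def block_end_def)

lemma start_owner_inside:
  assumes "\<not> block_end p"
  shows "\<exists>i. start_owner p = csum c i \<and> cmin c i = cmin c p"
    and "cmin c i = cmin c p \<Longrightarrow> start_owner p \<le> csum c i"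
proof -
  have eq: "start_owner p = (LEAST r. \<exists>i. r = csum c i \<and> cmin c i = cmin c p)"
    using assms csum_antimono[OF interlaced, of p "Suc p"] by (auto simp: start_owner_def block_end_def)
  show "\<exists>i. start_owner p = csum c i \<and> cmin c i = cmin c p"
    unfolding eq by (rule LeastI[of _ "csum c p"]) blast
  show "start_owner p \<le> csum c i" if "cmin c i = cmin c p"
    unfolding eq by (rule Least_le) (use that in blast)
qed

text \<open>Minimality of the owner makes both of its ends legal once it owns a start other than its
  end: the next block must have smaller chi, and the block start is either \<open>p\<close> itself
  or preceded by a block of equal chi. Hence only critical parts own a tail.\<close>

lemma starts_owned:
  assumes r: "r \<in> set lam"
  shows "{p. admissible c p \<and> 0 < c p \<and> start_owner p = r} =
    (if admissible c (part_end r) then insert (part_end r) (if critical lam chi r then tail_starts r else {}) else {})"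
    (is "?V = ?W")
proof -
  note b = part_block[OF r]
  have rpos: "0 < r" by (rule in_set_lamE[OF r])
  have be_pos: "0 < c (part_end r)" if "block_end (part_end r)"
    using block_end_c[OF that] b(5) rpos cmin_le_cmax[of c "part_end r"] by (auto simp: csum_def)
  have mid: "cmin c (part_start r) = chi r" "cmin c (part_end r) = chi r"
    using block_cmin_cmax(1)[OF r] b(3) by auto
  show ?thesis
  proof
    show "?V \<subseteq> ?W"
    proof
      fix p assume "p \<in> ?V"
      then have p: "admissible c p" "0 < c p" "start_owner p = r" by auto
      show "p \<in> ?W"
      proof (cases "block_end p")
        case True
        then have "p = part_end r" using start_owner_block_end block_end_eq p(3) by auto
        then show ?thesis using p(1) by simp
      next
        case False
        then have bs: "block_start p" using admissible_cases[OF p(1)] by blast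
        obtain i where i: "r = csum c i" "cmin c i = cmin c p" using start_owner_inside(1)[OF False] p(3) by metis
        have least: "r \<le> csum c k" if "cmin c k = cmin c p" for k
          using start_owner_inside(2)[OF False that] p(3) by simp
        have chir: "chi r = cmin c p" "chi r = c p" using fits_chi(1)[OF fits] i block_start_c[OF bs] by auto
        have "cmin c (Suc (part_end r)) \<noteq> chi r"
          using least[of "Suc (part_end r)"] chir b(5,7) by (auto simp: block_end_def)
        then have "cmin c (Suc (part_end r)) < chi r"
          using cmin_antimono[OF interlaced, of "part_end r" "Suc (part_end r)"] mid by simp
        then have adm_e: "admissible c (part_end r)" using part_end_admissible[OF r] by simp
        have "r \<le> csum c p" using least by simp
        then have pg: "p \<le> part_start r"
          using less_mult_gt[of "part_start r" r] block_start_eq[OF bs] b(1)[of p] csum_less_imp_less[of "part_start r" p]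
            b(4) rpos by (cases "csum c p = r") auto
        have "admissible c (part_start r)"
        proof (rule ccontr)
          assume nad: "\<not> admissible c (part_start r)"
          then have "p \<noteq> part_start r" "part_start r \<noteq> 0" using p(1) by (auto simp: admissible_def)
          then obtain l where l: "part_start r = Suc l" "p \<le> l" using pg by (cases "part_start r") auto
          have "cmin c l = chi r"
            using cmin_antimono[OF interlaced l(2)] cmin_antimono[OF interlaced, of l "part_start r"] l mid chir by simp
          then show False using nad start_of_same_chi[OF b(6)] l mid by simp
        qed
        then have "critical lam chi r" using adm_e critical_iff_admissible[OF r] by simp
        then show ?thesis using adm_e bs p(1) chir pg by (simp add: tail_starts_def)
      qed
    qed
    show "?W \<subseteq> ?V"
    proof
      fix p assume p: "p \<in> ?W"
      then have adm_e: "admissible c (part_end r)" by (auto split: if_splits)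
      show "p \<in> ?V"
      proof (cases "p = part_end r")
        case True
        then show ?thesis using adm_e be_pos b(5,7) start_owner_block_end by simp
      next
        case False
        then have cr: "critical lam chi r" and pt: "p \<in> tail_starts r" using p by (auto split: if_splits)
        note P = tail_startsD[OF pt r]
        have chi_pos: "0 < chi r" using cr by (simp add: critical_def)
        have low: "cmin c (Suc (part_end r)) < chi r" using part_end_admissible[OF r] adm_e by simp
        have "r \<le> csum c p" using csum_antimono[OF interlaced P(5)] b(4) by simp
        have "start_owner p = r"
        proof (cases "block_end p")
          case True
          \<comment> \<open>A start that is also a block end forms a block of length one, so its two
            values agree; a larger part with the same chi would have a block of even length.\<close>
          have "csum c p = r"
          proof (rule ccontr)
            assume ne: "csum c p \<noteq> r"
            have pin: "csum c p \<in> set lam" using \<open>r \<le> csum c p\<close> rpos by (intro in_set_lam) simp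
            have "2 * chi (csum c p) \<noteq> csum c p"
              using fits_chi(1)[OF fits, of p] P(3) two_chi_le[OF r] \<open>r \<le> csum c p\<close> ne by simp
            then have "odd (part_end (csum c p) - part_start (csum c p))" by (rule block_parity[OF pin])
            then show False using block_end_eq[OF True] block_start_eq[OF P(1)] in_set_lamE[OF pin] by fastforce
          qed
          then show ?thesis using start_owner_block_end[OF True] by simp
        next
          case False
          obtain i where i: "start_owner p = csum c i" "cmin c i = chi r" using start_owner_inside(1)[OF False] P(3) by metis
          have "i \<le> part_end r"
            using cmin_antimono[OF interlaced, of "Suc (part_end r)" i] low i(2) by (cases "i \<le> part_end r") auto
          then have "r \<le> start_owner p" using csum_antimono[OF interlaced, of i "part_end r"] b(5) i(1) by simp
          moreover have "start_owner p \<le> r" using start_owner_inside(2)[OF False, of "part_end r"] b(5) mid P(3) by simp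
          ultimately show ?thesis by simp
        qed
        then show ?thesis using P(2,4) chi_pos by simp
      qed
    qed
  qed
qed

text \<open>Period two inside a block leaves only its last two positions as corners. The last but
  one is a corner precisely when the last is a legal start, and then the last carries weight
  0.\<close>

lemma corners_owned:
  assumes r: "r \<in> set lam"
  shows "owned_corners c (csum c) r =
    (if admissible c (part_end r)
     then (if part_start r < part_end r
           then corner_weight c (part_end r - 1) *\<^sub>E lower_vec c (part_end r - 1) else 0)
     else corner_weight c (part_end r) *\<^sub>E lower_vec c (part_end r))"
proof -
  note b = part_block[OF r]
  let ?e = "part_end r" and ?g = "part_start r"
  have rpos: "0 < r" by (rule in_set_lamE[OF r])
  have inside: "q = ?e \<or> (Suc q = ?e \<and> admissible c ?e \<and> ?g < ?e)" if q: "corner c q" "csum c q = r" for q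
  proof -
    have qr: "?g \<le> q" "q \<le> ?e" using b(1)[of q] q(2) by auto
    have "\<not> Suc q < ?e"
    proof
      assume l: "Suc q < ?e"
      then have s: "csum c (Suc q) = r" using b(1)[of "Suc q"] qr by simp
      have "\<not> block_start (Suc q)" using s q(2) by (simp add: block_start_def)
      moreover have "\<not> block_end (Suc q)" using block_end_eq[of "Suc q"] s l by auto
      ultimately show False using inside_block[of q] q(1) by (simp add: corner_def)
    qed
    then consider "q = ?e" | "Suc q = ?e" using qr by linarith
    then show ?thesis
    proof cases
      case 2
      have "admissible c (Suc q)" using q(1) by (simp add: corner_def admissible_def)
      then show ?thesis using 2 qr by simp
    qed simp
  qed
  show ?thesis
  proof (cases "admissible c ?e")
    case True
    have "owned_corners c (csum c) r =
      (\<Sum>q\<in>(if ?g < ?e then {?e - 1} else {}). corner_weight c q *\<^sub>E lower_vec c q)"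
    proof (rule sum.mono_neutral_right)
      show "finite {q. corner c q \<and> csum c q = r}" using finite_corner[OF interlaced] by simp
      have "corner c (?e - 1) \<and> csum c (?e - 1) = r" if "?g < ?e"
        using True that b(1)[of "?e - 1"] by (cases ?e) (auto simp: corner_def admissible_def)
      then show "(if ?g < ?e then {?e - 1} else {}) \<subseteq> {q. corner c q \<and> csum c q = r}" by auto
      show "\<forall>q\<in>{q. corner c q \<and> csum c q = r} - (if ?g < ?e then {?e - 1} else {}).
          corner_weight c q *\<^sub>E lower_vec c q = 0"
      proof
        fix q assume "q \<in> {q. corner c q \<and> csum c q = r} - (if ?g < ?e then {?e - 1} else {})"
        then have q: "corner c q" "csum c q = r" "?g < ?e \<Longrightarrow> q \<noteq> ?e - 1" by auto
        from inside[OF q(1,2)] have "q = ?e"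
        proof
          assume s: "Suc q = ?e \<and> admissible c ?e \<and> ?g < ?e"
          then have "?e - 1 = q" by (metis diff_Suc_1)
          then show ?thesis using q(3) s by simp
        qed
        then show "corner_weight c q *\<^sub>E lower_vec c q = 0" using corner_weight_admissible[OF True] by simp
      qed
    qed
    then show ?thesis using True by simp
  next
    case False
    have m: "cmin c ?e = chi r" using block_cmin_cmax(1)[OF r] b(3) by simp
    have "cmin c (Suc ?e) = chi r"
      using False part_end_admissible[OF r] cmin_antimono[OF interlaced, of ?e "Suc ?e"] m by simp
    then have "cmax c (Suc ?e) < cmax c ?e" using b(7) m by (simp add: block_end_def csum_def)
    then have "c (Suc (Suc ?e)) < c ?e" using block_end_c[OF b(7)] by (simp add: cmax_def[of c "Suc ?e"])
    then have "?e \<in> {q. corner c q \<and> csum c q = r}" using b(5) by (simp add: corner_def)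
    moreover have "{q. corner c q \<and> csum c q = r} \<subseteq> {?e}" using inside False by blast
    ultimately have "{q. corner c q \<and> csum c q = r} = {?e}" by blast
    then show ?thesis using False by simp
  qed
qed

lemma single_critical: "r \<in> set lam \<Longrightarrow> 2 * chi r = r \<Longrightarrow> critical lam chi r"
proof -
  assume r: "r \<in> set lam" "2 * chi r = r"
  note b = part_block[OF r(1)]
  have "critical_at c (part_end r)"
    by (rule critical_at_single)
      (use b(3,7) block_cmin_cmax[OF r(1), of "part_end r"] r(2) in \<open>auto simp: block_end_def\<close>)
  then show ?thesis using critical_iff[OF fits, of "part_end r"] b(5) by simp
qed

text \<open>The block has even length and an illegal end or start. If its end is illegal, both
  vectors coincide and their coefficients merge into one corner weight. Otherwise its start is
  illegal, so the preceding block has the same maximum, and the end \<open>l\<close> of that block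
  is the previous start in the run of this block's end.\<close>

lemma A_noncrit_eq:
  assumes r: "r \<in> set lam" and nc: "\<not> critical lam chi r"
  shows "A_noncrit lam chi r =
    owned_starts c start_owner r + owned_corners c (csum c) r"
proof -
  note b = part_block[OF r]
  define g where "g = part_start r"
  have half: "2 * chi r \<noteq> r" using single_critical[OF r] nc by blast
  have odd: "odd (part_end r - g)" using block_parity[OF r half] by (simp add: g_def)
  then have "g < part_end r" using b(3) by (cases "g = part_end r") (auto simp: g_def)
  then obtain q where q: "part_end r = Suc q" "g \<le> q" by (cases "part_end r") auto
  have even: "even (q - g)" using odd q by (simp add: Suc_diff_le)
  then obtain k where k: "q = g + 2 * k" using q(2) by (metis evenE le_add_diff_inverse)
  have sq: "csum c q = r" "csum c (Suc q) = r" using b(1)[of q] b(1)[of "Suc q"] q by (auto simp: g_def)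
  have end': "csum c (Suc (Suc q)) < csum c q" using b(7) q sq by (simp add: block_end_def)
  have cm: "cmin c q = chi r" "cmax c q = r - chi r" "cmin c g = chi r" "cmax c g = r - chi r"
    using block_cmin_cmax[OF r, of q] block_cmin_cmax[OF r, of g] q by (auto simp: g_def)
  have cq: "c q = chi r" "c (Suc q) = r - chi r" using block_end_cmin[of q] sq end' cm by auto
  have asc: "c q < c (Suc q)" using cq half two_chi_le[OF r] by simp
  have mult: "int (mult_ge lam r) = int q + 2" "int (mult_gt lam r) = int g" using b(2) q by (auto simp: g_def part_start_def)
  have inside: "\<not> admissible c p" if "g < p" "p \<le> q" for p
    using not_admissible_inside[OF r, of p] that q by (simp add: g_def)
  have even_c: "c p = chi r" if "g \<le> p" "p \<le> q" "even (p - g)" for p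
  proof -
    from that(3) obtain j where "p - g = 2 * j" by (rule evenE)
    then have "p = g + 2 * j" using that(1) by simp
    then show ?thesis using block_even[OF r, of j] that(2) q by (simp add: g_def)
  qed
  show ?thesis
  proof (cases "admissible c (Suc q)")
    case False
    have T: "T_vec (lower_two lam r) (X_crit lam chi) = lower_vec c (Suc q)"
      "T_vec (lower_two lam r) (X_crit lam chi \<union> {(r - 1, chi r)}) = lower_vec c (Suc q)"
    proof -
      have "corner c (Suc q)"
      proof -
        have "cmin c (Suc (Suc q)) = chi r"
          using False part_end_admissible[OF r] cmin_antimono[OF interlaced, of "q" "Suc (Suc q)"] cm q by simp
        then have "cmax c (Suc (Suc q)) < r - chi r" using end' sq cm by (simp add: csum_def)
        then show ?thesis using cq by (simp add: corner_def cmax_def)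
      qed
      then show "T_vec (lower_two lam r) (X_crit lam chi) = lower_vec c (Suc q)"
        "T_vec (lower_two lam r) (X_crit lam chi \<union> {(r - 1, chi r)}) = lower_vec c (Suc q)"
        using T_lower_two_up[OF asc end'] sq cm False by (auto simp: lower_vec_def)
    qed
    have w: "corner_weight c (Suc q) = (xp (int (Suc q) + 1) - xp (int g)) / (x_ind - 1)"
    proof (rule corner_weight_eq)
      show "g \<le> Suc (Suc q)" using q by simp
      show "g = 0 \<or> even (Suc (Suc q) - g) \<and> (admissible c (g - 1) \<or> c (Suc q) < c (g - 1))"
      proof (cases g)
        case (Suc l)
        have be: "block_end l" using b(6) Suc by (simp add: g_def block_start_Suc)
        have "admissible c l \<or> c (Suc q) < c l"
        proof (cases "cmax c l = cmax c g")
          case True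
          then have "cmin c (Suc l) < cmin c l" using be Suc by (simp add: block_end_def csum_def)
          then show ?thesis using block_end_admissible[OF be] by simp
        next
          case False
          then have "cmax c g < cmax c l" using cmax_antimono[OF interlaced, of l g] Suc by simp
          then show ?thesis using block_end_c[OF be] cm cq by simp
        qed
        then show ?thesis using Suc even q by (simp add: Suc_diff_le)
      qed simp
    next
      fix p assume p: "g \<le> p" "p \<le> Suc q" "even (Suc q - p)"
      have "p \<noteq> g" using p(3) odd q by auto
      then have "\<not> admissible c p" using inside[of p] False p(1,2) by (cases "p = Suc q") auto
      moreover have "c p \<le> c (Suc q)"
      proof -
        have "csum c p = r" using b(1)[of p] p q by (simp add: g_def)
        then show ?thesis using le_cmax[of c p] csum_eqD(2)[OF interlaced, of p q] sq cm cq by simp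
      qed
      ultimately show "\<not> admissible c p \<and> c p \<le> c (Suc q)" ..
    qed
    \<comment> \<open>\<open>y / (x - 1) + y = x * y / (x - 1)\<close>: the factor x raises both
      exponents by one, to those of the corner weight.\<close>
    have "(xp (int q + 2 - 1) - xp (int g - 1)) / (x_ind - 1) + (xp (int q + 2 - 1) - xp (int g - 1)) =
        corner_weight c (Suc q)"
      using x_ind_neq xp_Suc[of "int q + 1"] xp_Suc[of "int g - 1"] unfolding w
      by (simp add: field_simps)
    moreover have "owned_starts c start_owner r = 0"
      unfolding starts_owned[OF r] using False q by simp
    moreover have "owned_corners c (csum c) r =
        corner_weight c (Suc q) *\<^sub>E lower_vec c (Suc q)"
      unfolding corners_owned[OF r] using False q by simp
    ultimately show ?thesis
      unfolding A_noncrit_def Let_def T mult scale_E_add_left[symmetric] by simp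
  next
    case True
    have nadg: "\<not> admissible c g" using critical_iff_admissible[OF r] nc True q by (simp add: g_def)
    then obtain l where l: "g = Suc l" by (cases g) (auto simp: admissible_def)
    have be: "block_end l" using b(6) l by (simp add: g_def block_start_Suc)
    have cml: "cmax c l = cmax c g"
      using block_start_admissible[of l] b(6) nadg l cmax_antimono[OF interlaced, of l g] by (simp add: g_def)
    then have cmn: "cmin c g < cmin c l" using be l by (simp add: block_end_def csum_def)
    have adl: "admissible c l" using block_end_admissible[OF be] cmn l by simp
    have cl: "c l = c (Suc q)" using block_end_c[OF be] cml cm cq by simp
    have T1: "T_vec (lower_two lam r) (X_crit lam chi) = lower_vec c q"
      using T_lower_two_critical[of q] sq end' True by (simp add: lower_vec_def corner_def admissible_def)
    have T2: "T_vec (lower_two lam r) (X_crit lam chi \<union> {(r - 1, chi r)}) = lower_vec c (Suc q)"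
      using T_lower_two_up[OF asc end'] sq cm True by (auto simp: lower_vec_def)
    have w1: "corner_weight c q = (xp (int q + 1) - xp (int l)) / (x_ind - 1)"
    proof (rule corner_weight_eq)
      show "l \<le> Suc q" using l q by simp
      show "l = 0 \<or> even (Suc q - l) \<and> (admissible c (l - 1) \<or> c q < c (l - 1))"
      proof (cases l)
        case (Suc m)
        have "cmin c l \<le> c m" using Suc by (simp add: cmin_Suc)
        then show ?thesis using Suc k l cmn cm cq by auto
      qed simp
    next
      fix p assume p: "l \<le> p" "p \<le> q" "even (q - p)"
      have "p \<noteq> l" using p(3) k l by auto
      then have "g \<le> p" using p(1) l by simp
      moreover have "even (p - g)" using p even \<open>g \<le> p\<close> q by auto
      ultimately show "\<not> admissible c p \<and> c p \<le> c q"
        using inside[of p] nadg even_c[of p] p(2) cq by (cases "p = g") auto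
    qed
    have w2: "start_weight c (Suc q) = xp (int (Suc q)) - xp (int l)"
    proof (rule start_weight_next)
      show "l < Suc q" "even (Suc q - l)" "admissible c l" "c l = c (Suc q)" using l q k adl cl by auto
      fix p assume p: "l < p" "p < Suc q"
      then show "\<not> admissible c p" using nadg inside[of p] l by (cases "p = g") auto
    qed
    have "owned_starts c start_owner r =
        (xp (int q + 2 - 1) - xp (int g - 1)) *\<^sub>E lower_vec c (Suc q)"
      unfolding starts_owned[OF r] using True q nc w2 l by (simp add: add.commute)
    moreover have "owned_corners c (csum c) r =
        ((xp (int q + 2 - 1) - xp (int g - 1)) / (x_ind - 1)) *\<^sub>E lower_vec c q"
      unfolding corners_owned[OF r] using True q w1 l by (simp add: add.commute flip: g_def)
    ultimately show ?thesis
      unfolding A_noncrit_def Let_def T1 T2 mult by (simp add: add.commute)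
  qed
qed

lemma critical_facts:
  assumes r: "r \<in> set lam" and cr: "critical lam chi r"
  shows "admissible c (part_start r)" "admissible c (part_end r)" "0 < chi r"
    "part_start r \<in> tail_starts r"
    "\<And>p. p \<in> tail_starts r \<Longrightarrow> part_start r < part_end r \<Longrightarrow> p \<noteq> part_end r"
proof -
  show a: "admissible c (part_start r)" "admissible c (part_end r)" using critical_iff_admissible[OF r] cr by auto
  show "0 < chi r" using cr by (simp add: critical_def)
  show "part_start r \<in> tail_starts r"
    using part_block(6)[OF r] a(1) block_cmin_cmax(1)[OF r] part_block(3)[OF r] by (simp add: tail_starts_def)
  fix p assume "p \<in> tail_starts r" "part_start r < part_end r"
  then show "p \<noteq> part_end r" by (auto simp: tail_starts_def)
qed

text \<open>The block end is the first legal start of its run: an earlier one would lie at or before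
  the end of the preceding block, whose value exceeds the maximum of this block because the block
  start is legal.\<close>

lemma critical_pair_start_weight:
  assumes r: "r \<in> set lam" and cr: "critical lam chi r" and odd: "odd (part_end r - part_start r)"
  shows "start_weight c (part_end r) = xp (int (part_end r))"
proof (rule start_weight_first, rule notI)
  note b = part_block[OF r] and f = critical_facts[OF r cr]
  fix p assume p: "p < part_end r" "even (part_end r - p)" "admissible c p" "c p = c (part_end r)"
  have "\<not> (part_start r < p)" using not_admissible_inside[OF r, of p] p by auto
  moreover have "p \<noteq> part_start r" using p(2) odd by auto
  ultimately obtain l where l: "part_start r = Suc l" "p \<le> l" by (cases "part_start r") auto
  have "even (l - p)"
    using p(2) odd l b(3) p(1) by (auto simp: even_diff_nat)
  then have "c l \<le> c p" by (rule interlaced_le[OF interlaced l(2)])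
  moreover have be: "block_end l" using b(6) l(1) by (simp add: block_start_Suc)
  moreover have "cmax c (part_start r) < cmax c l" using block_start_admissible[of l] b(6) f(1) l(1) by simp
  moreover have "cmax c (part_start r) = cmax c (part_end r)"
    using block_cmin_cmax(2)[OF r] b(3) by simp
  ultimately show False using block_end_c[OF b(7)] block_end_c[OF be] p(4) by simp
qed

text \<open>The geometric sum stops at the block start, which is legal and has the parity of the
  last but one position.\<close>

lemma critical_pair_corner_weight:
  assumes r: "r \<in> set lam" and cr: "critical lam chi r" and odd: "odd (part_end r - part_start r)"
  shows "corner_weight c (part_end r - 1) =
    (xp (int (part_end r)) - xp (int (part_start r) + 1)) / (x_ind - 1)"
proof -
  note b = part_block[OF r] and f = critical_facts[OF r cr]
  obtain q where q: "part_end r = Suc q" "part_start r \<le> q" using odd b(3) by (cases "part_end r") (auto simp: le_Suc_eq)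
  have "corner_weight c q = (xp (int q + 1) - xp (int (Suc (part_start r)))) / (x_ind - 1)"
  proof (rule corner_weight_eq)
    show "Suc (part_start r) \<le> Suc q" using q by simp
    show "Suc (part_start r) = 0 \<or> even (Suc q - Suc (part_start r)) \<and>
        (admissible c (Suc (part_start r) - 1) \<or> c q < c (Suc (part_start r) - 1))"
      using odd q f(1) by (simp add: Suc_diff_le)
  next
    fix p assume p: "Suc (part_start r) \<le> p" "p \<le> q" "even (q - p)"
    have "\<not> admissible c p" using not_admissible_inside[OF r, of p] p q by simp
    moreover have "c p = chi r"
    proof -
      have "even (p - part_start r)" using p(3) odd q p(1,2) by (auto simp: Suc_diff_le)
      then obtain j where "p - part_start r = 2 * j" by (rule evenE)
      then have "p = part_start r + 2 * j" using p(1) by simp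
      then show ?thesis using block_even[OF r, of j] p q by simp
    qed
    moreover have "chi r \<le> c q" using block_cmin_cmax(1)[OF r, of q] cmin_le[of c q] q by simp
    ultimately show "\<not> admissible c p \<and> c p \<le> c q" by simp
  qed
  then show ?thesis using q by (simp add: add.commute)
qed

text \<open>Common to all critical blocks of even length, whether or not 2 chi(r) = r: the first
  term comes from the block end, the second from the corner before it, and the rest is the
  tail.\<close>

lemma critical_pair_sums:
  assumes r: "r \<in> set lam" and cr: "critical lam chi r" and odd: "odd (part_end r - part_start r)"
  shows "owned_starts c start_owner r + owned_corners c (csum c) r =
    xp (int (mult_ge lam r) - 1) *\<^sub>E lower_vec c (part_end r) +
    ((xp (int (mult_ge lam r) - 1) - xp (int (mult_gt lam r) + 1)) / (x_ind - 1)) *\<^sub>E lower_vec c (part_end r - 1) +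
    (\<Sum>p\<in>tail_starts r. start_weight c p *\<^sub>E lower_vec c p)"
proof -
  note b = part_block[OF r] and f = critical_facts[OF r cr]
  have lt: "part_start r < part_end r" using odd b(3) by (cases "part_start r = part_end r") auto
  have "part_end r \<notin> tail_starts r" using f(5) lt by blast
  then have "owned_starts c start_owner r =
      xp (int (part_end r)) *\<^sub>E lower_vec c (part_end r) + (\<Sum>p\<in>tail_starts r. start_weight c p *\<^sub>E lower_vec c p)"
    unfolding starts_owned[OF r] using f(2) cr finite_tail_starts critical_pair_start_weight[OF r cr odd] by simp
  moreover have "owned_corners c (csum c) r =
      ((xp (int (part_end r)) - xp (int (part_start r) + 1)) / (x_ind - 1)) *\<^sub>E lower_vec c (part_end r - 1)"
    unfolding corners_owned[OF r] using f(2) lt critical_pair_corner_weight[OF r cr odd] by simp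
  moreover have "int (mult_ge lam r) - 1 = int (part_end r)" "int (mult_gt lam r) = int (part_start r)"
    using b(2) by (auto simp: part_start_def)
  ultimately show ?thesis by (simp add: algebra_simps)
qed

lemma tail_run:
  assumes r: "r \<in> set lam" and p: "p \<in> tail_starts r" and i: "p \<le> i" "i \<le> part_end r"
  shows "cmin c i = c p"
  using tail_startsD(4,6)[OF p r] i by simp

lemma pair_tail_vec:
  assumes r: "r \<in> set lam" and cr: "critical lam chi r" and odd: "odd (part_end r - part_start r)"
    and p: "p \<in> tail_starts r" and Z: "tail_extension p Z"
  shows "T_vec (lower_two lam r) (((X_crit lam chi \<union> {(r - 1, chi r - 1)}) - {(r, chi r)}) \<union> Z) = lower_vec c p"
proof -
  note b = part_block[OF r] and P = tail_startsD[OF p r]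
  obtain q where q: "part_end r = Suc q" "part_start r \<le> q" using odd b(3) by (cases "part_end r") (auto simp: le_Suc_eq)
  have sq: "csum c q = r" "csum c (Suc q) = r" using b(1)[of q] b(1)[of "Suc q"] q by auto
  have "even (q - part_start r)" using odd q by (simp add: Suc_diff_le)
  then have "even (q - p)" using tail_starts_parity[OF p r] P(5) q(2) by (auto simp: even_diff_nat)
  then obtain k where "q - p = 2 * k" by (rule evenE)
  then have k: "q = p + 2 * k" using P(5) q(2) by simp
  have "critical_at c q" using critical_iff[OF fits, of q] sq cr by simp
  moreover have "csum c (Suc (Suc q)) < csum c q" using b(7) q sq by (simp add: block_end_def)
  moreover have "cmin c q = chi r" using block_cmin_cmax(1)[OF r, of q] q by simp
  ultimately show ?thesis
    using T_lower_two_tail[of q p k, OF _ _ _ k P(2) tail_run[OF r p] Z] sq q by (simp add: lower_vec_def)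
qed

lemma critical_lower_two_vec:
  assumes r: "r \<in> set lam" and cr: "critical lam chi r" and lt: "part_start r < part_end r"
  shows "T_vec (lower_two lam r) (X_crit lam chi) = lower_vec c (part_end r - 1)"
proof -
  note b = part_block[OF r]
  obtain q where q: "part_end r = Suc q" "part_start r \<le> q" using lt by (cases "part_end r") auto
  have sq: "csum c q = r" "csum c (Suc q) = r" using b(1)[of q] b(1)[of "Suc q"] q by auto
  have "csum c (Suc (Suc q)) < csum c q" using b(7) q sq by (simp add: block_end_def)
  moreover have "corner c q" using critical_facts(2)[OF r cr] q by (simp add: corner_def admissible_def)
  ultimately show ?thesis using T_lower_two_critical[of q] sq q by (simp add: lower_vec_def)
qed

lemma A_crit_generic_eq:
  assumes r: "r \<in> set lam" and cr: "critical lam chi r" and half: "2 * chi r \<noteq> r"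
  shows "A_crit_generic lam chi r =
    owned_starts c start_owner r + owned_corners c (csum c) r"
proof -
  note b = part_block[OF r] and f = critical_facts[OF r cr]
  have odd: "odd (part_end r - part_start r)" by (rule block_parity[OF r half])
  have lt: "part_start r < part_end r" using odd b(3) by (cases "part_start r = part_end r") auto
  obtain q where q: "part_end r = Suc q" "part_start r \<le> q" using lt by (cases "part_end r") auto
  have sq: "csum c q = r" "csum c (Suc q) = r" using b(1)[of q] b(1)[of "Suc q"] q by auto
  have end': "csum c (Suc (Suc q)) < csum c q" using b(7) q sq by (simp add: block_end_def)
  have cm: "cmin c q = chi r" "cmax c q = r - chi r" using block_cmin_cmax[OF r, of q] q by auto
  have cq: "c q = chi r" "c (Suc q) = r - chi r" using block_end_cmin[of q] sq end' cm by auto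
  have asc: "c q < c (Suc q)" using cq half two_chi_le[OF r] by simp
  have T1: "T_vec (lower_two lam r) (X_crit lam chi \<union> {(r - 1, chi r)}) = lower_vec c (part_end r)"
    using T_lower_two_up[OF asc end'] sq cm f(2) q by (auto simp: lower_vec_def)
  have T2: "T_vec (lower_two lam r) (X_crit lam chi) = lower_vec c (part_end r - 1)"
    by (rule critical_lower_two_vec[OF r cr lt])
  have "tail_A lam chi r (lower_two lam r) ((X_crit lam chi \<union> {(r - 1, chi r - 1)}) - {(r, chi r)}) =
      (\<Sum>p\<in>tail_starts r. start_weight c p *\<^sub>E lower_vec c p)"
    by (rule tail_A_eq[OF r cr]) (rule pair_tail_vec[OF r cr odd])
  then show ?thesis unfolding critical_pair_sums[OF r cr odd] A_crit_generic_def Let_def T1 T2 by simp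
qed

lemma single_vec:
  assumes r: "r \<in> set lam" and half: "2 * chi r = r" and p: "p \<in> tail_starts r \<or> p = part_end r"
    and ev: "even (part_end r - p)" and newY: "(r - 2, (r - 2) div 2) \<in> Y"
    and sub: "Y \<subseteq> X_crit lam chi \<union> {(r - 2, (r - 2) div 2)} \<union> Z"
    and sup: "X_crit lam chi - {(r, chi r)} \<union> Z \<subseteq> Y"
    and Z: "(p = part_end r \<and> Z = {} \<and> X_crit lam chi \<subseteq> Y) \<or> ((r, chi r) \<notin> Y \<and> tail_extension p Z)"
  shows "T_vec (lower_one lam r) Y = lower_vec c p"
proof -
  note b = part_block[OF r]
  have cr: "critical lam chi r" by (rule single_critical[OF r half])
  note f = critical_facts[OF r cr]
  have m: "cmin c (part_end r) = chi r" "cmax c (part_end r) = chi r"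
    using block_cmin_cmax[OF r, of "part_end r"] b(3) half by auto
  have pe: "p \<le> part_end r" using p tail_startsD(5)[OF _ r] b(3) by fastforce
  from ev obtain k where "part_end r - p = 2 * k" by (rule evenE)
  then have k: "part_end r = p + 2 * k" using pe by simp
  have cm: "cmin c i = c p" if "p \<le> i" "i \<le> part_end r" for i
    using p
  proof
    assume "p = part_end r"
    then show ?thesis using that m block_end_c[OF b(7)] by simp
  qed (use tail_run[OF r _ that] in simp)
  have "admissible c p" using p f(2) tail_startsD(2)[OF _ r] by auto
  then show ?thesis
    using T_lower_one[of "part_end r" p k Y Z] k cm newY sub sup Z b(5,7) m by (simp add: block_end_def lower_vec_def)
qed

text \<open>Here (r - 2) / 2 = chi(r) - 1, so the tail is that of the generic critical case; only
  the first vector lowers a single part.\<close>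

lemma A_crit_half_even_eq:
  assumes r: "r \<in> set lam" and half: "2 * chi r = r" and ev: "even (count_list lam r)"
  shows "A_crit_half_even lam chi r =
    owned_starts c start_owner r + owned_corners c (csum c) r"
proof -
  note b = part_block[OF r]
  have cr: "critical lam chi r" by (rule single_critical[OF r half])
  note f = critical_facts[OF r cr]
  have "Suc (part_end r) - part_start r = count_list lam r"
    using b(2) mult_ge_eq_gt_count[of lam r] by (simp add: part_start_def)
  then have odd: "odd (part_end r - part_start r)" using b(3) ev by (metis Suc_diff_le even_Suc)
  have lt: "part_start r < part_end r" using odd b(3) by (cases "part_start r = part_end r") auto
  have T1: "T_vec (lower_one lam r) (X_crit lam chi \<union> {(r - 2, (r - 2) div 2)}) = lower_vec c (part_end r)"
    by (rule single_vec[OF r half, of _ _ "{}"]) auto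
  have T2: "T_vec (lower_two lam r) (X_crit lam chi) = lower_vec c (part_end r - 1)"
    by (rule critical_lower_two_vec[OF r cr lt])
  have halves: "(r - 2) div 2 = chi r - 1" "r div 2 = chi r" using half by auto
  have "tail_A lam chi r (lower_two lam r) ((X_crit lam chi \<union> {(r - 1, (r - 2) div 2)}) - {(r, r div 2)}) =
      (\<Sum>p\<in>tail_starts r. start_weight c p *\<^sub>E lower_vec c p)"
    unfolding halves by (rule tail_A_eq[OF r cr]) (rule pair_tail_vec[OF r cr odd])
  then show ?thesis unfolding critical_pair_sums[OF r cr odd] A_crit_half_even_def Let_def T1 T2 by simp
qed

lemma single_c:
  assumes r: "r \<in> set lam" and half: "2 * chi r = r" and i: "part_start r \<le> i" "i \<le> part_end r"
  shows "c i = chi r"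
proof -
  have "r - chi r = chi r" using half by simp
  then show ?thesis using block_cmin_cmax[OF r i] cmin_le[of c i] le_cmax[of c i] by simp
qed

text \<open>Odd length puts both ends of the block into one run. The block end is then the start
  following \<open>part_start r\<close>, and its weight is a difference instead of a lone
  power.\<close>

lemma A_crit_half_odd_eq:
  assumes r: "r \<in> set lam" and half: "2 * chi r = r" and od: "odd (count_list lam r)"
  shows "A_crit_half_odd lam chi r =
    owned_starts c start_owner r + owned_corners c (csum c) r"
proof -
  note b = part_block[OF r] and sc = single_c[OF r half]
  have cr: "critical lam chi r" by (rule single_critical[OF r half])
  note f = critical_facts[OF r cr]
  let ?g = "part_start r" and ?e = "part_end r"
  have "Suc ?e - ?g = count_list lam r"
    using b(2) mult_ge_eq_gt_count[of lam r] by (simp add: part_start_def)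
  then have ev: "even (?e - ?g)" using b(3) od by (metis Suc_diff_le even_Suc)
  have T1: "T_vec (lower_one lam r) (X_crit lam chi \<union> {(r - 2, (r - 2) div 2)}) = lower_vec c ?e"
    by (rule single_vec[OF r half, of _ _ "{}"]) auto
  have tail: "tail_A lam chi r (lower_one lam r) ((X_crit lam chi \<union> {(r - 2, (r - 2) div 2)}) - {(r, r div 2)}) =
      (\<Sum>p\<in>tail_starts r. start_weight c p *\<^sub>E lower_vec c p)"
  proof (rule tail_A_eq[OF r cr])
    fix p Z assume p: "p \<in> tail_starts r" and Z: "tail_extension p Z"
    note P = tail_startsD[OF p r]
    have notZ: "(r, chi r) \<notin> Z"
    proof
      assume "(r, chi r) \<in> Z"
      then have z: "0 < p" "csum c (p - 1) = r" using Z by (auto simp: tail_extension_def)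
      then have "csum c p < r" using P(1) by (simp add: block_start_def)
      then show False using csum_antimono[OF interlaced P(5)] b(4) by simp
    qed
    have new: "(r - 2, (r - 2) div 2) \<noteq> (r, r div 2)" using f(3) half by auto
    have hr: "r div 2 = chi r" using half by simp
    have "even (?e - p)" using ev tail_starts_parity[OF p r] P(5) b(3) by (auto simp: even_diff_nat)
    then show "T_vec (lower_one lam r) (((X_crit lam chi \<union> {(r - 2, (r - 2) div 2)}) - {(r, r div 2)}) \<union> Z) = lower_vec c p"
      using p Z notZ new unfolding hr by (intro single_vec[OF r half, of _ _ Z]) auto
  qed
  have mult: "int (mult_ge lam r) - 1 = int ?e" "int (mult_gt lam r) = int ?g"
    using b(2) by (auto simp: part_start_def)
  show ?thesis
  proof (cases "?g < ?e")
    case False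
    \<comment> \<open>For a single part r the first two coefficients vanish, and with them the
      vector that would lower two parts r.\<close>
    then have eq: "?g = ?e" using b(3) by simp
    then have "owned_starts c start_owner r =
        (\<Sum>p\<in>tail_starts r. start_weight c p *\<^sub>E lower_vec c p)"
      unfolding starts_owned[OF r] using f(2,4) cr by (simp add: insert_absorb)
    moreover have "owned_corners c (csum c) r = 0"
      unfolding corners_owned[OF r] using f(2) False by simp
    ultimately show ?thesis
      unfolding A_crit_half_odd_def Let_def tail mult eq by simp
  next
    case True
    then obtain q where q: "?e = Suc q" "?g \<le> q" by (cases ?e) auto
    have inside: "\<not> admissible c p" if "?g < p" "p \<le> q" for p
      using not_admissible_inside[OF r, of p] that q by simp
    have w2: "start_weight c ?e = xp (int ?e) - xp (int ?g)"
      by (rule start_weight_next) (use True ev f(1) sc inside q in auto)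
    have w1: "corner_weight c q = (xp (int q + 1) - xp (int ?g)) / (x_ind - 1)"
    proof (rule corner_weight_eq)
      show "?g \<le> Suc q" using q by simp
      show "?g = 0 \<or> even (Suc q - ?g) \<and> (admissible c (?g - 1) \<or> c q < c (?g - 1))"
      proof (cases ?g)
        case (Suc l)
        have be: "block_end l" using b(6) Suc by (simp add: block_start_Suc)
        have "cmax c ?g < cmax c l" using block_start_admissible[of l] b(6) f(1) Suc by simp
        then have "c q < c l" using block_end_c[OF be] sc[of q] q block_cmin_cmax(2)[OF r, of ?g] half b(3) by simp
        then show ?thesis using Suc ev q by simp
      qed simp
    next
      fix p assume p: "?g \<le> p" "p \<le> q" "even (q - p)"
      have "p \<noteq> ?g" using p(3) ev q by (auto simp: Suc_diff_le)
      then show "\<not> admissible c p \<and> c p \<le> c q" using inside[of p] p sc[of p] sc[of q] q by simp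
    qed
    have "?e \<notin> tail_starts r" using f(5) True by blast
    then have "owned_starts c start_owner r =
        (xp (int ?e) - xp (int ?g)) *\<^sub>E lower_vec c ?e + (\<Sum>p\<in>tail_starts r. start_weight c p *\<^sub>E lower_vec c p)"
      unfolding starts_owned[OF r] using f(2) cr finite_tail_starts w2 by simp
    moreover have "owned_corners c (csum c) r =
        ((xp (int ?e) - xp (int ?g)) / (x_ind - 1)) *\<^sub>E lower_vec c q"
      unfolding corners_owned[OF r] using f(2) True w1 q by (simp add: add.commute)
    ultimately show ?thesis
      unfolding A_crit_half_odd_def Let_def tail mult T1 critical_lower_two_vec[OF r cr True]
      using q by (simp add: algebra_simps)
  qed
qed

lemma A_elem_eq_box_sum: "A_elem lam chi = box_sum c"
proof -
  let ?S = "\<lambda>r. owned_starts c start_owner r + owned_corners c (csum c) r"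
  let ?C = "\<lambda>r. critical lam chi r" and ?h = "\<lambda>r. 2 * chi r = r" and ?o = "\<lambda>r. odd (count_list lam r)"
  have crit_in: "r \<in> set lam" if "?C r" for r using that by (simp add: critical_def)
  have "box_sum c = (\<Sum>r\<in>set lam. ?S r)"
  proof (rule box_sum_grouped[OF interlaced])
    show "start_owner p \<in> set lam" if "admissible c p" "0 < c p" for p
    proof (cases "block_end p")
      case True
      then show ?thesis using start_owner_block_end by (auto simp: block_end_def intro!: in_set_lam)
    next
      case False
      then have "cmin c p = c p" using admissible_cases[OF that(1)] block_start_c by auto
      moreover obtain i where i: "start_owner p = csum c i" "cmin c i = cmin c p"
        using start_owner_inside(1)[OF False] by blast
      ultimately have "0 < csum c i" using that(2) by (simp add: csum_def)
      then show ?thesis using in_set_lam i(1) by simp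
    qed
    show "csum c q \<in> set lam" if "corner c q" for q
      using that le_cmax[of c q] by (intro in_set_lam) (auto simp: corner_def csum_def)
  qed simp
  also have "set lam = {r \<in> set lam. \<not> ?C r} \<union> ({r. ?C r \<and> \<not> ?h r} \<union>
      ({r. ?C r \<and> ?h r \<and> ?o r} \<union> {r. ?C r \<and> ?h r \<and> \<not> ?o r}))"
    using crit_in by auto
  also have "(\<Sum>r\<in>\<dots>. ?S r) = (\<Sum>r | r \<in> set lam \<and> \<not> ?C r. ?S r) + ((\<Sum>r | ?C r \<and> \<not> ?h r. ?S r) +
      ((\<Sum>r | ?C r \<and> ?h r \<and> ?o r. ?S r) + (\<Sum>r | ?C r \<and> ?h r \<and> \<not> ?o r. ?S r)))"
  proof -
    have fin: "finite {r. ?C r \<and> \<not> ?h r}" "finite {r. ?C r \<and> ?h r \<and> ?o r}" "finite {r. ?C r \<and> ?h r \<and> \<not> ?o r}"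
      by (rule finite_subset[of _ "set lam"]; use crit_in in auto)+
    show ?thesis
      by (subst sum.union_disjoint; (use fin in auto)?)+
  qed
  also have "\<dots> = A_elem lam chi"
    unfolding A_elem_def add.assoc
    by (intro arg_cong2[of _ _ _ _ "(+)"] sum.cong refl)
      (auto simp: A_noncrit_eq A_crit_generic_eq A_crit_half_even_eq A_crit_half_odd_eq crit_in)
  finally show ?thesis by simp
qed

end

subsection \<open>The exotic restriction formula\<close>

locale interlaced_sequence =
  fixes c :: "nat \<Rightarrow> nat"
  assumes interlaced: "interlaced c"
begin

abbreviation mu :: "nat list" where "mu \<equiv> partition_of (\<lambda>i. c (2 * i))"

abbreviation nu :: "nat list" where "nu \<equiv> partition_of (\<lambda>i. c (Suc (2 * i)))"

abbreviation kappa :: "nat list" where "kappa \<equiv> part_add mu nu"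

definition kap :: "nat \<Rightarrow> nat" where
  "kap i = c (2 * i) + c (Suc (2 * i))"

lemma mu_nu:
  "is_partition mu" "is_partition nu" "part mu (Suc i) = c (2 * i)" "part nu (Suc i) = c (Suc (2 * i))"
  using finite_antimono_subseq[OF interlaced]
  by (simp_all add: is_partition_partition_of part_partition_of)

lemma c_antimono: "i \<le> j \<Longrightarrow> c (2 * j) \<le> c (2 * i)" "i \<le> j \<Longrightarrow> c (Suc (2 * j)) \<le> c (Suc (2 * i))"
  by (rule interlaced_le[OF interlaced]; simp)+

lemma kap_antimono: "i \<le> j \<Longrightarrow> kap j \<le> kap i"
  using c_antimono[of i j] by (simp add: kap_def add_mono)

text \<open>As for \<open>csum\<close>, both summands decrease, so their sum determines them; this
  is what makes \<open>nabla\<close> and \<open>Delta\<close> well defined.\<close>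

lemma kap_eqD:
  assumes "kap i = kap j"
  shows "c (2 * i) = c (2 * j)" "c (Suc (2 * i)) = c (Suc (2 * j))"
  using assms c_antimono[of i j] c_antimono[of j i] by (cases "i \<le> j"; simp add: kap_def)+

lemma kap_less_imp_less: "kap j < kap i \<Longrightarrow> i < j"
  using kap_antimono[of j i] by (cases "i < j") auto

lemma kappa_eq: "kappa = map kap [0..<max (length mu) (length nu)]"
  unfolding part_add_def Suc_eq_plus1[symmetric] map_shift_upt mu_nu kap_def ..

lemma kap_eq_0_iff: "kap i = 0 \<longleftrightarrow> max (length mu) (length nu) \<le> i"
proof -
  have pos: "0 < part l (Suc i) \<longleftrightarrow> i < length l" if "is_partition l" for l
    using that by (auto simp: is_partition_def part_Suc) (metis nth_mem gr0I)
  show ?thesis using pos[OF mu_nu(1)] pos[OF mu_nu(2)] unfolding mu_nu kap_def by auto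
qed

lemma part_kappa: "part kappa (Suc i) = kap i"
  using kap_eq_0_iff[of i] by (auto simp: kappa_eq part_Suc)

lemma is_partition_kappa: "is_partition kappa"
proof -
  have "0 < kap i" if "i < max (length mu) (length nu)" for i
    using that by (intro gr0I) (auto simp: kap_eq_0_iff less_max_iff_disj)
  then have "0 \<notin> set kappa" by (force simp: kappa_eq simp del: less_max_iff_disj)
  moreover have "sorted_wrt (\<ge>) kappa" using kap_antimono by (auto simp: kappa_eq sorted_wrt_iff_nth_less)
  ultimately show ?thesis by (simp add: is_partition_def)
qed

lemma less_mult_ge_kappa: "0 < t \<Longrightarrow> i < mult_ge kappa t \<longleftrightarrow> t \<le> kap i"
  using less_mult_ge_iff[OF is_partition_kappa] part_kappa by simp

lemma less_mult_gt_kappa: "i < mult_gt kappa r \<longleftrightarrow> r < kap i"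
  using less_mult_gt_iff[OF is_partition_kappa] part_kappa by simp

lemma in_set_kappa: "r \<in> set kappa \<longleftrightarrow> 0 < r \<and> (\<exists>i. kap i = r)"
  using in_set_partition_iff[OF is_partition_kappa] part_kappa by simp

lemma in_set_kappaE:
  assumes "r \<in> set kappa"
  obtains i where "kap i = r" "0 < r"
  using assms unfolding in_set_kappa by (elim conjE exE) (rule that)

lemma part_kappa_conv: "(\<exists>i\<ge>1. part kappa i = r \<and> part l i = y) \<longleftrightarrow> (\<exists>i. kap i = r \<and> part l (Suc i) = y)"
  using part_kappa by (metis Suc_le_D One_nat_def le_add1 plus_1_eq_Suc)

lemma nabla_kap: "nabla mu nu (kap i) = c (2 * i)"
  unfolding nabla_def part_kappa_conv mu_nu using kap_eqD(1) by (intro the_equality) blast+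

lemma Delta_kap: "Delta mu nu (kap i) = c (Suc (2 * i))"
  unfolding Delta_def part_kappa_conv mu_nu using kap_eqD(2) by (intro the_equality) blast+

definition kap_start :: "nat \<Rightarrow> nat" where
  "kap_start r = mult_gt kappa r"

definition kap_end :: "nat \<Rightarrow> nat" where
  "kap_end r = mult_ge kappa r - 1"

lemma kap_block:
  assumes "r \<in> set kappa"
  shows "kap i = r \<longleftrightarrow> kap_start r \<le> i \<and> i \<le> kap_end r"
    and "mult_ge kappa r = Suc (kap_end r)" "kap_start r \<le> kap_end r"
    and "kap (kap_start r) = r" "kap (kap_end r) = r"
    and "r < kap i \<longleftrightarrow> i < kap_start r" "kap i < r \<longleftrightarrow> kap_end r < i"
proof -
  obtain k where k: "kap k = r" and pos: "0 < r" by (rule in_set_kappaE[OF assms])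
  have lt: "\<And>i. i < mult_ge kappa r \<longleftrightarrow> r \<le> kap i" using less_mult_ge_kappa pos by blast
  have gt: "\<And>i. i < kap_start r \<longleftrightarrow> r < kap i" using less_mult_gt_kappa by (simp add: kap_start_def)
  have "k < mult_ge kappa r" using lt k by simp
  then show e: "mult_ge kappa r = Suc (kap_end r)" by (simp add: kap_end_def)
  show iff: "kap i = r \<longleftrightarrow> kap_start r \<le> i \<and> i \<le> kap_end r" for i
    using lt[of i] gt[of i] e by auto
  show le: "kap_start r \<le> kap_end r" using iff[of k] k by simp
  then show cs: "kap (kap_start r) = r" "kap (kap_end r) = r" using iff by auto
  show "r < kap i \<longleftrightarrow> i < kap_start r" using gt by simp
  show "kap i < r \<longleftrightarrow> kap_end r < i" using lt[of i] e by auto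
qed

lemma kap_block_c:
  assumes "r \<in> set kappa" "kap_start r \<le> i" "i \<le> kap_end r"
  shows "c (2 * i) = nabla mu nu r" "c (Suc (2 * i)) = Delta mu nu r"
  using kap_block(1)[OF assms(1), of i] assms(2,3) nabla_kap[of i] Delta_kap[of i] by auto

lemma kap_start_eq: "0 < kap i \<Longrightarrow> i = 0 \<or> kap i < kap (i - 1) \<Longrightarrow> kap_start (kap i) = i"
proof -
  assume a: "0 < kap i" "i = 0 \<or> kap i < kap (i - 1)"
  then have "kap i \<in> set kappa" using in_set_kappa by blast
  from kap_block(1)[OF this, of i] kap_block(6)[OF this, of "i - 1"] a show ?thesis by auto
qed

lemma kap_end_eq: "kap (Suc i) < kap i \<Longrightarrow> kap_end (kap i) = i"
proof -
  assume a: "kap (Suc i) < kap i"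
  then have "kap i \<in> set kappa" using in_set_kappa by auto
  from kap_block(1)[OF this, of i] kap_block(7)[OF this, of "Suc i"] a show ?thesis by auto
qed

lemma nabla_zero: "nabla mu nu 0 = 0" "\<exists>i. kap i = 0"
proof -
  obtain n where "c (2 * n) = 0" "c (Suc (2 * n)) = 0"
    using interlaced unfolding interlaced_def by (metis le_add2 mult_2 le_Suc_eq)
  then show "\<exists>i. kap i = 0" "nabla mu nu 0 = 0" using nabla_kap[of n] by (auto simp: kap_def intro!: exI[of _ n])
qed

text \<open>By monotonicity it suffices to look at the next index. The resulting inequality says
  that the last mu-entry of \<open>r\<close> is a corner, and equally that its last nu-entry is a
  legal start.\<close>

lemma kappa_v_iff:
  assumes r: "r \<in> set kappa"
  shows "r \<in> kappa_v mu nu \<longleftrightarrow> c (Suc (Suc (2 * kap_end r))) < c (2 * kap_end r)"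
proof -
  note b = kap_block[OF r]
  let ?e = "kap_end r"
  have ne: "c (2 * ?e) = nabla mu nu r" using kap_block_c(1)[OF r, of ?e] b(3) by simp
  have m: "x \<in> set kappa \<union> {0} \<longleftrightarrow> (\<exists>i. kap i = x)" for x
    using nabla_zero(2) in_set_kappa[of x] by (cases "x = 0") simp_all
  have set0: "set kappa \<union> {0} = range kap" by (rule set_eqI) (unfold m, auto)
  have "r \<in> kappa_v mu nu \<longleftrightarrow> (\<forall>i. kap i < r \<longrightarrow> c (2 * i) < c (2 * ?e))"
    using r unfolding kappa_v_def set0 ne by (auto simp: nabla_kap)
  also have "\<dots> \<longleftrightarrow> c (2 * Suc ?e) < c (2 * ?e)"
    unfolding b(7) using c_antimono(1)[of "Suc ?e"] by (meson Suc_le_eq lessI le_less_trans)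
  finally show ?thesis by simp
qed

text \<open>By monotonicity only the preceding index matters. Case 3 thus means that the first
  mu-entry of \<open>r\<close> is not a legal start.\<close>

lemma case3_iff:
  assumes r: "r \<in> set kappa"
  shows "case3 mu nu r \<longleftrightarrow> (\<exists>l. kap_start r = Suc l \<and> c (Suc (2 * l)) = Delta mu nu r)"
proof -
  note b = kap_block[OF r]
  let ?g = "kap_start r"
  have de: "c (Suc (2 * ?g)) = Delta mu nu r" using kap_block_c(2)[OF r, of ?g] b(3) by simp
  have "case3 mu nu r \<longleftrightarrow> (\<exists>i. r < kap i \<and> c (Suc (2 * i)) = Delta mu nu r)"
    unfolding case3_def using in_set_kappa Delta_kap by (metis gr_implies_not0 gr0I)
  also have "\<dots> \<longleftrightarrow> (\<exists>i<?g. c (Suc (2 * i)) = Delta mu nu r)" unfolding b(6) by simp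
  also have "\<dots> \<longleftrightarrow> (\<exists>l. ?g = Suc l \<and> c (Suc (2 * l)) = Delta mu nu r)"
  proof
    assume "\<exists>i<?g. c (Suc (2 * i)) = Delta mu nu r"
    then obtain i where i: "i < ?g" "c (Suc (2 * i)) = Delta mu nu r" by blast
    then obtain l where l: "?g = Suc l" "i \<le> l" by (cases ?g) auto
    then show "\<exists>l. ?g = Suc l \<and> c (Suc (2 * l)) = Delta mu nu r"
      using c_antimono(2)[of i l] c_antimono(2)[of l ?g] i(2) de by (intro exI[of _ l]) simp
  qed auto
  finally show ?thesis .
qed

lemma case4_iff:
  assumes r: "r \<in> set kappa"
  shows "case4 mu nu r \<longleftrightarrow> (\<exists>l. kap_start r = Suc l \<and> c (2 * l) = nabla mu nu r)"
proof -
  note b = kap_block[OF r]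
  let ?g = "kap_start r"
  have de: "c (2 * ?g) = nabla mu nu r" using kap_block_c(1)[OF r, of ?g] b(3) by simp
  have "case4 mu nu r \<longleftrightarrow> (\<exists>i. r < kap i \<and> c (2 * i) = nabla mu nu r)"
    unfolding case4_def using in_set_kappa nabla_kap by (metis gr_implies_not0 gr0I)
  also have "\<dots> \<longleftrightarrow> (\<exists>i<?g. c (2 * i) = nabla mu nu r)" unfolding b(6) by simp
  also have "\<dots> \<longleftrightarrow> (\<exists>l. ?g = Suc l \<and> c (2 * l) = nabla mu nu r)"
  proof
    assume "\<exists>i<?g. c (2 * i) = nabla mu nu r"
    then obtain i where i: "i < ?g" "c (2 * i) = nabla mu nu r" by blast
    then obtain l where l: "?g = Suc l" "i \<le> l" by (cases ?g) auto
    then show "\<exists>l. ?g = Suc l \<and> c (2 * l) = nabla mu nu r"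
      using c_antimono(1)[of i l] c_antimono(1)[of l ?g] i(2) de by (intro exI[of _ l]) simp
  qed auto
  finally show ?thesis .
qed

lemma case2_iff:
  assumes r: "r \<in> set kappa"
  shows "case2 mu nu r \<longleftrightarrow> \<not> case3 mu nu r \<and> \<not> case4 mu nu r"
proof -
  note b = kap_block[OF r]
  have "nabla mu nu r \<le> nabla mu nu r'" "Delta mu nu r \<le> Delta mu nu r'"
    if "r' \<in> set kappa" "r < r'" for r'
  proof -
    note mem = that(1)
    obtain i where "kap i = r'" by (rule in_set_kappaE[OF mem])
    then have i: "r' = kap i" ..
    have "i \<le> kap_start r" using b(6)[of i] that(2) i by simp
    then show "nabla mu nu r \<le> nabla mu nu r'" "Delta mu nu r \<le> Delta mu nu r'"
      using c_antimono[of i "kap_start r"] kap_block_c[OF r, of "kap_start r"] b(3)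
      by (simp_all add: i nabla_kap Delta_kap)
  qed
  then show ?thesis unfolding case2_def case3_def case4_def by (metis le_neq_implies_less less_irrefl)
qed

lemma case34_disjoint:
  assumes r: "r \<in> set kappa"
  shows "\<not> (case3 mu nu r \<and> case4 mu nu r)"
proof
  assume "case3 mu nu r \<and> case4 mu nu r"
  then obtain l where l: "kap_start r = Suc l" "c (Suc (2 * l)) = Delta mu nu r" "c (2 * l) = nabla mu nu r"
    unfolding case3_iff[OF r] case4_iff[OF r] by auto
  then have "kap l = kap (kap_start r)"
    using kap_block_c[OF r, of "kap_start r"] kap_block(3)[OF r] by (simp add: kap_def)
  then show False using kap_block(4,6)[OF r] l(1) by (metis lessI less_irrefl)
qed

lemma lower_corner: "corner c q \<Longrightarrow> lower c q i = c i - (if i = q then 1 else 0)"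
proof -
  assume co: "corner c q"
  have "c i \<noteq> c q" if "q < i" "even (i - q)" for i
  proof -
    have "Suc (Suc q) \<le> i" using that by (cases "i = Suc q") auto
    moreover have "even (i - Suc (Suc q))" using that \<open>Suc (Suc q) \<le> i\<close> by (auto simp: even_diff_nat)
    ultimately have "c i \<le> c (Suc (Suc q))" by (rule interlaced_le[OF interlaced])
    then show ?thesis using co by (simp add: corner_def)
  qed
  from this[of i] this[of "Suc i"] show ?thesis
    unfolding lower_def
    by (cases "i = q"; cases "q \<le> i"; cases "even (i - q)") (simp_all add: Suc_diff_le del: even_diff_nat)
qed

lemma mu_lowered_eq:
  assumes "r \<in> set kappa" "corner c (2 * kap_end r)"
  shows "mu_lowered mu nu r = lower_vec c (2 * kap_end r)"
proof -
  have n: "nabla mu nu r = c (2 * kap_end r)" using nabla_kap[of "kap_end r"] kap_block(5)[OF assms(1)] by simp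
  have "replace_part (nabla mu nu r) (nabla mu nu r - 1) mu =
      partition_of (\<lambda>k. part mu (Suc k) - (if k = kap_end r then 1 else 0))"
    by (rule replace_part_pred_eq) (use assms(2) mu_nu mu_nu(3)[of "Suc _"] n in \<open>auto simp: corner_def\<close>)
  moreover have "Suc (2 * k) = 2 * kap_end r \<longleftrightarrow> False" for k by presburger
  then have "bipartition_of (lower c (2 * kap_end r)) =
      (partition_of (\<lambda>k. part mu (Suc k) - (if k = kap_end r then 1 else 0)), nu)"
    unfolding bipartition_of_def lower_corner[OF assms(2)] mu_nu by simp
  ultimately show ?thesis by (simp add: mu_lowered_def lower_vec_def)
qed

lemma nu_lowered_eq:
  assumes "r \<in> set kappa" "corner c (Suc (2 * kap_end r))"
  shows "e_vec (mu, replace_part (Delta mu nu r) (Delta mu nu r - 1) nu) = lower_vec c (Suc (2 * kap_end r))"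
proof -
  have n: "Delta mu nu r = c (Suc (2 * kap_end r))" using Delta_kap[of "kap_end r"] kap_block(5)[OF assms(1)] by simp
  have "replace_part (Delta mu nu r) (Delta mu nu r - 1) nu =
      partition_of (\<lambda>k. part nu (Suc k) - (if k = kap_end r then 1 else 0))"
    by (rule replace_part_pred_eq) (use assms(2) mu_nu mu_nu(4)[of "Suc _"] n in \<open>auto simp: corner_def\<close>)
  moreover have "2 * k = Suc (2 * kap_end r) \<longleftrightarrow> False" for k by presburger
  then have "bipartition_of (lower c (Suc (2 * kap_end r))) =
      (mu, partition_of (\<lambda>k. part nu (Suc k) - (if k = kap_end r then 1 else 0)))"
    unfolding bipartition_of_def lower_corner[OF assms(2)] mu_nu by simp
  ultimately show ?thesis by (simp add: lower_vec_def)
qed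

lemma antimono_lower:
  assumes "0 < c p" "admissible c p"
  shows "antimono (\<lambda>i. lower c p (2 * i))" "antimono (\<lambda>i. lower c p (Suc (2 * i)))"
  using finite_antimono_subseq[OF interlaced_lower[OF interlaced assms(1) disjI1[OF assms(2)]]]
  by (simp_all add: finite_antimono_def)

text \<open>Lowering from the last nu-entry of \<open>r\<close>. The intervals count from 1, so
  m(>=r) is the index of that entry, M is the end of its run, and the mu-entries in between have
  indices m(>=r) + 1 to M.\<close>

lemma up_down_eq:
  assumes r: "r \<in> set kappa" and v: "r \<in> kappa_v mu nu" and pos: "0 < Delta mu nu r"
  shows "up_down mu nu r = lower_vec c (Suc (2 * kap_end r))"
proof -
  let ?e = "kap_end r" and ?D = "Delta mu nu r"
  let ?p = "Suc (2 * ?e)"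
  have D: "c ?p = ?D" using Delta_kap[of ?e] kap_block(5)[OF r] by simp
  have ad: "admissible c ?p" using v kappa_v_iff[OF r] by (simp add: admissible_def)
  have M: "i < mult_ge nu ?D \<longleftrightarrow> ?D \<le> c (Suc (2 * i))" for i
    using less_mult_ge_iff[OF mu_nu(2) pos, of i] mu_nu(4) by simp
  have past: "c (Suc (2 * i)) \<le> ?D" if "?e \<le> i" for i using c_antimono(2)[OF that] D by simp
  have "incr_parts (mult_ge kappa r + 1) (mult_ge nu ?D) mu = partition_of (\<lambda>i. lower c ?p (2 * i))"
  proof (rule incr_parts_eq)
    fix i
    show "lower c ?p (2 * i) = part mu (Suc i) + (if mult_ge kappa r + 1 \<le> Suc i \<and> Suc i \<le> mult_ge nu ?D then 1 else 0)"
    proof (cases "Suc ?e \<le> i")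
      case True
      then have "odd (2 * i - ?p)" by (simp add: even_diff_nat)
      then show ?thesis using True M[of i] past[of i] D by (auto simp: lower_def mu_nu kap_block(2)[OF r] Suc_le_eq)
    next
      case False
      then show ?thesis by (simp add: mu_nu kap_block(2)[OF r])
    qed
  qed (rule antimono_lower; use ad pos D in simp)
  moreover have "decr_parts (mult_ge kappa r) (mult_ge nu ?D) nu = partition_of (\<lambda>i. lower c ?p (Suc (2 * i)))"
  proof (rule decr_parts_eq)
    fix i
    show "lower c ?p (Suc (2 * i)) = part nu (Suc i) - (if mult_ge kappa r \<le> Suc i \<and> Suc i \<le> mult_ge nu ?D then 1 else 0)"
    proof (cases "?e \<le> i")
      case True
      then have "even (Suc (2 * i) - ?p)" by simp
      then show ?thesis using True M[of i] past[of i] D by (auto simp: lower_def mu_nu kap_block(2)[OF r] Suc_le_eq)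
    next
      case False
      then show ?thesis by (simp add: mu_nu kap_block(2)[OF r])
    qed
  qed (rule antimono_lower; use ad pos D in simp)
  ultimately show ?thesis
    using pos by (simp add: up_down_def Let_def lower_vec_def bipartition_of_def)
qed

text \<open>Lowering from a mu-entry with index \<open>i\<close> counted from 0, hence
  \<open>Suc i\<close>. Membership in \<open>kappa_v\<close> makes \<open>kap_end r\<close> the end
  of the run of value nabla(r), so the lowered interval stops at M and the raised one at M -
  1.\<close>

lemma down_up_eq:
  assumes r: "r \<in> set kappa" and v: "r \<in> kappa_v mu nu" and i: "admissible c (2 * i)" "c (2 * i) = nabla mu nu r"
  shows "down_up mu nu r (Suc i) = lower_vec c (2 * i)"
proof -
  let ?e = "kap_end r" and ?D = "nabla mu nu r"
  let ?p = "2 * i"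
  have D: "c (2 * ?e) = ?D" using nabla_kap[of ?e] kap_block(5)[OF r] by simp
  have lt: "c (2 * Suc ?e) < ?D" using v kappa_v_iff[OF r] D by simp
  have pos: "0 < ?D" using lt by simp
  have eq: "c (2 * k) = ?D \<longleftrightarrow> k \<le> ?e" if "i \<le> k" for k
    using c_antimono(1)[OF that] c_antimono(1)[of k ?e] c_antimono(1)[of "Suc ?e" k] D lt i(2)
    by (cases "k \<le> ?e") auto
  have M: "mult_ge mu ?D = Suc ?e"
    using less_mult_ge_iff[OF mu_nu(1) pos, of ?e] less_mult_ge_iff[OF mu_nu(1) pos, of "Suc ?e"]
      mu_nu(3)[of ?e] mu_nu(3)[of "Suc ?e"] D lt by simp
  have "decr_parts (Suc i) (Suc ?e) mu = partition_of (\<lambda>k. lower c ?p (2 * k))"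
  proof (rule decr_parts_eq)
    fix k
    show "lower c ?p (2 * k) = part mu (Suc k) - (if Suc i \<le> Suc k \<and> Suc k \<le> Suc ?e then 1 else 0)"
      using eq[of k] i(2) by (cases "i \<le> k") (auto simp: lower_def mu_nu)
  qed (rule antimono_lower; use i pos in simp)
  moreover have "incr_parts (Suc i) (Suc ?e - 1) nu = partition_of (\<lambda>k. lower c ?p (Suc (2 * k)))"
  proof (rule incr_parts_eq)
    fix k
    show "lower c ?p (Suc (2 * k)) = part nu (Suc k) + (if Suc i \<le> Suc k \<and> Suc k \<le> Suc ?e - 1 then 1 else 0)"
    proof (cases "i \<le> k")
      case True
      then have "odd (Suc (2 * k) - ?p)" by (simp add: Suc_diff_le)
      then show ?thesis using True eq[of "Suc k"] i(2) by (auto simp: lower_def mu_nu)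
    next
      case False
      then show ?thesis by (simp add: mu_nu)
    qed
  qed (rule antimono_lower; use i pos in simp)
  ultimately show ?thesis
    by (simp add: down_up_def Let_def M lower_vec_def bipartition_of_def)
qed

text \<open>Counterpart of \<open>tail_starts\<close> for mu-entries; for r in
  \<open>kappa_v\<close> the bound by the first index of \<open>r\<close> is a consequence.\<close>

definition exotic_starts :: "nat \<Rightarrow> nat set" where
  "exotic_starts r = {i. admissible c (2 * i) \<and> c (2 * i) = nabla mu nu r}"

lemma finite_exotic_starts: "0 < nabla mu nu r \<Longrightarrow> finite (exotic_starts r)"
proof -
  assume "0 < nabla mu nu r"
  then have "\<not> max (length mu) (length nu) \<le> i" if "i \<in> exotic_starts r" for i
    unfolding kap_eq_0_iff[symmetric] using that by (simp add: exotic_starts_def kap_def)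
  then have "exotic_starts r \<subseteq> {..max (length mu) (length nu)}" by (meson atMost_iff nat_le_linear subsetI)
  then show ?thesis by (rule finite_subset) simp
qed

lemma kap_start_of_admissible:
  assumes "admissible c (2 * i)"
  shows "i = 0 \<or> kap i < kap (i - 1)"
proof (cases i)
  case (Suc l)
  then have "c (Suc (2 * i)) < c (Suc (2 * l))" using assms by (simp add: admissible_def)
  then show ?thesis using Suc c_antimono(1)[of l i] by (simp add: kap_def)
qed simp

lemma admissible_of_kap_start:
  assumes "kap (Suc l) < kap l" "c (2 * Suc l) = c (2 * l)"
  shows "admissible c (2 * Suc l)"
  using assms by (simp add: kap_def admissible_def)

text \<open>Parallel to \<open>tail_A_eq\<close>: j is the part at the least start, and k
  contributes the start after its last index. Excluding case 3 makes the first mu-entry of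
  \<open>r\<close> a legal start, and so treats cases 2 and 4 together.\<close>

lemma exotic_tail_eq:
  assumes r: "r \<in> set kappa" and v: "r \<in> kappa_v mu nu" and n3: "\<not> case3 mu nu r"
  shows "xp (2 * int (mult_gt kappa (j_B mu nu r))) *\<^sub>E down_up mu nu r (mult_gt kappa (j_B mu nu r) + 1) +
    (\<Sum>k | k \<in> set kappa \<and> r < k \<and> k \<le> j_B mu nu r.
      (xp (2 * int (mult_ge kappa k)) - xp (2 * int (mult_gt kappa k))) *\<^sub>E down_up mu nu r (mult_ge kappa k + 1)) =
    (\<Sum>i\<in>exotic_starts r. start_weight c (2 * i) *\<^sub>E lower_vec c (2 * i))"
proof -
  note b = kap_block[OF r]
  define g where "g = kap_start r"
  define e where "e = kap_end r"
  define D where "D = nabla mu nu r"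
  have ge: "g \<le> e" using b(3) by (simp add: g_def e_def)
  have cD: "c (2 * i) = D" if "g \<le> i" "i \<le> e" for i using kap_block_c(1)[OF r] that by (simp add: g_def e_def D_def)
  have lt: "c (2 * Suc e) < D" using v kappa_v_iff[OF r] cD[of e] ge by (simp add: e_def)
  have Dpos: "0 < D" using lt by simp
  have fin: "finite (exotic_starts r)" using finite_exotic_starts Dpos by (simp add: D_def)
  have E: "i \<in> exotic_starts r \<longleftrightarrow> admissible c (2 * i) \<and> c (2 * i) = D" for i by (simp add: exotic_starts_def D_def)
  have kap_g: "kap g = r" using b(4) by (simp add: g_def)
  have g_in: "g \<in> exotic_starts r"
  proof -
    have "admissible c (2 * g)"
    proof (cases g)
      case (Suc l)
      then have "c (Suc (2 * l)) \<noteq> Delta mu nu r" using n3 case3_iff[OF r] by (simp add: g_def)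
      moreover have "c (Suc (2 * g)) = Delta mu nu r" using kap_block_c(2)[OF r, of g] b(3) by (simp add: g_def)
      moreover have "c (Suc (2 * g)) \<le> c (Suc (2 * l))" using Suc by (intro c_antimono) simp
      ultimately show ?thesis using Suc by (simp add: admissible_def)
    qed (simp add: admissible_def)
    then show ?thesis using E cD[of g] ge by simp
  qed
  have le_e: "i \<le> e" if "c (2 * i) = D" for i
    using c_antimono(1)[of "Suc e" i] lt that by (cases "i \<le> e") auto
  have le_g: "i \<le> g" if "i \<in> exotic_starts r" for i
  proof (rule ccontr)
    assume "\<not> i \<le> g"
    then have "kap i = r" "kap (i - 1) = r" using b(1)[of i] b(1)[of "i - 1"] le_e[of i] that E by (auto simp: g_def e_def)
    then show False using kap_start_of_admissible[of i] that E \<open>\<not> i \<le> g\<close> by simp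
  qed
  define i0 where "i0 = Min (exotic_starts r)"
  have i0: "i0 \<in> exotic_starts r" unfolding i0_def using g_in fin by (intro Min_in) auto
  have i0_le: "i0 \<le> i" if "i \<in> exotic_starts r" for i unfolding i0_def using that fin by simp
  have i0g: "i0 \<le> g" using i0_le g_in by simp
  have mid: "c (2 * i) = D" if "i0 \<le> i" "i \<le> g" for i
    using c_antimono(1)[OF that(1)] c_antimono(1)[OF that(2)] i0 E cD[of g] ge by simp
  have rpos: "0 < r" by (rule in_set_kappaE[OF r])
  have kap_i0: "r \<le> kap i0" using kap_antimono[OF i0g] kap_g by simp
  have start0: "kap_start (kap i0) = i0"
    using kap_start_eq[of i0] kap_start_of_admissible[of i0] i0 E kap_i0 rpos by simp
  have j: "j_B mu nu r = kap i0"
    unfolding j_B_def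
  proof (rule Max_eqI)
    fix y assume "y \<in> {j \<in> set kappa. nabla mu nu j = nabla mu nu r \<and>
      (\<forall>r'\<in>set kappa. j < r' \<longrightarrow> Delta mu nu r' \<noteq> Delta mu nu j)}"
    then have y: "y \<in> set kappa" "nabla mu nu y = D" "\<And>r'. r' \<in> set kappa \<Longrightarrow> y < r' \<Longrightarrow> Delta mu nu r' \<noteq> Delta mu nu y"
      by (auto simp: D_def)
    note by' = kap_block[OF y(1)]
    let ?s = "kap_start y"
    have cs: "c (2 * ?s) = D" "c (Suc (2 * ?s)) = Delta mu nu y" using kap_block_c[OF y(1), of ?s] by'(3) y(2) by auto
    have "admissible c (2 * ?s)"
    proof (cases ?s)
      case (Suc l)
      then have l: "y < kap l" using by'(6)[of l] by simp
      then have "kap l \<in> set kappa" using in_set_kappa by auto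
      then have "c (Suc (2 * l)) \<noteq> c (Suc (2 * ?s))" using y(3)[OF _ l] cs Delta_kap by simp
      moreover have "c (Suc (2 * ?s)) \<le> c (Suc (2 * l))" using Suc by (intro c_antimono) simp
      ultimately show ?thesis using Suc by (simp add: admissible_def)
    qed (simp add: admissible_def)
    then have "i0 \<le> ?s" using i0_le E cs by simp
    then show "y \<le> kap i0" using kap_antimono[of i0 ?s] by'(4) by simp
  next
    have "Delta mu nu r' \<noteq> Delta mu nu (kap i0)" if r': "r' \<in> set kappa" "kap i0 < r'" for r'
    proof -
      obtain i where i: "kap i = r'" by (rule in_set_kappaE[OF r'(1)])
      then have "i < i0" using r'(2) kap_less_imp_less by simp
      then obtain l where l: "i0 = Suc l" "i \<le> l" by (cases i0) auto
      have "c (Suc (2 * i0)) < c (Suc (2 * l))" using i0 E l by (simp add: admissible_def)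
      also have "\<dots> \<le> c (Suc (2 * i))" by (rule c_antimono(2)[OF l(2)])
      finally show ?thesis unfolding i[symmetric] Delta_kap by simp
    qed
    moreover have "kap i0 \<in> set kappa" using kap_i0 rpos in_set_kappa by auto
    ultimately show "kap i0 \<in> {j \<in> set kappa. nabla mu nu j = nabla mu nu r \<and>
      (\<forall>r'\<in>set kappa. j < r' \<longrightarrow> Delta mu nu r' \<noteq> Delta mu nu j)}"
      using i0 E nabla_kap by (simp add: D_def)
  qed simp
  have ge_i0: "i0 \<le> i" if "kap i \<le> kap i0" for i
  proof (rule ccontr)
    assume "\<not> i0 \<le> i"
    then obtain l where l: "i0 = Suc l" "i \<le> l" by (cases i0) auto
    then have "kap i0 < kap l" using kap_start_of_admissible[of i0] i0 E by simp
    then show False using kap_antimono[OF l(2)] that by simp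
  qed
  have vec: "down_up mu nu r (Suc i) = lower_vec c (2 * i)" if "i \<in> exotic_starts r" for i
    using down_up_eq[OF r v] that by (simp add: exotic_starts_def)
  have weight0: "start_weight c (2 * i0) = xp (2 * int i0)"
  proof -
    have "start_weight c (2 * i0) = xp (int (2 * i0))"
    proof (rule start_weight_first, rule notI)
      fix p assume p: "p < 2 * i0" "even (2 * i0 - p)" "admissible c p" "c p = c (2 * i0)"
      then have "even p" by (simp add: even_diff_nat)
      then obtain i where i: "p = 2 * i" by (rule evenE)
      then have "i \<in> exotic_starts r" using p(3,4) E i0 by simp
      then show False using i0_le p(1) i by force
    qed
    then show ?thesis by simp
  qed
  have "(\<Sum>k | k \<in> set kappa \<and> r < k \<and> k \<le> kap i0.
      (xp (2 * int (mult_ge kappa k)) - xp (2 * int (mult_gt kappa k))) *\<^sub>E down_up mu nu r (mult_ge kappa k + 1)) =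
    (\<Sum>i\<in>exotic_starts r - {i0}. start_weight c (2 * i) *\<^sub>E lower_vec c (2 * i))"
  proof (rule sum.reindex_bij_witness[of _ "\<lambda>i. kap (i - 1)" "\<lambda>k. Suc (kap_end k)"])
    fix i assume "i \<in> exotic_starts r - {i0}"
    then have i: "i \<in> exotic_starts r" "i0 < i" using i0_le[of i] by auto
    then obtain l where l: "i = Suc l" by (cases i) auto
    have lt': "kap i < kap l" using kap_start_of_admissible[of i] i E l by simp
    then show "Suc (kap_end (kap (i - 1))) = i" using kap_end_eq[of l] l by simp
    have "r \<le> kap i" using kap_antimono[OF le_g[OF i(1)]] kap_g by simp
    moreover have "kap l \<le> kap i0" using i l by (intro kap_antimono) simp
    ultimately show "kap (i - 1) \<in> {k \<in> set kappa. r < k \<and> k \<le> kap i0}"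
      using l lt' in_set_kappa by auto
  next
    fix k assume "k \<in> {k \<in> set kappa. r < k \<and> k \<le> kap i0}"
    then have k: "k \<in> set kappa" "r < k" "k \<le> kap i0" by auto
    note bk = kap_block[OF k(1)]
    let ?e = "kap_end k" and ?s = "kap_start k"
    show "kap (Suc ?e - 1) = k" using bk(5) by simp
    have le: "i0 \<le> ?e" "?e < g" using ge_i0[of ?e] bk(5) k kap_less_imp_less[of g ?e] kap_g by auto
    have s: "i0 \<le> ?s" using ge_i0[of ?s] bk(4) k by auto
    have "kap (Suc ?e) < kap ?e" using bk(7)[of "Suc ?e"] bk(5) by simp
    then have adm: "admissible c (2 * Suc ?e)"
      by (rule admissible_of_kap_start) (use mid[of "Suc ?e"] mid[of ?e] le in simp)
    then have inE: "Suc ?e \<in> exotic_starts r" using E mid[of "Suc ?e"] le by simp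
    then show "Suc ?e \<in> exotic_starts r - {i0}" using le by auto
    \<comment> \<open>Competing starts have even position and therefore stand at the first index of
      a part of kappa, so none lies strictly between \<open>2 * ?s\<close> and this one.\<close>
    have "start_weight c (2 * Suc ?e) = xp (int (2 * Suc ?e)) - xp (int (2 * ?s))"
    proof (rule start_weight_next)
      show "2 * ?s < 2 * Suc ?e" "even (2 * Suc ?e - 2 * ?s)" using bk(3) by auto
      show "admissible c (2 * ?s)"
      proof (cases "?s = i0")
        case True
        then show ?thesis using i0 E by simp
      next
        case False
        then obtain l where l: "?s = Suc l" "i0 \<le> l" using s by (cases ?s) auto
        have "kap (Suc l) < kap l" using bk(4) bk(6)[of l] l by simp
        then show ?thesis unfolding l(1)
          by (rule admissible_of_kap_start) (use mid[of "Suc l"] mid[of l] l le bk(3) in simp)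
      qed
      show "c (2 * ?s) = c (2 * Suc ?e)" using mid[of ?s] mid[of "Suc ?e"] s le bk(3) by simp
    next
      fix p assume p: "2 * ?s < p" "p < 2 * Suc ?e" "even (2 * Suc ?e - p)"
      then have "even p" by (simp add: even_diff_nat)
      then obtain l where l: "p = 2 * l" by (rule evenE)
      then have "kap l = k" "kap (l - 1) = k" "l \<noteq> 0" using p(1,2) bk(1)[of l] bk(1)[of "l - 1"] by auto
      then show "\<not> admissible c p" using kap_start_of_admissible[of l] l by auto
    qed
    then show "start_weight c (2 * Suc ?e) *\<^sub>E lower_vec c (2 * Suc ?e) =
      (xp (2 * int (mult_ge kappa k)) - xp (2 * int (mult_gt kappa k))) *\<^sub>E down_up mu nu r (mult_ge kappa k + 1)"
      using vec[OF inE] bk(2) by (simp add: kap_start_def)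
  qed
  moreover have "mult_gt kappa (kap i0) = i0" using start0 by (simp add: kap_start_def)
  ultimately show ?thesis
    unfolding j using vec[OF i0] weight0 by (simp add: sum.remove[OF fin i0])
qed

end

section \<open>Grouping by the parts of mu + nu\<close>

context interlaced_sequence
begin

text \<open>A mu-start is charged to the smallest part with the same nabla, where cases 2 and 4
  collect their tails; a nu-start stays with its own index.\<close>

definition exotic_owner :: "nat \<Rightarrow> nat" where
  "exotic_owner p = (if even p then (LEAST r. \<exists>i. r = kap i \<and> c (2 * i) = c p) else kap (p div 2))"

lemma exotic_owner_even:
  "\<exists>i. exotic_owner (2 * l) = kap i \<and> c (2 * i) = c (2 * l)"
  "c (2 * i) = c (2 * l) \<Longrightarrow> exotic_owner (2 * l) \<le> kap i"
proof -
  have eq: "exotic_owner (2 * l) = (LEAST r. \<exists>i. r = kap i \<and> c (2 * i) = c (2 * l))"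
    by (simp add: exotic_owner_def)
  show "\<exists>i. exotic_owner (2 * l) = kap i \<and> c (2 * i) = c (2 * l)"
    unfolding eq by (rule LeastI[of _ "kap l"]) blast
  show "exotic_owner (2 * l) \<le> kap i" if "c (2 * i) = c (2 * l)"
    unfolding eq by (rule Least_le) (use that in blast)
qed

lemma exotic_owner_odd: "exotic_owner (Suc (2 * l)) = kap l"
  by (simp add: exotic_owner_def)

lemma kap_end_c:
  assumes r: "r \<in> set kappa"
  shows "c (2 * kap_end r) = nabla mu nu r" "c (Suc (2 * kap_end r)) = Delta mu nu r"
    "c (2 * kap_start r) = nabla mu nu r" "c (Suc (2 * kap_start r)) = Delta mu nu r"
  using kap_block_c[OF r] kap_block(3)[OF r] by auto

text \<open>The least part with a given positive nabla is one after which mu strictly falls, that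
  is, a member of \<open>kappa_v\<close>; the same fall is the legality of a nu-start. So parts
  outside \<open>kappa_v\<close> own no starts.\<close>

lemma exotic_starts_owned:
  assumes r: "r \<in> set kappa"
  shows "{p. admissible c p \<and> 0 < c p \<and> exotic_owner p = r} =
    (if r \<in> kappa_v mu nu
     then (\<lambda>i. 2 * i) ` exotic_starts r \<union> (if 0 < Delta mu nu r then {Suc (2 * kap_end r)} else {})
     else {})" (is "?V = ?W")
proof -
  note b = kap_block[OF r] and ec = kap_end_c[OF r] and v = kappa_v_iff[OF r]
  show ?thesis
  proof
    show "?V \<subseteq> ?W"
    proof
      fix p assume "p \<in> ?V"
      then have p: "admissible c p" "0 < c p" "exotic_owner p = r" by auto
      show "p \<in> ?W"
      proof (cases "even p")
        case True
        then obtain l where l: "p = 2 * l" by (rule evenE)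
        obtain i where i: "r = kap i" "c (2 * i) = c p" using exotic_owner_even(1)[of l] p(3) l by auto
        have n: "nabla mu nu r = c p" using nabla_kap[of i] i by simp
        have "c (2 * Suc (kap_end r)) \<noteq> c p"
        proof
          assume "c (2 * Suc (kap_end r)) = c p"
          then have "r \<le> kap (Suc (kap_end r))" using exotic_owner_even(2) p(3) l by metis
          then show False using b(7)[of "Suc (kap_end r)"] by simp
        qed
        then have "c (2 * Suc (kap_end r)) < c (2 * kap_end r)"
          using c_antimono(1)[of "kap_end r" "Suc (kap_end r)"] ec n by simp
        then have "r \<in> kappa_v mu nu" using v by simp
        moreover have "l \<in> exotic_starts r" using p(1) l n by (simp add: exotic_starts_def)
        ultimately show ?thesis using l by auto
      next
        case False
        then obtain l where l: "p = Suc (2 * l)" by (auto elim: oddE)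
        then have kl: "kap l = r" using p(3) exotic_owner_odd by simp
        have adm: "c (2 * Suc l) < c (2 * l)" using p(1) l by (simp add: admissible_def)
        have "kap (Suc l) < kap l" using adm c_antimono(2)[of l "Suc l"] by (simp add: kap_def)
        then have "l = kap_end r" using kap_end_eq kl by auto
        then show ?thesis using v adm l ec p(2) by simp
      qed
    qed
    show "?W \<subseteq> ?V"
    proof
      fix p assume pW: "p \<in> ?W"
      then have kv: "r \<in> kappa_v mu nu" by (auto split: if_splits)
      have lt: "c (2 * Suc (kap_end r)) < c (2 * kap_end r)" using v kv by simp
      from pW kv consider l where "p = 2 * l" "l \<in> exotic_starts r" | "p = Suc (2 * kap_end r)" "0 < Delta mu nu r"
        by (auto split: if_splits)
      then show "p \<in> ?V"
      proof cases
        case 1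
        then have l: "admissible c p" "c p = nabla mu nu r" by (auto simp: exotic_starts_def)
        obtain i where i: "exotic_owner p = kap i" "c (2 * i) = nabla mu nu r"
          using exotic_owner_even(1)[of l] 1(1) l(2) by auto
        have "i \<le> kap_end r"
          using c_antimono(1)[of "Suc (kap_end r)" i] lt ec i(2) by (cases "i \<le> kap_end r") auto
        then have "r \<le> exotic_owner p" using kap_antimono[of i "kap_end r"] b(5) i(1) by simp
        moreover have "exotic_owner p \<le> r" using exotic_owner_even(2)[of "kap_end r" l] b(5) 1(1) l(2) ec by simp
        ultimately show ?thesis using l lt ec by simp
      next
        case 2
        then show ?thesis using exotic_owner_odd b(5) ec lt by (simp add: admissible_def)
      qed
    qed
  qed
qed

lemma exotic_starts_sum:
  assumes r: "r \<in> set kappa"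
  shows "owned_starts c exotic_owner r =
    (if r \<in> kappa_v mu nu
     then (\<Sum>i\<in>exotic_starts r. start_weight c (2 * i) *\<^sub>E lower_vec c (2 * i)) +
       (if 0 < Delta mu nu r
        then start_weight c (Suc (2 * kap_end r)) *\<^sub>E lower_vec c (Suc (2 * kap_end r)) else 0)
     else 0)"
proof (cases "r \<in> kappa_v mu nu")
  case True
  then have "0 < nabla mu nu r" using kappa_v_iff[OF r] kap_end_c[OF r] by simp
  then have fin: "finite (exotic_starts r)" by (rule finite_exotic_starts)
  have im: "sum f ((\<lambda>i. 2 * i) ` exotic_starts r) = (\<Sum>i\<in>exotic_starts r. f (2 * i))" for f :: "nat \<Rightarrow> free_space"
    by (subst sum.reindex) (auto simp: inj_on_def)
  have "Suc (2 * kap_end r) \<notin> (\<lambda>i. 2 * i) ` exotic_starts r" by (auto simp: image_iff) presburger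
  then show ?thesis unfolding exotic_starts_owned[OF r] using True fin im by (auto simp: add.commute)
next
  case False
  then show ?thesis unfolding exotic_starts_owned[OF r] by simp
qed

text \<open>A part can have corners only at the two entries of its last index. If it lies in
  \<open>kappa_v\<close>, the nu-entry is a legal start and weighs nothing; otherwise the mu-entry
  is no corner.\<close>

lemma exotic_corners_sum:
  assumes r: "r \<in> set kappa"
  shows "owned_corners c (\<lambda>q. kap (q div 2)) r =
    (if r \<in> kappa_v mu nu
     then corner_weight c (2 * kap_end r) *\<^sub>E lower_vec c (2 * kap_end r)
     else corner_weight c (Suc (2 * kap_end r)) *\<^sub>E lower_vec c (Suc (2 * kap_end r)))"
    and "r \<in> kappa_v mu nu \<Longrightarrow> corner c (2 * kap_end r)"
    and "r \<notin> kappa_v mu nu \<Longrightarrow> corner c (Suc (2 * kap_end r))"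
proof -
  note b = kap_block[OF r] and v = kappa_v_iff[OF r]
  let ?e = "kap_end r"
  have inside: "q = 2 * ?e \<or> q = Suc (2 * ?e)" if q: "corner c q" "kap (q div 2) = r" for q
  proof -
    define l where "l = q div 2"
    have l: "q = 2 * l \<or> q = Suc (2 * l)" unfolding l_def by presburger
    have "kap (Suc l) \<noteq> kap l"
      using l q(1) kap_eqD[of "Suc l" l] by (auto simp: corner_def)
    then have "kap (Suc l) < kap l" using kap_antimono[of l "Suc l"] by simp
    then have "l = ?e" using kap_end_eq[of l] q(2) by (simp add: l_def)
    then show ?thesis using l by simp
  qed
  show ce: "corner c (2 * ?e)" if "r \<in> kappa_v mu nu" using v that by (simp add: corner_def)
  show co: "corner c (Suc (2 * ?e))" if "r \<notin> kappa_v mu nu"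
  proof -
    have "c (2 * Suc ?e) = c (2 * ?e)" using v that c_antimono(1)[of ?e "Suc ?e"] by simp
    moreover have "kap (Suc ?e) < kap ?e" using b(7)[of "Suc ?e"] b(5) by simp
    ultimately show ?thesis by (simp add: kap_def corner_def)
  qed
  show "owned_corners c (\<lambda>q. kap (q div 2)) r =
    (if r \<in> kappa_v mu nu
     then corner_weight c (2 * kap_end r) *\<^sub>E lower_vec c (2 * kap_end r)
     else corner_weight c (Suc (2 * kap_end r)) *\<^sub>E lower_vec c (Suc (2 * kap_end r)))"
  proof (cases "r \<in> kappa_v mu nu")
    case True
    have "admissible c (Suc (2 * ?e))" using v True by (simp add: admissible_def)
    then have z: "corner_weight c (Suc (2 * ?e)) = 0" by (rule corner_weight_admissible)
    have "owned_corners c (\<lambda>q. kap (q div 2)) r =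
        (\<Sum>q\<in>{2 * ?e}. corner_weight c q *\<^sub>E lower_vec c q)"
    proof (rule sum.mono_neutral_right)
      show "finite {q. corner c q \<and> kap (q div 2) = r}" using finite_corner[OF interlaced] by simp
      show "{2 * ?e} \<subseteq> {q. corner c q \<and> kap (q div 2) = r}" using ce[OF True] b(5) by simp
      show "\<forall>q\<in>{q. corner c q \<and> kap (q div 2) = r} - {2 * ?e}. corner_weight c q *\<^sub>E lower_vec c q = 0"
        using inside z by fastforce
    qed
    then show ?thesis using True by simp
  next
    case False
    have nc: "\<not> corner c (2 * ?e)" using v False by (simp add: corner_def)
    have "{q. corner c q \<and> kap (q div 2) = r} \<subseteq> {Suc (2 * ?e)}"
    proof
      fix q assume "q \<in> {q. corner c q \<and> kap (q div 2) = r}"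
      then have q: "corner c q" "kap (q div 2) = r" by simp_all
      from inside[OF q] nc q(1) show "q \<in> {Suc (2 * ?e)}" by auto
    qed
    moreover have "Suc (2 * ?e) \<in> {q. corner c q \<and> kap (q div 2) = r}" using co[OF False] b(5) by simp
    ultimately have "{q. corner c q \<and> kap (q div 2) = r} = {Suc (2 * ?e)}" by blast
    then show ?thesis using False by simp
  qed
qed

text \<open>Only the nu-corner survives. Its geometric sum stops at the nu-entry of the preceding
  index, which is larger or, because mu falls there, a legal start; hence the base
  \<open>2 * kap_start r\<close>.\<close>

lemma B_outside_eq:
  assumes r: "r \<in> set kappa" and nv: "r \<notin> kappa_v mu nu"
  shows "B_outside mu nu r =
    owned_starts c exotic_owner r + owned_corners c (\<lambda>q. kap (q div 2)) r"
proof -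
  note b = kap_block[OF r] and ec = kap_end_c[OF r] and v = kappa_v_iff[OF r]
  let ?e = "kap_end r" and ?g = "kap_start r"
  have "corner_weight c (Suc (2 * ?e)) = (xp (int (Suc (2 * ?e)) + 1) - xp (int (2 * ?g))) / (x_ind - 1)"
  proof (rule corner_weight_eq)
    show "2 * ?g \<le> Suc (Suc (2 * ?e))" using b(3) by simp
    show "2 * ?g = 0 \<or> even (Suc (Suc (2 * ?e)) - 2 * ?g) \<and>
      (admissible c (2 * ?g - 1) \<or> c (Suc (2 * ?e)) < c (2 * ?g - 1))"
    proof (cases ?g)
      case (Suc l)
      have "kap ?g < kap l" using b(4) b(6)[of l] Suc by simp
      then have "c (Suc (2 * ?g)) < c (Suc (2 * l)) \<or> c (2 * ?g) < c (2 * l)" by (auto simp: kap_def)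
      then show ?thesis using Suc ec by (auto simp: admissible_def)
    qed simp
  next
    fix p assume p: "2 * ?g \<le> p" "p \<le> Suc (2 * ?e)" "even (Suc (2 * ?e) - p)"
    then have "odd p" by (auto simp: even_diff_nat)
    then obtain l where l: "p = Suc (2 * l)" by (auto elim: oddE)
    then have lr: "?g \<le> l" "l \<le> ?e" using p by auto
    have "\<not> c (2 * Suc l) < c (2 * l)"
    proof (cases "l = ?e")
      case True
      then show ?thesis using v nv by simp
    next
      case False
      then show ?thesis using kap_block_c(1)[OF r, of l] kap_block_c(1)[OF r, of "Suc l"] lr by simp
    qed
    then show "\<not> admissible c p \<and> c p \<le> c (Suc (2 * ?e))"
      using l kap_block_c(2)[OF r lr] ec by (simp add: admissible_def)
  qed
  moreover have "2 * int (mult_ge kappa r) = int (Suc (2 * ?e)) + 1" "2 * int (mult_gt kappa r) = int (2 * ?g)"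
    using b(2) by (auto simp: kap_start_def)
  ultimately show ?thesis
    unfolding exotic_starts_sum[OF r] exotic_corners_sum(1)[OF r] B_outside_def Let_def
      nu_lowered_eq[OF r exotic_corners_sum(3)[OF r nv]]
    using nv by simp
qed

text \<open>Outside case 3 the sum stops at the first mu-entry of \<open>r\<close>, a legal start,
  with base 2m(>r) + 1. In case 3 that entry is not legal and the sum runs on to the preceding
  mu-entry, which is larger; the base becomes 2m(>r) - 1.\<close>

lemma kappa_v_corner_weight:
  assumes r: "r \<in> set kappa" and kv: "r \<in> kappa_v mu nu"
  shows "corner_weight c (2 * kap_end r) =
    (xp (2 * int (mult_ge kappa r) - 1) - xp (2 * int (mult_gt kappa r) + (if case3 mu nu r then -1 else 1))) / (x_ind - 1)"
proof -
  note b = kap_block[OF r] and ec = kap_end_c[OF r]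
  let ?e = "kap_end r" and ?g = "kap_start r"
  have inside: "\<not> admissible c (2 * l)" if "?g < l" "l \<le> ?e" for l
    using kap_start_of_admissible[of l] b(1)[of l] b(1)[of "l - 1"] that by auto
  have even_p: "\<exists>l. p = 2 * l \<and> l \<le> ?e" if "p \<le> 2 * ?e" "even (2 * ?e - p)" for p
  proof -
    have "even p" using that by (auto simp: even_diff_nat)
    then show ?thesis using that(1) by (auto elim: evenE)
  qed
  have mult: "2 * int (mult_ge kappa r) - 1 = int (2 * ?e) + 1" "2 * int (mult_gt kappa r) = int (2 * ?g)"
    using b(2) by (auto simp: kap_start_def)
  show ?thesis
  proof (cases "case3 mu nu r")
    case True
    then obtain l where l: "?g = Suc l" "c (Suc (2 * l)) = Delta mu nu r" using case3_iff[OF r] by auto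
    have "kap ?g < kap l" using b(4) b(6)[of l] l by simp
    then have lt: "c (2 * ?g) < c (2 * l)" using l ec by (simp add: kap_def)
    have "corner_weight c (2 * ?e) = (xp (int (2 * ?e) + 1) - xp (int (Suc (2 * l)))) / (x_ind - 1)"
    proof (rule corner_weight_eq)
      show "Suc (2 * l) \<le> Suc (2 * ?e)" using l b(3) by simp
      show "Suc (2 * l) = 0 \<or> even (Suc (2 * ?e) - Suc (2 * l)) \<and>
          (admissible c (Suc (2 * l) - 1) \<or> c (2 * ?e) < c (Suc (2 * l) - 1))"
        using lt ec by simp
    next
      fix p assume p: "Suc (2 * l) \<le> p" "p \<le> 2 * ?e" "even (2 * ?e - p)"
      obtain m where m: "p = 2 * m" "m \<le> ?e" using even_p[OF p(2,3)] by blast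
      then have gm: "?g \<le> m" using p(1) l by simp
      have "\<not> admissible c (2 * ?g)" using l ec by (simp add: admissible_def)
      then show "\<not> admissible c p \<and> c p \<le> c (2 * ?e)"
        using inside[of m] gm m kap_block_c(1)[OF r gm] ec by (cases "m = ?g") auto
    qed
    moreover have "2 * int (mult_gt kappa r) + (if case3 mu nu r then -1 else 1) = int (Suc (2 * l))"
      using True mult l by simp
    ultimately show ?thesis using mult by (simp only:)
  next
    case False
    have adm: "admissible c (2 * ?g)"
    proof (cases ?g)
      case (Suc l)
      then have "c (Suc (2 * l)) \<noteq> c (Suc (2 * ?g))" using False case3_iff[OF r] ec by simp
      moreover have "c (Suc (2 * ?g)) \<le> c (Suc (2 * l))" using Suc by (intro c_antimono) simp
      ultimately show ?thesis using Suc by (simp add: admissible_def)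
    qed (simp add: admissible_def)
    have "corner_weight c (2 * ?e) = (xp (int (2 * ?e) + 1) - xp (int (Suc (2 * ?g)))) / (x_ind - 1)"
    proof (rule corner_weight_eq)
      show "Suc (2 * ?g) \<le> Suc (2 * ?e)" using b(3) by simp
      show "Suc (2 * ?g) = 0 \<or> even (Suc (2 * ?e) - Suc (2 * ?g)) \<and>
          (admissible c (Suc (2 * ?g) - 1) \<or> c (2 * ?e) < c (Suc (2 * ?g) - 1))"
        using adm by simp
    next
      fix p assume p: "Suc (2 * ?g) \<le> p" "p \<le> 2 * ?e" "even (2 * ?e - p)"
      obtain m where m: "p = 2 * m" "m \<le> ?e" using even_p[OF p(2,3)] by blast
      then have gm: "?g < m" using p(1) by simp
      then show "\<not> admissible c p \<and> c p \<le> c (2 * ?e)"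
        using inside[OF gm m(2)] m kap_block_c(1)[OF r _ m(2)] ec by simp
    qed
    moreover have "2 * int (mult_gt kappa r) + (if case3 mu nu r then -1 else 1) = int (Suc (2 * ?g))"
      using False mult by simp
    ultimately show ?thesis using mult by (simp only:)
  qed
qed

text \<open>In case 3 the preceding nu-entry has the same value and is legal, since mu falls there,
  so its power is subtracted. Otherwise an earlier start of the run would force case 3.\<close>

lemma kappa_v_start_weight:
  assumes r: "r \<in> set kappa" and kv: "r \<in> kappa_v mu nu"
  shows "start_weight c (Suc (2 * kap_end r)) =
    xp (2 * int (mult_ge kappa r) - 1) - (if case3 mu nu r then xp (2 * int (mult_gt kappa r) - 1) else 0)"
proof -
  note b = kap_block[OF r] and ec = kap_end_c[OF r]
  let ?e = "kap_end r" and ?g = "kap_start r"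
  have inside: "\<not> admissible c (Suc (2 * l))" if "?g \<le> l" "l < ?e" for l
    using kap_block_c(1)[OF r, of l] kap_block_c(1)[OF r, of "Suc l"] that by (simp add: admissible_def)
  have odd_p: "\<exists>l. p = Suc (2 * l) \<and> l < ?e" if "p < Suc (2 * ?e)" "even (Suc (2 * ?e) - p)" for p
  proof -
    have "odd p" using that by (auto simp: even_diff_nat)
    then show ?thesis using that(1) by (auto elim!: oddE)
  qed
  have mult: "2 * int (mult_ge kappa r) - 1 = int (Suc (2 * ?e))" "2 * int (mult_gt kappa r) = int (2 * ?g)"
    using b(2) by (auto simp: kap_start_def)
  show ?thesis
  proof (cases "case3 mu nu r")
    case True
    then obtain l where l: "?g = Suc l" "c (Suc (2 * l)) = Delta mu nu r" using case3_iff[OF r] by auto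
    have "kap ?g < kap l" using b(4) b(6)[of l] l by simp
    then have lt: "c (2 * ?g) < c (2 * l)" using l ec by (simp add: kap_def)
    have "start_weight c (Suc (2 * ?e)) = xp (int (Suc (2 * ?e))) - xp (int (Suc (2 * l)))"
    proof (rule start_weight_next)
      show "Suc (2 * l) < Suc (2 * ?e)" using l b(3) by simp
      show "even (Suc (2 * ?e) - Suc (2 * l))" by simp
      show "admissible c (Suc (2 * l))" using lt l by (simp add: admissible_def)
      show "c (Suc (2 * l)) = c (Suc (2 * ?e))" using l ec by simp
    next
      fix p assume p: "Suc (2 * l) < p" "p < Suc (2 * ?e)" "even (Suc (2 * ?e) - p)"
      then obtain m where "p = Suc (2 * m)" "m < ?e" using odd_p by blast
      then show "\<not> admissible c p" using inside[of m] p(1) l by simp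
    qed
    moreover have "2 * int (mult_gt kappa r) - 1 = int (Suc (2 * l))" using mult l by simp
    ultimately show ?thesis using True mult by (simp only: if_True)
  next
    case False
    have "start_weight c (Suc (2 * ?e)) = xp (int (Suc (2 * ?e)))"
    proof (rule start_weight_first, rule notI)
      fix p assume p: "p < Suc (2 * ?e)" "even (Suc (2 * ?e) - p)" "admissible c p" "c p = c (Suc (2 * ?e))"
      then obtain m where m: "p = Suc (2 * m)" "m < ?e" using odd_p by blast
      then have "m < ?g" using inside[of m] p(3) by (cases "m < ?g") auto
      then obtain l where l: "?g = Suc l" "m \<le> l" by (cases ?g) auto
      then have "c (Suc (2 * l)) = Delta mu nu r"
        using c_antimono(2)[of m l] c_antimono(2)[of l ?g] p(4) m ec by simp
      then show False using False case3_iff[OF r] l by simp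
    qed
    then show ?thesis using False mult by simp
  qed
qed

text \<open>One formula for cases 2, 3 and 4, which differ only in two coefficients and in the tail.
  The convention for Delta(r) = 0 agrees with \<open>owned_starts\<close>, which admits positive
  entries only.\<close>

lemma exotic_up_down_sum:
  assumes r: "r \<in> set kappa" and kv: "r \<in> kappa_v mu nu"
  shows "owned_starts c exotic_owner r + owned_corners c (\<lambda>q. kap (q div 2)) r =
    (xp (2 * int (mult_ge kappa r) - 1) - (if case3 mu nu r then xp (2 * int (mult_gt kappa r) - 1) else 0)) *\<^sub>E up_down mu nu r +
    ((xp (2 * int (mult_ge kappa r) - 1) - xp (2 * int (mult_gt kappa r) + (if case3 mu nu r then -1 else 1))) / (x_ind - 1)) *\<^sub>E
      mu_lowered mu nu r +
    (\<Sum>i\<in>exotic_starts r. start_weight c (2 * i) *\<^sub>E lower_vec c (2 * i))"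
proof -
  have "up_down mu nu r = (if 0 < Delta mu nu r then lower_vec c (Suc (2 * kap_end r)) else 0)"
    using up_down_eq[OF r kv] by (simp add: up_down_def)
  then show ?thesis
    unfolding exotic_starts_sum[OF r] exotic_corners_sum(1)[OF r] mu_lowered_eq[OF r exotic_corners_sum(2)[OF r kv]]
      kappa_v_corner_weight[OF r kv, symmetric] kappa_v_start_weight[OF r kv, symmetric]
    using kv by (simp add: add_ac)
qed

text \<open>Case 3 has no tail: the mu-entry before the first index is strictly larger and the first
  entry itself is not legal, so the run of nabla(r) offers no start at all.\<close>

lemma B_case3_eq:
  assumes r: "r \<in> set kappa" and kv: "r \<in> kappa_v mu nu" and c3: "case3 mu nu r"
  shows "B_case3 mu nu r =
    owned_starts c exotic_owner r + owned_corners c (\<lambda>q. kap (q div 2)) r"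
proof -
  note b = kap_block[OF r] and ec = kap_end_c[OF r]
  let ?e = "kap_end r" and ?g = "kap_start r"
  obtain l where l: "?g = Suc l" "c (Suc (2 * l)) = Delta mu nu r" using c3 case3_iff[OF r] by auto
  have "kap ?g < kap l" using b(4) b(6)[of l] l by simp
  then have lt: "c (2 * ?g) < c (2 * l)" using l ec by (simp add: kap_def)
  have "i \<notin> exotic_starts r" for i
  proof
    assume "i \<in> exotic_starts r"
    then have i: "admissible c (2 * i)" "c (2 * i) = nabla mu nu r" by (auto simp: exotic_starts_def)
    have "?g \<le> i" using c_antimono(1)[of i l] lt ec i(2) l by (cases "?g \<le> i") auto
    moreover have "i \<noteq> ?g" using i(1) l ec by (auto simp: admissible_def)
    moreover have "i \<le> ?e"
      using c_antimono(1)[of "Suc ?e" i] i(2) ec kv kappa_v_iff[OF r] by (cases "i \<le> ?e") auto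
    ultimately show False using kap_start_of_admissible[OF i(1)] b(1)[of i] b(1)[of "i - 1"] by auto
  qed
  then have "exotic_starts r = {}" by blast
  then show ?thesis unfolding exotic_up_down_sum[OF r kv] B_case3_def Let_def using c3 by simp
qed

lemma B_case4_eq:
  assumes r: "r \<in> set kappa" and kv: "r \<in> kappa_v mu nu" and c3: "\<not> case3 mu nu r"
  shows "B_case4 mu nu r =
    owned_starts c exotic_owner r + owned_corners c (\<lambda>q. kap (q div 2)) r"
  unfolding exotic_up_down_sum[OF r kv] exotic_tail_eq[OF r kv c3, symmetric] B_case4_def Let_def
  using c3 by (simp add: add.assoc)

text \<open>In case 2 the part \<open>r\<close> satisfies the condition on j and no larger part
  does, so j = r and the sum over k is empty.\<close>

lemma B_case2_eq_case4:
  assumes r: "r \<in> set kappa" and c2: "case2 mu nu r"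
  shows "B_case2 mu nu r = B_case4 mu nu r"
proof -
  have j: "j_B mu nu r = r"
    unfolding j_B_def
  proof (rule Max_eqI)
    show "r \<in> {j \<in> set kappa. nabla mu nu j = nabla mu nu r \<and>
        (\<forall>r'\<in>set kappa. j < r' \<longrightarrow> Delta mu nu r' \<noteq> Delta mu nu j)}"
      using r c2 by (auto simp: case2_def)
    show "y \<le> r" if "y \<in> {j \<in> set kappa. nabla mu nu j = nabla mu nu r \<and>
        (\<forall>r'\<in>set kappa. j < r' \<longrightarrow> Delta mu nu r' \<noteq> Delta mu nu j)}" for y
      using that c2 by (force simp: case2_def not_le[symmetric])
  qed simp
  have empty: "{k \<in> set kappa. r < k \<and> k \<le> r} = {}" by auto
  show ?thesis unfolding B_case2_def B_case4_def Let_def j empty by simp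
qed

lemma B_elem_eq_box_sum: "B_elem (bipartition_of c) = box_sum c"
proof -
  let ?S = "\<lambda>r. owned_starts c exotic_owner r + owned_corners c (\<lambda>q. kap (q div 2)) r"
  let ?v = "kappa_v mu nu"
  have v_sub: "?v \<subseteq> set kappa" by (auto simp: kappa_v_def)
  have kap_in: "kap i \<in> set kappa" if "0 < c (2 * i) \<or> 0 < c (Suc (2 * i))" for i
    using that in_set_kappa[of "kap i"] by (auto simp: kap_def)
  have split2: "q = 2 * (q div 2) \<or> q = Suc (2 * (q div 2))" for q :: nat by presburger
  have "box_sum c = (\<Sum>r\<in>set kappa. ?S r)"
  proof (rule box_sum_grouped[OF interlaced])
    show "exotic_owner p \<in> set kappa" if "0 < c p" for p
    proof (cases "even p")
      case True
      then obtain l where l: "p = 2 * l" by (rule evenE)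
      obtain i where "exotic_owner (2 * l) = kap i" "c (2 * i) = c (2 * l)" using exotic_owner_even(1) by blast
      then show ?thesis using kap_in[of i] that l by simp
    next
      case False
      then obtain l where "p = Suc (2 * l)" by (auto elim: oddE)
      then show ?thesis using kap_in[of l] that exotic_owner_odd by simp
    qed
    show "kap (q div 2) \<in> set kappa" if "corner c q" for q
      using split2[of q] that by (intro kap_in) (auto simp: corner_def)
  qed simp
  also have "set kappa = (set kappa - ?v) \<union> ({r. r \<in> ?v \<and> case2 mu nu r} \<union>
      ({r. r \<in> ?v \<and> case3 mu nu r} \<union> {r. r \<in> ?v \<and> case4 mu nu r}))"
    using v_sub case2_iff by blast
  also have "(\<Sum>r\<in>\<dots>. ?S r) = (\<Sum>r\<in>set kappa - ?v. ?S r) + ((\<Sum>r | r \<in> ?v \<and> case2 mu nu r. ?S r) +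
      ((\<Sum>r | r \<in> ?v \<and> case3 mu nu r. ?S r) + (\<Sum>r | r \<in> ?v \<and> case4 mu nu r. ?S r)))"
  proof -
    have fin: "finite {r. r \<in> ?v \<and> Q r}" for Q
      by (rule finite_subset[of _ "set kappa"]) (use v_sub in auto)
    have dis: "{r. r \<in> ?v \<and> case3 mu nu r} \<inter> {r. r \<in> ?v \<and> case4 mu nu r} = {}"
      "{r. r \<in> ?v \<and> case2 mu nu r} \<inter> ({r. r \<in> ?v \<and> case3 mu nu r} \<union> {r. r \<in> ?v \<and> case4 mu nu r}) = {}"
      "(set kappa - ?v) \<inter> ({r. r \<in> ?v \<and> case2 mu nu r} \<union>
        ({r. r \<in> ?v \<and> case3 mu nu r} \<union> {r. r \<in> ?v \<and> case4 mu nu r})) = {}"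
      using v_sub case2_iff case34_disjoint by blast+
    show ?thesis using fin dis by (simp add: sum.union_disjoint)
  qed
  also have "\<dots> = B_elem (mu, nu)"
    unfolding B_elem_def prod.case add.assoc
  proof (intro arg_cong2[of _ _ _ _ "(+)"] sum.cong refl)
    fix r
    show "?S r = B_outside mu nu r" if "r \<in> set kappa - ?v" using B_outside_eq that by simp
    show "?S r = B_case2 mu nu r" if "r \<in> {r. r \<in> ?v \<and> case2 mu nu r}"
      using B_case2_eq_case4 B_case4_eq case2_iff v_sub that by auto
    show "?S r = B_case3 mu nu r" if "r \<in> {r. r \<in> ?v \<and> case3 mu nu r}"
      using B_case3_eq v_sub that by auto
    show "?S r = B_case4 mu nu r" if "r \<in> {r. r \<in> ?v \<and> case4 mu nu r}"
    proof -
      have rk: "r \<in> set kappa" "r \<in> ?v" "case4 mu nu r" using that v_sub by auto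
      then show ?thesis using B_case4_eq[OF rk(1,2)] case34_disjoint[OF rk(1)] by simp
    qed
  qed
  finally show ?thesis by (simp add: bipartition_of_def)
qed

end

subsection \<open>Sizes\<close>

lemma sum_list_partition_of:
  assumes f: "finite_antimono f" and z: "f N = 0"
  shows "sum_list (partition_of f) = sum f {..<N}"
proof -
  define L where "L = (LEAST n. f n = 0)"
  have L: "f L = 0" "L \<le> N" unfolding L_def using z by (rule LeastI, rule Least_le)
  have zero: "f i = 0" if "L \<le> i" for i
    using f that L(1) antimonoD[of f L i] by (simp add: finite_antimono_def)
  have "sum f {..<N} = sum f {..<L}"
  proof (rule sum.mono_neutral_right)
    show "\<forall>i\<in>{..<N} - {..<L}. f i = 0" using zero by simp
  qed (use L(2) in auto)
  then show ?thesis
    by (simp add: partition_of_def L_def[symmetric] interv_sum_list_conv_sum_set_nat atLeast0LessThan)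
qed

lemma sum_even_odd: "sum f {..<2 * N} = (\<Sum>i<N. f (2 * i)) + (\<Sum>i<N. f (Suc (2 * i)))" for f :: "nat \<Rightarrow> nat"
  by (induction N) auto

lemma bipartition_of_in_P2:
  assumes c: "interlaced c" and z: "\<And>i. 2 * N \<le> i \<Longrightarrow> c i = 0"
  shows "bipartition_of c \<in> P2 (sum c {..<2 * N})"
  using finite_antimono_subseq[OF c] z[of "2 * N"] z[of "Suc (2 * N)"]
  by (simp add: P2_def bipartition_of_def is_partition_partition_of sum_list_partition_of[of _ N] sum_even_odd)

text \<open>Each raise is compensated by the drop right after it, so lowering a run costs one box in
  total. The indicator corrects for a cut \<open>M\<close> that separates a raise from its
  drop.\<close>

lemma sum_lower:
  assumes "interlaced c" "0 < c p"
  shows "(\<Sum>i<M. int (lower c p i)) = (\<Sum>i<M. int (c i)) +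
    (if p < M then of_bool (even (M - p) \<and> c M = c p) - 1 else 0)"
proof (induction M)
  case (Suc M)
  consider "M < p" | "M = p" | "p < M" "even (M - p)" | "p < M" "odd (M - p)" by linarith
  then show ?case
  proof cases
    case 1
    then show ?thesis using Suc by simp
  next
    case 2
    then show ?thesis using Suc assms(2) by (simp add: lower_def)
  next
    case 3
    then show ?thesis using Suc assms(2) by (simp add: lower_def Suc_diff_le del: even_diff_nat)
  next
    case 4
    then show ?thesis using Suc by (simp add: lower_def Suc_diff_le del: even_diff_nat)
  qed
qed simp

text \<open>\<open>cmax c i + cmin c (Suc i)\<close> is the maximum plus the minimum of the same two
  entries; regrouping counts every entry twice, up to the boundary. This turns |lambda| = 2n into
  |mu| + |nu| = n.\<close>

lemma sum_csum: "(\<Sum>i<Suc M. csum c i) + cmin c (Suc M) = 2 * (\<Sum>i<Suc M. c i) + c (Suc M)"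
proof (induction M)
  case 0
  then show ?case by (simp add: csum_def cmin_def cmax_def)
next
  case (Suc M)
  have "cmax c (Suc M) + cmin c (Suc (Suc M)) = c (Suc M) + c (Suc (Suc M))"
    by (simp add: cmin_Suc cmax_def)
  moreover have "csum c (Suc M) = cmin c (Suc M) + cmax c (Suc M)" by (simp add: csum_def)
  ultimately show ?case using Suc by simp
qed

lemma E_space_iff: "v \<in> E_space m \<longleftrightarrow> (\<forall>k. k \<notin> P2 m \<longrightarrow> Poly_Mapping.lookup v k = 0)"
  by (auto simp: E_space_def in_keys_iff)

lemma E_space_add: "v \<in> E_space m \<Longrightarrow> w \<in> E_space m \<Longrightarrow> v + w \<in> E_space m"
  by (simp add: E_space_iff lookup_add)

lemma E_space_scale: "v \<in> E_space m \<Longrightarrow> a *\<^sub>E v \<in> E_space m"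
  by (simp add: E_space_iff lookup_scale_E)

lemma E_space_sum: "(\<And>i. i \<in> I \<Longrightarrow> f i \<in> E_space m) \<Longrightarrow> sum f I \<in> E_space m"
  by (simp add: E_space_iff lookup_sum)

lemma e_vec_in_E_space: "k \<in> P2 m \<Longrightarrow> e_vec k \<in> E_space m"
  by (auto simp: E_space_iff e_vec_def lookup_single when_def)

lemma box_sum_in_E_space:
  assumes c: "interlaced c" and z: "\<And>i. 2 * N \<le> i \<Longrightarrow> c i = 0" and n: "sum c {..<2 * N} = n"
  shows "box_sum c \<in> E_space (n - 1)"
proof -
  have v: "lower_vec c p \<in> E_space (n - 1)" if p: "0 < c p" "admissible c p \<or> corner c p" for p
  proof -
    have "p < 2 * N" using z[of p] p(1) by (cases "p < 2 * N") auto
    have zl: "lower c p i = 0" if "2 * N \<le> i" for i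
      using z[OF that] z[of "Suc i"] that p(1) by (simp add: lower_def)
    have "(\<Sum>i<2 * N. int (lower c p i)) = int n - 1"
      using sum_lower[OF c p(1), of "2 * N"] z[of "2 * N"] p(1) \<open>p < 2 * N\<close> n by auto
    then have "sum (lower c p) {..<2 * N} = n - 1" by (simp flip: of_nat_sum)
    then show ?thesis
      using bipartition_of_in_P2[of "lower c p" N, OF interlaced_lower[OF c p] zl]
      by (simp add: lower_vec_def e_vec_in_E_space)
  qed
  then show ?thesis
    unfolding box_sum_def by (intro E_space_add E_space_sum E_space_scale v) (auto simp: corner_def)
qed

theorem theorem13p5:
  fixes n :: nat and lam mu nu :: "nat list" and chi :: "nat \<Rightarrow> nat"
  assumes "n \<ge> 1"
    and "(lam, chi) \<in> Omega n"
    and "(mu, nu) = iota lam chi"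
  shows "A_elem lam chi \<in> E_space (n - 1) \<and> B_elem (mu, nu) \<in> E_space (n - 1) \<and>
         A_elem lam chi = B_elem (mu, nu)"
proof -
  obtain c where c: "interlaced c" and f: "fits lam chi c" by (rule Omega_fits[OF assms(2)])
  have A: "A_elem lam chi = box_sum c" by (rule fitting.A_elem_eq_box_sum) (use c f in unfold_locales)
  have "(mu, nu) = bipartition_of c" using assms(3) iota_eq_bipartition_of[OF c f] by simp
  then have B: "B_elem (mu, nu) = box_sum c"
    using interlaced_sequence.B_elem_eq_box_sum[of c] c by (simp add: interlaced_sequence_def)
  obtain N where N: "\<And>i. N \<le> i \<Longrightarrow> c i = 0" using c by (auto simp: interlaced_def)
  \<comment> \<open>\<open>2 * M\<close> is an even cutoff behind the support, which splits evenly
    between mu and nu, and it is positive, as \<open>sum_csum\<close> speaks of successors.\<close>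
  define M where "M = Suc N"
  have z: "c i = 0" if "2 * M \<le> i" for i using N that by (simp add: M_def)
  have z2: "cmin c (2 * M) = 0" "csum c (2 * M) = 0"
    using z[of "2 * M"] z[of "Suc (2 * M)"] cmin_le[of c "2 * M"] by (auto simp: csum_def cmax_def)
  have "lam = partition_of (csum c)" using f by (intro partition_of_eqI) (auto simp: fits_def)
  moreover have "finite_antimono (csum c)"
    using csum_antimono[OF c] z2 by (auto simp: finite_antimono_def intro!: antimonoI)
  ultimately have "sum_list lam = sum (csum c) {..<2 * M}" using sum_list_partition_of z2 by blast
  moreover have "sum_list lam = 2 * n" using assms(2) by (simp add: Omega_def)
  moreover have "sum (csum c) {..<2 * M} = 2 * sum c {..<2 * M}"
    using sum_csum[of c "2 * M - 1"] z2 z[of "2 * M"] by (simp add: M_def)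
  ultimately have "sum c {..<2 * M} = n" by simp
  then show ?thesis using box_sum_in_E_space[OF c z] A B by simp
qed

end
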